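(* Let $X$ be a maximal Gromov hyperbolic space such that its Gromov boundary $\partial X$ is finite of cardinality $n$ (with $n\ge 4$). Then $X$ is isometric to (the underlying set of) a polyhedral complex $\mathcal{P}\subset\mathbb{R}^n$ embedded in $(\mathbb{R}^n,\|\cdot\|_\infty)$, where $\mathcal{P}$ carries the restriction of the metric $(x,y)\mapsto\|x-y\|_\infty$, with finitely many polyhedral cells, each of dimension at most $n/2$. The polyhedral complex $\mathcal{P}$ is given by attaching $n$ half-lines to a compact polyhedral complex.
   Context: **Gromov hyperbolic spaces.** For a metric space $X$ and $x,y,z\in X$, $(y|z)_x=\frac12(d(y,x)+d(z,x)-d(y,z))$. A geodesic metric space is Gromov hyperbolic if for some $\delta\ge0$ all geodesic triangles are $\delta$-slim. For proper $X$, $\partial X$ is the Gromov boundary (classes of geodesic rays at bounded distance) and $\overline X=X\cup\partial X$ is the Gromov compactification with the cone topology. $X$ is boundary continuous if for each $x$ the Gromov product $(\cdot|\cdot)_x$ extends to a continuous function $\overline X\times\overline X\to[0,+\infty]$. $X$ is geodesically complete if every geodesic (isometric embedding of an interval $I\subseteq\mathbb{R}$) extends to a bi-infinite geodesic $\mathbb{R}\to X$. A *good* Gromov hyperbolic space is one which is proper, geodesic, geodesically complete and boundary continuous. **Moebius maps.** For a good Gromov hyperbolic space $X$ and $x\in X$ let $\rho_x(\xi,\eta)=e^{-(\xi|\eta)_x}$ on $\partial X$. The cross-ratio $[\xi,\xi',\eta,\eta']=\frac{\rho_x(\xi,\eta)\rho_x(\xi',\eta')}{\rho_x(\xi,\eta')\rho_x(\xi',\eta)}$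 of distinct $\xi,\xi',\eta,\eta'\in\partial X$ does not depend on $x$. A homeomorphism between boundaries is Moebius if it preserves cross-ratios. **Maximality.** For a good Gromov hyperbolic space $X$, a hyperbolic filling of $\partial X$ is a pair $(Y,f:\partial Y\to\partial X)$ with $Y$ a good Gromov hyperbolic space and $f$ a Moebius homeomorphism. $X$ is a *maximal Gromov hyperbolic space* if it is good and, for every hyperbolic filling $(Y,f)$ of $\partial X$, there is an isometric embedding $H:Y\to X$ whose extension to the Gromov boundaries is $f$. All boundaries considered are assumed to have at least four points. **Polyhedral complexes.** A polyhedral cell (polyhedron) in $\mathbb{R}^n$ is a non-empty intersection of finitely many closed half-spaces; its dimension is that of its affine hull. A face of a polyhedron $P$ is a set $H\cap P$, where $H$ is a hyperplane such that $P$ lies in one of the closed half-spaces bounded by $H$; $\emptyset$ also counts as a face. A polyhedral complex is a set $\mathcal C$ of polyhedra in $\mathbb{R}^n$ together with $\emptyset$ such that every face of a member is a member and the intersection of two members is a face of both. Its underlying set is the union of its members. "Given by attaching $n$ half-lines to a compact polyhedral complex" means: the underlying set is the union of the underlying set $K$ of a subcomplex with finitely many cells, all bounded, and of $n$ distinct half-lines, each of which meets $K$ exactly in its endpoint, with distinct half-lines meeting at most in their endpoints. *)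

theory Defs
  imports "HOL-Analysis.Analysis"
begin

section \<open>Geodesics and Gromov hyperbolicity\<close>

definition geodesic_on :: "'a metric \<Rightarrow> real set \<Rightarrow> (real \<Rightarrow> 'a) \<Rightarrow> bool" where
  "geodesic_on X I c \<longleftrightarrow>
     c ` I \<subseteq> mspace X \<and> (\<forall>s\<in>I. \<forall>t\<in>I. mdist X (c s) (c t) = \<bar>s - t\<bar>)"

definition geodesic_segment :: "'a metric \<Rightarrow> 'a \<Rightarrow> 'a \<Rightarrow> 'a set \<Rightarrow> bool" where
  "geodesic_segment X x y S \<longleftrightarrow>
     (\<exists>l c. 0 \<le> l \<and> geodesic_on X {0..l} c \<and> c 0 = x \<and> c l = y \<and> S = c ` {0..l})"

definition geodesic_space :: "'a metric \<Rightarrow> bool" where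
  "geodesic_space X \<longleftrightarrow> (\<forall>x\<in>mspace X. \<forall>y\<in>mspace X. \<exists>S. geodesic_segment X x y S)"

text \<open>The sides and vertices are universally quantified, so it suffices to state slimness for
  one side of the triangle.\<close>

definition geodesic_triangles_slim :: "'a metric \<Rightarrow> real \<Rightarrow> bool" where
  "geodesic_triangles_slim X \<delta> \<longleftrightarrow>
     (\<forall>x y z A B C. geodesic_segment X x y A \<and> geodesic_segment X y z B \<and> geodesic_segment X z x C
        \<longrightarrow> (\<forall>a\<in>A. \<exists>b\<in>B \<union> C. mdist X a b \<le> \<delta>))"

definition gromov_hyperbolic :: "'a metric \<Rightarrow> bool" where
  "gromov_hyperbolic X \<longleftrightarrow> geodesic_space X \<and> (\<exists>\<delta>\<ge>0. geodesic_triangles_slim X \<delta>)"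

definition proper_space :: "'a metric \<Rightarrow> bool" where
  "proper_space X \<longleftrightarrow> (\<forall>x\<in>mspace X. \<forall>r. compactin (mtopology_of X) (mcball_of X x r))"

definition geodesically_complete :: "'a metric \<Rightarrow> bool" where
  "geodesically_complete X \<longleftrightarrow>
     (\<forall>I c. is_interval I \<and> I \<noteq> {} \<and> geodesic_on X I c
        \<longrightarrow> (\<exists>c'. geodesic_on X UNIV c' \<and> (\<forall>t\<in>I. c' t = c t)))"

definition gromov_product :: "'a metric \<Rightarrow> 'a \<Rightarrow> 'a \<Rightarrow> 'a \<Rightarrow> real" where
  "gromov_product X x y z = (mdist X y x + mdist X z x - mdist X y z) / 2"


section \<open>The Gromov boundary and the Gromov compactification\<close>

text \<open>A ray is a function on all of \<^typ>\<open>real\<close> whose values at negative arguments are irrelevant.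
  The equivalence classes absorb these values, as asymptoticity only looks at \<open>t \<ge> 0\<close>.\<close>

definition geodesic_ray :: "'a metric \<Rightarrow> (real \<Rightarrow> 'a) \<Rightarrow> bool" where
  "geodesic_ray X r \<longleftrightarrow> geodesic_on X {0..} r"

definition asymptotic_rays :: "'a metric \<Rightarrow> ((real \<Rightarrow> 'a) \<times> (real \<Rightarrow> 'a)) set" where
  "asymptotic_rays X = {(r, r'). geodesic_ray X r \<and> geodesic_ray X r' \<and>
     (\<exists>C. \<forall>t\<ge>0. mdist X (r t) (r' t) \<le> C)}"

definition gromov_boundary :: "'a metric \<Rightarrow> (real \<Rightarrow> 'a) set set" where
  "gromov_boundary X = {r. geodesic_ray X r} // asymptotic_rays X"

type_synonym 'a compactified = "'a + (real \<Rightarrow> 'a) set"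

definition compactification :: "'a metric \<Rightarrow> 'a compactified set" where
  "compactification X = mspace X <+> gromov_boundary X"

text \<open>The cone topology is defined as in Bridson and Haefliger, Definition III.H.3.5. A generalized
  ray issuing from \<open>p\<close> is a geodesic ray or a geodesic on \<open>{0..R}\<close> that is prolonged by its constant
  end value; its end point is a boundary point or a point of the space, respectively.\<close>

definition generalized_ray :: "'a metric \<Rightarrow> 'a \<Rightarrow> (real \<Rightarrow> 'a) \<Rightarrow> 'a compactified \<Rightarrow> bool" where
  "generalized_ray X p c z \<longleftrightarrow> c 0 = p \<and>
     (case z of
        Inl x \<Rightarrow> \<exists>R\<ge>0. geodesic_on X {0..R} c \<and> (\<forall>t\<ge>R. c t = x)
      | Inr \<xi> \<Rightarrow> \<xi> \<in> gromov_boundary X \<and> c \<in> \<xi>)"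

definition converges_on_compacts :: "'a metric \<Rightarrow> (nat \<Rightarrow> real \<Rightarrow> 'a) \<Rightarrow> (real \<Rightarrow> 'a) \<Rightarrow> bool" where
  "converges_on_compacts X c c' \<longleftrightarrow>
     (\<forall>T\<ge>0. \<forall>\<epsilon>>0. \<exists>N. \<forall>n\<ge>N. \<forall>t\<in>{0..T}. mdist X (c n t) (c' t) < \<epsilon>)"

definition cone_converges ::
    "'a metric \<Rightarrow> 'a \<Rightarrow> (nat \<Rightarrow> 'a compactified) \<Rightarrow> 'a compactified \<Rightarrow> bool" where
  "cone_converges X p zs z \<longleftrightarrow>
     (\<exists>c. (\<forall>n. generalized_ray X p (c n) (zs n)) \<and>
          (\<forall>\<sigma>::nat \<Rightarrow> nat. strict_mono \<sigma> \<longrightarrow>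
             (\<exists>(\<tau>::nat \<Rightarrow> nat) c'. strict_mono \<tau> \<and> generalized_ray X p c' z \<and>
                converges_on_compacts X (\<lambda>n. c (\<sigma> (\<tau> n))) c')))"

text \<open>On proper hyperbolic spaces the notion of convergence does not depend on the base point \<open>p\<close>;
  quantifying over all \<open>p\<close> avoids choosing one.\<close>

definition cone_closed :: "'a metric \<Rightarrow> 'a compactified set \<Rightarrow> bool" where
  "cone_closed X B \<longleftrightarrow> B \<subseteq> compactification X \<and>
     (\<forall>p\<in>mspace X. \<forall>zs z. (\<forall>n. zs n \<in> B) \<and> cone_converges X p zs z \<longrightarrow> z \<in> B)"

definition cone_topology :: "'a metric \<Rightarrow> 'a compactified topology" where
  "cone_topology X =
     topology (\<lambda>U. U \<subseteq> compactification X \<and> cone_closed X (compactification X - U))"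

lemma generalized_ray_compactification:
  assumes "generalized_ray X p c z"
  shows "z \<in> compactification X"
proof (cases z)
  case (Inl x)
  then obtain R where "R \<ge> 0" "geodesic_on X {0..R} c" "c R = x"
    using assms by (auto simp: generalized_ray_def)
  then have "x \<in> mspace X"
    by (auto simp: geodesic_on_def)
  then show ?thesis
    using Inl by (simp add: compactification_def InlI)
next
  case (Inr \<xi>)
  then show ?thesis
    using assms by (simp add: generalized_ray_def compactification_def InrI)
qed

lemma cone_converges_compactification:
  assumes "cone_converges X p zs z"
  shows "z \<in> compactification X"
proof -
  obtain c where c: "\<forall>\<sigma>::nat \<Rightarrow> nat. strict_mono \<sigma> \<longrightarrow>
      (\<exists>(\<tau>::nat \<Rightarrow> nat) c'. strict_mono \<tau> \<and> generalized_ray X p c' z \<and>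
         converges_on_compacts X (\<lambda>n. c (\<sigma> (\<tau> n))) c')"
    using assms unfolding cone_converges_def by (elim exE conjE)
  have "strict_mono (\<lambda>n::nat. n)"
    by (simp add: strict_mono_def)
  with spec[OF c, of "\<lambda>n. n"] obtain c' where "generalized_ray X p c' z"
    by (elim impE exE conjE)
  then show ?thesis
    by (rule generalized_ray_compactification)
qed

lemma cone_converges_subseq:
  assumes "cone_converges X p zs z" and \<rho>: "strict_mono (\<rho> :: nat \<Rightarrow> nat)"
  shows "cone_converges X p (\<lambda>n. zs (\<rho> n)) z"
proof -
  obtain c where c: "\<forall>n. generalized_ray X p (c n) (zs n)"
    and sub: "\<forall>\<sigma>::nat \<Rightarrow> nat. strict_mono \<sigma> \<longrightarrow>
      (\<exists>(\<tau>::nat \<Rightarrow> nat) c'. strict_mono \<tau> \<and> generalized_ray X p c' z \<and>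
         converges_on_compacts X (\<lambda>n. c (\<sigma> (\<tau> n))) c')"
    using assms(1) unfolding cone_converges_def by (elim exE conjE)
  show ?thesis
    unfolding cone_converges_def
  proof (intro exI[of _ "\<lambda>n. c (\<rho> n)"] conjI allI impI)
    show "generalized_ray X p (c (\<rho> n)) (zs (\<rho> n))" for n
      using c by (rule spec)
    fix \<sigma> :: "nat \<Rightarrow> nat"
    assume "strict_mono \<sigma>"
    then have "strict_mono (\<lambda>n. \<rho> (\<sigma> n))"
      using \<rho> by (simp add: strict_mono_def)
    from sub[rule_format, OF this]
    show "\<exists>(\<tau>::nat \<Rightarrow> nat) c'. strict_mono \<tau> \<and> generalized_ray X p c' z \<and>
      converges_on_compacts X (\<lambda>n. c (\<rho> (\<sigma> (\<tau> n)))) c'" .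
  qed
qed

lemma cone_closedD:
  assumes "cone_closed X B" "p \<in> mspace X" "\<And>n. zs n \<in> B" "cone_converges X p zs z"
  shows "z \<in> B"
proof -
  have "(\<forall>n. zs n \<in> B) \<and> cone_converges X p zs z \<longrightarrow> z \<in> B"
    using assms(1,2) unfolding cone_closed_def by (elim conjE) (drule (1) bspec, elim allE)
  then show ?thesis
    using assms(3,4) by simp
qed

lemma cone_closed_Un:
  assumes A: "cone_closed X A" and B: "cone_closed X B"
  shows "cone_closed X (A \<union> B)"
  unfolding cone_closed_def
proof (intro conjI ballI allI impI)
  show "A \<union> B \<subseteq> compactification X"
    using assms by (simp add: cone_closed_def)
  fix p zs z
  assume p: "p \<in> mspace X" and zs: "(\<forall>n. zs n \<in> A \<union> B) \<and> cone_converges X p zs z"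
  have *: "z \<in> D" if D: "cone_closed X D" and inf: "infinite {n. zs n \<in> D}" for D
  proof -
    obtain \<rho> :: "nat \<Rightarrow> nat" where \<rho>: "strict_mono \<rho>" "\<forall>n. \<rho> n \<in> {n. zs n \<in> D}"
      using infinite_enumerate[OF inf] by (elim exE conjE)
    have "cone_converges X p (\<lambda>n. zs (\<rho> n)) z"
      by (rule cone_converges_subseq[OF conjunct2[OF zs] \<rho>(1)])
    moreover have "zs (\<rho> n) \<in> D" for n
      using \<rho>(2) by simp
    ultimately show ?thesis
      by (rule cone_closedD[OF D p, rotated])
  qed
  have "{n. zs n \<in> A} \<union> {n. zs n \<in> B} = UNIV"
    using conjunct1[OF zs] by auto
  then have "infinite {n. zs n \<in> A} \<or> infinite {n. zs n \<in> B}"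
    using finite_UnI[of "{n. zs n \<in> A}" "{n. zs n \<in> B}"] by auto
  then show "z \<in> A \<union> B"
    using *[OF A] *[OF B] by auto
qed

lemma istopology_cone:
  "istopology (\<lambda>U. U \<subseteq> compactification X \<and> cone_closed X (compactification X - U))"
proof -
  have "cone_closed X (compactification X - S \<inter> T)"
    if "cone_closed X (compactification X - S)" "cone_closed X (compactification X - T)" for S T
    using cone_closed_Un[OF that] by (simp add: Diff_Int)
  moreover have "cone_closed X (compactification X - \<Union>\<K>)"
    if \<K>: "\<forall>K\<in>\<K>. cone_closed X (compactification X - K)" for \<K>
    unfolding cone_closed_def
  proof (intro conjI ballI allI impI)
    show "compactification X - \<Union>\<K> \<subseteq> compactification X"
      by blast
    fix p zs z
    assume p: "p \<in> mspace X"
      and zs: "(\<forall>n. zs n \<in> compactification X - \<Union>\<K>) \<and> cone_converges X p zs z"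
    have "z \<notin> K" if "K \<in> \<K>" for K
    proof -
      have "zs n \<in> compactification X - K" for n
        using conjunct1[OF zs, rule_format, of n] that by auto
      then have "z \<in> compactification X - K"
        by (rule cone_closedD[OF bspec[OF \<K> that] p _ conjunct2[OF zs]])
      then show ?thesis
        by simp
    qed
    moreover have "z \<in> compactification X"
      by (rule cone_converges_compactification[OF conjunct2[OF zs]])
    ultimately show "z \<in> compactification X - \<Union>\<K>"
      by blast
  qed
  ultimately show ?thesis
    unfolding istopology_def by blast
qed

lemma openin_cone_topology:
  "openin (cone_topology X) U \<longleftrightarrow>
     U \<subseteq> compactification X \<and> cone_closed X (compactification X - U)"
  by (simp add: cone_topology_def topology_inverse'[OF istopology_cone])

lemma topspace_cone_topology [simp]: "topspace (cone_topology X) = compactification X"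
proof -
  have "openin (cone_topology X) (compactification X)"
    by (simp add: openin_cone_topology cone_closed_def)
  then show ?thesis
    using openin_subset[of "cone_topology X" "compactification X"]
      openin_cone_topology[of X "topspace (cone_topology X)"]
    by auto
qed

definition boundary_topology :: "'a metric \<Rightarrow> (real \<Rightarrow> 'a) set topology" where
  "boundary_topology X = pullback_topology (gromov_boundary X) Inr (cone_topology X)"


section \<open>Boundary continuity and good spaces\<close>

definition extends_gromov_product ::
    "'a metric \<Rightarrow> 'a \<Rightarrow> ('a compactified \<times> 'a compactified \<Rightarrow> ereal) \<Rightarrow> bool" where
  "extends_gromov_product X x G \<longleftrightarrow>
     continuous_map (prod_topology (cone_topology X) (cone_topology X)) (top_of_set {0..}) G \<and>
     (\<forall>y\<in>mspace X. \<forall>z\<in>mspace X. G (Inl y, Inl z) = ereal (gromov_product X x y z))"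

definition boundary_continuous :: "'a metric \<Rightarrow> bool" where
  "boundary_continuous X \<longleftrightarrow> (\<forall>x\<in>mspace X. \<exists>G. extends_gromov_product X x G)"

definition good_gromov_hyperbolic :: "'a metric \<Rightarrow> bool" where
  "good_gromov_hyperbolic X \<longleftrightarrow> gromov_hyperbolic X \<and> proper_space X \<and> geodesic_space X \<and>
     geodesically_complete X \<and> boundary_continuous X"

text \<open>A continuous extension is unique on the compactification, since the space is dense in its
  compactification; so the choice below only affects values at irrelevant arguments.\<close>

definition boundary_gromov_product ::
    "'a metric \<Rightarrow> 'a \<Rightarrow> (real \<Rightarrow> 'a) set \<Rightarrow> (real \<Rightarrow> 'a) set \<Rightarrow> ereal" where
  "boundary_gromov_product X x \<xi> \<eta> = (SOME G. extends_gromov_product X x G) (Inr \<xi>, Inr \<eta>)"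


section \<open>Moebius maps and maximality\<close>

definition visual_rho :: "'a metric \<Rightarrow> 'a \<Rightarrow> (real \<Rightarrow> 'a) set \<Rightarrow> (real \<Rightarrow> 'a) set \<Rightarrow> real" where
  "visual_rho X x \<xi> \<eta> =
     (if boundary_gromov_product X x \<xi> \<eta> = \<infinity> then 0
      else exp (- real_of_ereal (boundary_gromov_product X x \<xi> \<eta>)))"

definition cross_ratio :: "'a metric \<Rightarrow> 'a \<Rightarrow> (real \<Rightarrow> 'a) set \<Rightarrow> (real \<Rightarrow> 'a) set \<Rightarrow>
    (real \<Rightarrow> 'a) set \<Rightarrow> (real \<Rightarrow> 'a) set \<Rightarrow> real" where
  "cross_ratio X x \<xi> \<xi>' \<eta> \<eta>' =
     (visual_rho X x \<xi> \<eta> * visual_rho X x \<xi>' \<eta>') / (visual_rho X x \<xi> \<eta>' * visual_rho X x \<xi>' \<eta>)"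

text \<open>Cross-ratios do not depend on the base point, so all pairs of base points may be allowed.\<close>

definition moebius_homeomorphism ::
    "'b metric \<Rightarrow> 'a metric \<Rightarrow> ((real \<Rightarrow> 'b) set \<Rightarrow> (real \<Rightarrow> 'a) set) \<Rightarrow> bool" where
  "moebius_homeomorphism Y X f \<longleftrightarrow>
     homeomorphic_map (boundary_topology Y) (boundary_topology X) f \<and>
     (\<forall>y\<in>mspace Y. \<forall>x\<in>mspace X.
        \<forall>\<xi>\<in>gromov_boundary Y. \<forall>\<xi>'\<in>gromov_boundary Y.
        \<forall>\<eta>\<in>gromov_boundary Y. \<forall>\<eta>'\<in>gromov_boundary Y.
          distinct [\<xi>, \<xi>', \<eta>, \<eta>'] \<longrightarrow>
            cross_ratio X x (f \<xi>) (f \<xi>') (f \<eta>) (f \<eta>') = cross_ratio Y y \<xi> \<xi>' \<eta> \<eta>')"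

definition hyperbolic_filling ::
    "'a metric \<Rightarrow> 'b metric \<Rightarrow> ((real \<Rightarrow> 'b) set \<Rightarrow> (real \<Rightarrow> 'a) set) \<Rightarrow> bool" where
  "hyperbolic_filling X Y f \<longleftrightarrow> good_gromov_hyperbolic Y \<and> moebius_homeomorphism Y X f"

definition isometric_embedding :: "'b metric \<Rightarrow> 'a metric \<Rightarrow> ('b \<Rightarrow> 'a) \<Rightarrow> bool" where
  "isometric_embedding Y X H \<longleftrightarrow>
     H ` mspace Y \<subseteq> mspace X \<and>
     (\<forall>y\<in>mspace Y. \<forall>y'\<in>mspace Y. mdist X (H y) (H y') = mdist Y y y')"

text \<open>The extension of an isometric embedding \<open>H\<close> to the boundaries sends the class of a ray \<open>r\<close> to
  the class of \<open>H \<circ> r\<close>.\<close>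

definition extends_to_boundary ::
    "'b metric \<Rightarrow> ('b \<Rightarrow> 'a) \<Rightarrow> ((real \<Rightarrow> 'b) set \<Rightarrow> (real \<Rightarrow> 'a) set) \<Rightarrow> bool" where
  "extends_to_boundary Y H f \<longleftrightarrow> (\<forall>\<xi>\<in>gromov_boundary Y. \<forall>r\<in>\<xi>. H \<circ> r \<in> f \<xi>)"

text \<open>In higher-order logic one cannot quantify over fillings of arbitrary types inside a formula.
  The fillings \<open>Y\<close> therefore range over all metric spaces whose points lie in the type
  \<^typ>\<open>nat \<Rightarrow> real\<close>, with an arbitrary metric. This is no restriction up to isometry, because a good
  space is proper: see the lemma \<open>proper_space_isometric_copy\<close>.\<close>

definition maximal_gromov_hyperbolic :: "'a metric \<Rightarrow> bool" where
  "maximal_gromov_hyperbolic X \<longleftrightarrow> good_gromov_hyperbolic X \<and>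
     (\<forall>(Y :: (nat \<Rightarrow> real) metric) f. hyperbolic_filling X Y f \<longrightarrow>
        (\<exists>H. isometric_embedding Y X H \<and> extends_to_boundary Y H f))"

lemma proper_space_isometric_copy:
  fixes X :: "'a metric"
  assumes "proper_space X"
  shows "\<exists>(Y :: (nat \<Rightarrow> real) metric) h. isometric_embedding X Y h \<and> h ` mspace X = mspace Y"
proof -
  interpret Metric_space "mspace X" "mdist X"
    by (rule Metric_space_mspace_mdist)
  obtain h :: "'a \<Rightarrow> nat \<Rightarrow> real" where h: "inj_on h (mspace X)"
  proof (cases "mspace X = {}")
    case True
    then show ?thesis using that[of "\<lambda>_ _. 0"] by simp
  next
    case False
    then obtain p where p: "p \<in> mspace X"
      by blast
    have "\<exists>K. finite K \<and> K \<subseteq> mspace X \<and> mcball p (real k) \<subseteq> (\<Union>x\<in>K. mball x (1 / Suc m))" for k m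
    proof -
      have "compactin mtopology (mcball p (real k))"
        using assms p by (auto simp: proper_space_def mtopology_of_def mcball_of_def)
      then have "mtotally_bounded (mcball p (real k))"
        by (rule compactin_imp_mtotally_bounded)
      then obtain K where "finite K" "K \<subseteq> mcball p (real k)"
          "mcball p (real k) \<subseteq> (\<Union>x\<in>K. mball x (1 / Suc m))"
        unfolding mtotally_bounded_def by (metis of_nat_0_less_iff zero_less_Suc zero_less_divide_1_iff)
      moreover have "mcball p (real k) \<subseteq> mspace X"
        by auto
      ultimately show ?thesis
        by blast
    qed
    then obtain K where K: "\<And>k m. finite (K k m)" "\<And>k m. K k m \<subseteq> mspace X"
        "\<And>k m. mcball p (real k) \<subseteq> (\<Union>x\<in>K k m. mball x (1 / Suc m))"
      by metis
    define Q where "Q = (\<Union>k m. K k m)"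
    have "countable Q"
      unfolding Q_def by (intro countable_UN countableI_type countable_finite K(1))
    moreover have "Q \<subseteq> mspace X"
      unfolding Q_def using K(2) by blast
    ultimately have Q: "countable Q" "Q \<subseteq> mspace X" .
    have dense: "\<exists>q\<in>Q. mdist X q x < \<epsilon>" if x: "x \<in> mspace X" and \<epsilon>: "\<epsilon> > 0" for x \<epsilon>
    proof -
      obtain k where k: "mdist X p x \<le> real k"
        using real_arch_simple by blast
      obtain m where m: "1 / Suc m < \<epsilon>"
        using \<epsilon> nat_approx_posE by blast
      have "x \<in> mcball p (real k)"
        using k x p by simp
      then obtain q where "q \<in> K k m" "x \<in> mball q (1 / Suc m)"
        using K(3) by blast
      then show ?thesis
        using m by (intro bexI[of _ q]) (auto simp: Q_def)
    qed
    have Q_ne: "Q \<noteq> {}"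
      using dense[OF p, of 1] by auto
    have "inj_on (\<lambda>x n. mdist X (from_nat_into Q n) x) (mspace X)"
    proof (rule inj_onI, rule ccontr)
      fix x y
      assume x: "x \<in> mspace X" and y: "y \<in> mspace X" and "x \<noteq> y"
        and eq: "(\<lambda>n. mdist X (from_nat_into Q n) x) = (\<lambda>n. mdist X (from_nat_into Q n) y)"
      then have "mdist X x y > 0"
        by simp
      then obtain q where q: "q \<in> Q" "mdist X q x < mdist X x y / 2"
        using dense[OF x, of "mdist X x y / 2"] by auto
      obtain n where "from_nat_into Q n = q"
        using from_nat_into_surj[OF Q(1) q(1)] by blast
      then have "mdist X q x = mdist X q y"
        using fun_cong[OF eq, of n] by simp
      moreover have "mdist X x y \<le> mdist X x q + mdist X q y"
        using x y q Q by (intro triangle) auto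
      moreover have "mdist X x q = mdist X q x"
        by (rule commute)
      ultimately show False
        using q(2) by simp
    qed
    then show ?thesis
      using that by blast
  qed
  define g where "g = inv_into (mspace X) h"
  have g: "g (h x) = x" if "x \<in> mspace X" for x
    using h that by (simp add: g_def)
  define d where "d = (\<lambda>a b. mdist X (g a) (g b))"
  interpret H: Metric_space "h ` mspace X" d
  proof
    show "0 \<le> d a b" "d a b = d b a" for a b
      by (simp_all add: d_def commute)
    show "d a b = 0 \<longleftrightarrow> a = b" if "a \<in> h ` mspace X" "b \<in> h ` mspace X" for a b
      using that by (auto simp: d_def g)
    show "d a c \<le> d a b + d b c"
      if "a \<in> h ` mspace X" "b \<in> h ` mspace X" "c \<in> h ` mspace X" for a b c
      using that by (auto simp: d_def g triangle)
  qed
  have "isometric_embedding X (metric (h ` mspace X, d)) h"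
    unfolding isometric_embedding_def H.mspace_metric H.mdist_metric by (simp add: d_def g)
  then show ?thesis
    using H.mspace_metric by metis
qed


section \<open>Polyhedral complexes\<close>

text \<open>The supporting hyperplane is a genuine one (\<open>a \<noteq> 0\<close>), unlike in \<^const>\<open>exposed_face_of\<close>.\<close>

definition polyhedral_face :: "'m::euclidean_space set \<Rightarrow> 'm set \<Rightarrow> bool" where
  "polyhedral_face P F \<longleftrightarrow> F = {} \<or>
     (\<exists>a b. a \<noteq> 0 \<and> P \<subseteq> {x. a \<bullet> x \<le> b} \<and> F = {x. a \<bullet> x = b} \<inter> P)"

text \<open>The intersection axiom concerns two different members: with the above notion of face, a
  full-dimensional polyhedron is not a face of itself.\<close>

definition polyhedral_complex :: "'m::euclidean_space set set \<Rightarrow> bool" where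
  "polyhedral_complex \<C> \<longleftrightarrow>
     {} \<in> \<C> \<and>
     (\<forall>P\<in>\<C>. polyhedron P) \<and>
     (\<forall>P\<in>\<C>. \<forall>F. polyhedral_face P F \<longrightarrow> F \<in> \<C>) \<and>
     (\<forall>P\<in>\<C>. \<forall>Q\<in>\<C>. P \<noteq> Q \<longrightarrow> polyhedral_face P (P \<inter> Q) \<and> polyhedral_face Q (P \<inter> Q))"

definition half_line :: "'m::real_vector \<Rightarrow> 'm \<Rightarrow> 'm set" where
  "half_line p u = {p + t *\<^sub>R u | t. 0 \<le> t}"

definition attached_half_lines :: "nat \<Rightarrow> 'm::euclidean_space set set \<Rightarrow> bool" where
  "attached_half_lines n \<C> \<longleftrightarrow>
     (\<exists>\<K> p u. \<K> \<subseteq> \<C> \<and> polyhedral_complex \<K> \<and> finite \<K> \<and> (\<forall>P\<in>\<K>. bounded P) \<and>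
        (\<forall>i<n. u i \<noteq> 0) \<and>
        inj_on (\<lambda>i. half_line (p i) (u i)) {..<n} \<and>
        \<Union>\<C> = \<Union>\<K> \<union> (\<Union>i<n. half_line (p i) (u i)) \<and>
        (\<forall>i<n. half_line (p i) (u i) \<inter> \<Union>\<K> = {p i}) \<and>
        (\<forall>i<n. \<forall>j<n. i \<noteq> j \<longrightarrow>
           half_line (p i) (u i) \<inter> half_line (p j) (u j) \<subseteq> {p i} \<inter> {p j}))"

definition isometric_to_sup_norm_set :: "'a metric \<Rightarrow> 'm::euclidean_space set \<Rightarrow> bool" where
  "isometric_to_sup_norm_set X S \<longleftrightarrow>
     (\<exists>\<phi>. \<phi> ` mspace X = S \<and>
        (\<forall>x\<in>mspace X. \<forall>y\<in>mspace X. infnorm (\<phi> x - \<phi> y) = mdist X x y))"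

end

theory Submission
  imports Defs
begin

text \<open>Fix a base point \<open>x\<close> of \<open>X\<close> and let \<open>D \<xi> \<eta> = - 2 (\<xi>|\<eta>)\<^sub>x\<close> for \<open>\<xi> \<noteq> \<eta>\<close> in \<open>\<partial>X\<close>. The Busemann
  functions \<open>b\<^sub>\<xi>\<close> normalized at \<open>x\<close> satisfy \<open>b\<^sub>\<xi> + b\<^sub>\<eta> \<ge> D \<xi> \<eta>\<close>. Since geodesics extend and \<open>\<partial>X\<close> is
  finite, every \<open>\<xi>\<close> has at each point of \<open>X\<close> a partner \<open>\<eta>\<close> for which equality holds, and \<open>y \<mapsto> (b\<^sub>\<xi> y)\<^sub>\<xi>\<close> is an
  isometric embedding into the tight span of \<open>D\<close> with the sup norm, that is, the set of all \<open>v\<close> with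
  \<open>v\<^sub>\<xi> + v\<^sub>\<eta> \<ge> D \<xi> \<eta>\<close> and equality for some partner of each \<open>\<xi>\<close>. The tight span is the union of those faces of
  a polyhedron that it contains, and it consists of a bounded core with one half-line for each \<open>\<xi>\<close>. It is
  itself a filling of \<open>\<partial>X\<close>. By maximality it embeds into \<open>X\<close>; in Busemann coordinates this embedding
  is a translation, and the tight constraints force the translation to be trivial. Hence \<open>X\<close> fills the
  tight span.\<close>

section \<open>The tight span\<close>

text \<open>Maximality only sees fillings that are good, so the main burden is to show that the
  tight span is hyperbolic, proper, geodesically complete and boundary continuous. Two facts carry
  it. The feasible polyhedron retracts onto the tight span by a 1-Lipschitz map, which turns
  straight paths into geodesics and rays. And below a threshold \<open>\<alpha> i\<close> coordinate
  \<open>i\<close> alone determines a point and its distances to all others, so Gromov products near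
  infinity equal their limits instead of merely approaching them. The cone topology is defined by
  convergence of generalized rays, so each neighbourhood has to be shown open by following rays.
  Finiteness of the boundary has a second use besides tightness: it makes the boundary topology
  discrete, so that a bijection of indices is already a homeomorphism.\<close>

lemma infnorm_le_iff_cart: "infnorm v \<le> c \<longleftrightarrow> (\<forall>i. \<bar>v $ i\<bar> \<le> c)" for v :: "real ^ 'n"
proof
  assume "infnorm v \<le> c"
  then show "\<forall>i. \<bar>v $ i\<bar> \<le> c"
    using component_le_infnorm_cart order_trans by blast
next
  assume "\<forall>i. \<bar>v $ i\<bar> \<le> c"
  then show "infnorm v \<le> c"
    unfolding infnorm_cart by (intro cSup_least) auto
qed

lemma infnorm_attained_cart: "\<exists>i. infnorm v = \<bar>v $ i\<bar>" for v :: "real ^ 'n"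
proof -
  have "infnorm v = Max (range (\<lambda>i. \<bar>v $ i\<bar>))"
    unfolding infnorm_cart by (simp add: cSup_eq_Max full_SetCompr_eq)
  moreover have "Max (range (\<lambda>i. \<bar>v $ i\<bar>)) \<in> range (\<lambda>i. \<bar>v $ i\<bar>)"
    by (intro Max_in) auto
  ultimately show ?thesis by (metis rangeE)
qed

lemma infnorm_diff_triangle: "infnorm (a - c) \<le> infnorm (a - b) + infnorm (b - c)"
  using infnorm_triangle[of "a - b" "b - c"] by simp

text \<open>In the application \<open>D\<close> is -2 times a Gromov product, so it is no metric and
  its values are at most 0. The diagonal carries no constraint because the product of a boundary
  point with itself is infinite. Three indices make the minimum in \<open>\<alpha>\<close> range
  over a nonempty set.\<close>

locale tight_span =
  fixes D :: "'n::finite \<Rightarrow> 'n \<Rightarrow> real"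
  assumes sym: "D i j = D j i" and card3: "3 \<le> CARD('n)"
begin

definition feasible :: "(real ^ 'n) set" where
  "feasible = {v. \<forall>i j. i \<noteq> j \<longrightarrow> D i j \<le> v $ i + v $ j}"

definition tspan :: "(real ^ 'n) set" where
  "tspan = {v \<in> feasible. \<forall>i. \<exists>j. j \<noteq> i \<and> v $ i + v $ j = D i j}"

definition pivots :: "'n \<Rightarrow> ('n \<times> 'n) set" where
  "pivots i = {(j, k). j \<noteq> i \<and> k \<noteq> i \<and> j \<noteq> k}"

text \<open>The smallest Gromov product \<open>(j|k)\<close> at base \<open>i\<close> when
  \<open>D\<close> is read as a distance. It is the height at which the end towards \<open>i\<close>
  starts: a tight pair that avoids \<open>i\<close> forces \<open>v $ i\<close> to be at least this
  value.\<close>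

definition \<alpha> :: "'n \<Rightarrow> real" where
  "\<alpha> i = Min ((\<lambda>(j, k). (D i j + D i k - D j k) / 2) ` pivots i)"

definition end_point :: "'n \<Rightarrow> real \<Rightarrow> real ^ 'n" where
  "end_point i a = (\<chi> k. if k = i then a else D i k - a)"

lemma feasibleD: "v \<in> feasible \<Longrightarrow> i \<noteq> j \<Longrightarrow> D i j \<le> v $ i + v $ j"
  by (simp add: feasible_def)

lemma tspan_feasible: "v \<in> tspan \<Longrightarrow> v \<in> feasible"
  by (simp add: tspan_def)

lemma tspan_tight:
  assumes "v \<in> tspan" obtains j where "j \<noteq> i" "v $ i + v $ j = D i j"
  using assms by (auto simp: tspan_def)

lemma exists_other: "\<exists>k::'n. k \<noteq> i \<and> k \<noteq> j"
proof (rule ccontr)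
  assume "\<not> ?thesis"
  then have "(UNIV :: 'n set) \<subseteq> {i, j}"
    by auto
  then have "CARD('n) \<le> card {i, j}"
    by (intro card_mono) auto
  also have "\<dots> \<le> 2"
    by (simp add: card_insert_if)
  finally show False
    using card3 by simp
qed

lemma pivots_nonempty: "pivots i \<noteq> {}"
proof -
  obtain j where "j \<noteq> i"
    using exists_other by blast
  moreover obtain k where "k \<noteq> i" "k \<noteq> j"
    using exists_other by blast
  ultimately show ?thesis
    by (auto simp: pivots_def)
qed

section \<open>Ends of the tight span and the thresholds where they begin\<close>

lemma alpha_le:
  assumes "j \<noteq> i" "k \<noteq> i" "j \<noteq> k"
  shows "2 * \<alpha> i \<le> D i j + D i k - D j k"
proof -
  have "\<alpha> i \<le> (D i j + D i k - D j k) / 2"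
    unfolding \<alpha>_def using assms by (intro Min_le) (auto simp: pivots_def image_iff)
  then show ?thesis by simp
qed

lemma alpha_attained:
  obtains j k where "j \<noteq> i" "k \<noteq> i" "j \<noteq> k" "2 * \<alpha> i = D i j + D i k - D j k"
proof -
  have "\<alpha> i \<in> (\<lambda>(j, k). (D i j + D i k - D j k) / 2) ` pivots i"
    unfolding \<alpha>_def using pivots_nonempty by (intro Min_in) auto
  then show ?thesis
    using that by (auto simp: pivots_def)
qed

text \<open>Adding the bounds on \<open>\<alpha> i\<close> and \<open>\<alpha> j\<close> that come
  from a third index \<open>k\<close> cancels every term with \<open>k\<close>. This keeps two ends
  from overlapping in more than an end point.\<close>

lemma alpha_sum:
  assumes "i \<noteq> j" shows "\<alpha> i + \<alpha> j \<le> D i j"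
proof -
  obtain k where k: "k \<noteq> i" "k \<noteq> j"
    using exists_other by blast
  show ?thesis
    using alpha_le[of j i k] alpha_le[of i j k] k assms sym[of i j] sym[of i k] sym[of j k] by simp
qed

lemma end_point_nth [simp]:
  "end_point i a $ i = a" "k \<noteq> i \<Longrightarrow> end_point i a $ k = D i k - a"
  by (simp_all add: end_point_def)

lemma end_point_tspan:
  assumes "a \<le> \<alpha> i" shows "end_point i a \<in> tspan"
proof -
  have "D k l \<le> end_point i a $ k + end_point i a $ l" if "k \<noteq> l" for k l
    using that alpha_le[of k i l] assms sym[of k i] by (auto simp: end_point_def)
  moreover have "\<exists>j. j \<noteq> k \<and> end_point i a $ k + end_point i a $ j = D k j" for k
  proof (cases "k = i")
    case True
    obtain j where "j \<noteq> i" using exists_other by blast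
    then show ?thesis using True by (intro exI[of _ j]) auto
  next
    case False
    then show ?thesis using sym[of k i] by (intro exI[of _ i]) auto
  qed
  ultimately show ?thesis
    by (simp add: tspan_def feasible_def)
qed

text \<open>If the partner \<open>k\<close> of \<open>j\<close> is not \<open>i\<close>, then
  \<open>v $ j + v $ i \<le> D j k - D i k + 2 * v $ i\<close>, and below \<open>\<alpha> i\<close>
  the right side is at most \<open>D i j\<close>. Either way the pair \<open>i\<close>,
  \<open>j\<close> is tight, so the end is a single line.\<close>

lemma tspan_below_alpha:
  assumes v: "v \<in> tspan" and le: "v $ i \<le> \<alpha> i"
  shows "v = end_point i (v $ i)"
proof (rule vec_eq_iff[THEN iffD2], rule allI)
  fix j
  show "v $ j = end_point i (v $ i) $ j"
  proof (cases "j = i")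
    case False
    obtain k where k: "k \<noteq> j" "v $ j + v $ k = D j k"
      using tspan_tight[OF v] by blast
    have *: "D i j \<le> v $ i + v $ j"
      using feasibleD[OF tspan_feasible[OF v]] False by metis
    have "v $ i + v $ j \<le> D i j"
    proof (cases "k = i")
      case True
      then show ?thesis using k sym[of j i] by simp
    next
      case ki: False
      have "D i k \<le> v $ i + v $ k"
        using feasibleD[OF tspan_feasible[OF v]] ki by metis
      then show ?thesis
        using k * alpha_le[of j i k] ki False le by auto
    qed
    with * False show ?thesis by simp
  qed simp
qed

text \<open>At the lower point \<open>v\<close> all constraints with \<open>i\<close> are tight,
  while \<open>w\<close> satisfies them and has partners; this confines every other coordinate
  difference to the one in coordinate \<open>i\<close>. Only \<open>v\<close> has to lie in the end,
  so distances from an end to any point are read off one coordinate.\<close>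

lemma tspan_dist_below_aux:
  assumes v: "v \<in> tspan" and w: "w \<in> tspan" and le: "v $ i \<le> \<alpha> i" "v $ i \<le> w $ i"
  shows "infnorm (v - w) = w $ i - v $ i"
proof (rule antisym)
  show "w $ i - v $ i \<le> infnorm (v - w)"
    using component_le_infnorm_cart[of "v - w" i] by simp
  have "\<bar>v $ j - w $ j\<bar> \<le> w $ i - v $ i" for j
  proof (cases "j = i")
    case False
    have vj: "v $ j = D i j - v $ i"
      using tspan_below_alpha[OF v le(1)] False by (metis end_point_nth(2))
    have "D i j \<le> w $ i + w $ j"
      using feasibleD[OF tspan_feasible[OF w]] False by metis
    moreover obtain k where k: "k \<noteq> j" "w $ j + w $ k = D j k"
      using tspan_tight[OF w] by blast
    have "w $ j \<le> D i j - v $ i + (w $ i - v $ i)"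
    proof (cases "k = i")
      case True
      then show ?thesis using k sym[of j i] le by simp
    next
      case ki: False
      have "D i k \<le> w $ i + w $ k"
        using feasibleD[OF tspan_feasible[OF w]] ki by metis
      then show ?thesis
        using k alpha_le[of j i k] ki False le by auto
    qed
    ultimately show ?thesis
      using vj by simp
  qed (use le in simp)
  then show "infnorm (v - w) \<le> w $ i - v $ i"
    by (simp add: infnorm_le_iff_cart)
qed

lemma tspan_dist_below:
  assumes v: "v \<in> tspan" and w: "w \<in> tspan" and le: "v $ i \<le> \<alpha> i \<or> w $ i \<le> \<alpha> i"
  shows "infnorm (v - w) = \<bar>v $ i - w $ i\<bar>"
proof (cases "v $ i \<le> w $ i")
  case True
  then show ?thesis using tspan_dist_below_aux[OF v w] le by auto
next
  case False
  then show ?thesis using tspan_dist_below_aux[OF w v, of i] le infnorm_sub[of v w] by auto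
qed

text \<open>A partner \<open>j\<close> of \<open>i\<close> gives
  \<open>v $ i = D i j - v $ j \<le> D i j - \<alpha> j\<close>, an upper bound that complements the
  lower bound \<open>\<alpha> i\<close>.\<close>

lemma tspan_above_alpha_bounded:
  obtains C where "\<And>v i. v \<in> tspan \<Longrightarrow> (\<And>i. \<alpha> i \<le> v $ i) \<Longrightarrow> \<bar>v $ i\<bar> \<le> C"
proof -
  define A where "A = (\<Sum>i\<in>UNIV. \<bar>\<alpha> i\<bar>)"
  define B where "B = (\<Sum>i\<in>UNIV. \<Sum>j\<in>UNIV. \<bar>D i j\<bar>)"
  have A: "\<bar>\<alpha> i\<bar> \<le> A" for i
    unfolding A_def by (rule member_le_sum) auto
  have B: "\<bar>D i j\<bar> \<le> B" for i j
  proof -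
    have "\<bar>D i j\<bar> \<le> (\<Sum>j\<in>UNIV. \<bar>D i j\<bar>)"
      by (rule member_le_sum) auto
    also have "\<dots> \<le> B"
      unfolding B_def by (rule member_le_sum) (auto intro: sum_nonneg)
    finally show ?thesis .
  qed
  have "\<bar>v $ i\<bar> \<le> A + B" if v: "v \<in> tspan" and ge: "\<And>i. \<alpha> i \<le> v $ i" for v i
  proof -
    obtain j where "v $ i + v $ j = D i j"
      using tspan_tight[OF v] by blast
    then show ?thesis
      using ge[of i] ge[of j] A[of i] A[of j] B[of i j] by linarith
  qed
  then show ?thesis by (rule that)
qed

text \<open>Lower the coordinates one after the other as far as feasibility allows. A constraint that is
  tight stays tight, because neither of its coordinates can be lowered any further.\<close>

definition lower :: "'n \<Rightarrow> real ^ 'n \<Rightarrow> real ^ 'n" where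
  "lower i v = (\<chi> k. if k = i then Max ((\<lambda>j. D i j - v $ j) ` (UNIV - {i})) else v $ k)"

lemma lower_nth_other [simp]: "k \<noteq> i \<Longrightarrow> lower i v $ k = v $ k"
  by (simp add: lower_def)

lemma lower_nth_ge: "j \<noteq> i \<Longrightarrow> D i j - v $ j \<le> lower i v $ i"
  by (auto simp: lower_def intro!: Max_ge)

lemma lower_nth_attained: obtains j where "j \<noteq> i" "lower i v $ i = D i j - v $ j"
proof -
  obtain j where "j \<noteq> i" using exists_other by blast
  then have "Max ((\<lambda>j. D i j - v $ j) ` (UNIV - {i})) \<in> (\<lambda>j. D i j - v $ j) ` (UNIV - {i})"
    by (intro Max_in) auto
  then show ?thesis using that by (auto simp: lower_def)
qed

lemma lower_le:
  assumes "v \<in> feasible" shows "lower i v $ k \<le> v $ k"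
proof (cases "k = i")
  case True
  obtain j where "j \<noteq> i" "lower i v $ i = D i j - v $ j"
    by (rule lower_nth_attained)
  then show ?thesis
    using feasibleD[OF assms, of i j] True by simp
qed simp

lemma lower_feasible:
  assumes "v \<in> feasible" shows "lower i v \<in> feasible"
proof -
  have "D j k \<le> lower i v $ j + lower i v $ k" if "j \<noteq> k" for j k
    using that feasibleD[OF assms, of j k] lower_nth_ge[of k i v] lower_nth_ge[of j i v] sym[of j i]
    by (cases "j = i"; cases "k = i") auto
  then show ?thesis
    by (simp add: feasible_def)
qed

lemma lower_tight:
  assumes v: "v \<in> feasible" and jk: "j \<noteq> k" "v $ j + v $ k = D j k"
  shows "lower i v $ j + lower i v $ k = D j k"
  using lower_le[OF v, of i j] lower_le[OF v, of i k] feasibleD[OF lower_feasible[OF v, of i] jk(1)] jk(2)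
  by linarith

lemma lower_lipschitz: "infnorm (lower i v - lower i w) \<le> infnorm (v - w)"
proof -
  have *: "\<bar>v $ j - w $ j\<bar> \<le> infnorm (v - w)" for j
    using component_le_infnorm_cart[of "v - w" j] by simp
  obtain j where j: "j \<noteq> i" "lower i v $ i = D i j - v $ j"
    by (rule lower_nth_attained)
  obtain k where k: "k \<noteq> i" "lower i w $ i = D i k - w $ k"
    by (rule lower_nth_attained)
  have "\<bar>lower i v $ i - lower i w $ i\<bar> \<le> infnorm (v - w)"
    using lower_nth_ge[OF k(1), of v] lower_nth_ge[OF j(1), of w] j k *[of j] *[of k] by linarith
  then have "\<bar>(lower i v - lower i w) $ l\<bar> \<le> infnorm (v - w)" for l
    using * by (cases "l = i") auto
  then show ?thesis
    by (simp add: infnorm_le_iff_cart)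
qed

lemma lower_tspan:
  assumes "v \<in> tspan" shows "lower i v = v"
proof -
  obtain j where "j \<noteq> i" "v $ i + v $ j = D i j"
    using tspan_tight[OF assms] by blast
  then have "v $ i \<le> lower i v $ i"
    using lower_nth_ge[of j i v] by simp
  then show ?thesis
    using lower_le[OF tspan_feasible[OF assms], of i i]
    by (metis lower_nth_other order_antisym vec_eq_iff)
qed

text \<open>The induction grows the set \<open>S\<close> of indices that already have a partner;
  \<open>lower i\<close> adds \<open>i\<close> and destroys no tight pair. The coordinatewise
  decrease is recorded because it pins down the speed of rays in \<open>tspan_ray\<close>.\<close>

lemma retraction:
  obtains p where
    "\<And>v. v \<in> feasible \<Longrightarrow> p v \<in> tspan" "\<And>v k. v \<in> feasible \<Longrightarrow> p v $ k \<le> v $ k"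
    "\<And>v w. infnorm (p v - p w) \<le> infnorm (v - w)" "\<And>v. v \<in> tspan \<Longrightarrow> p v = v"
proof -
  have "\<exists>p. (\<forall>v\<in>feasible. p v \<in> feasible \<and> (\<forall>k. p v $ k \<le> v $ k) \<and>
          (\<forall>i\<in>S. \<exists>j. j \<noteq> i \<and> p v $ i + p v $ j = D i j)) \<and>
        (\<forall>v w. infnorm (p v - p w) \<le> infnorm (v - w)) \<and> (\<forall>v\<in>tspan. p v = v)" for S :: "'n set"
    using finite[of S]
  proof (induction S rule: finite_induct)
    case empty
    show ?case by (rule exI[of _ "\<lambda>v. v"]) simp
  next
    case (insert i S)
    then obtain p where p: "\<And>v. v \<in> feasible \<Longrightarrow> p v \<in> feasible"
      "\<And>v k. v \<in> feasible \<Longrightarrow> p v $ k \<le> v $ k"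
      "\<And>v i. v \<in> feasible \<Longrightarrow> i \<in> S \<Longrightarrow> \<exists>j. j \<noteq> i \<and> p v $ i + p v $ j = D i j"
      "\<And>v w. infnorm (p v - p w) \<le> infnorm (v - w)" "\<And>v. v \<in> tspan \<Longrightarrow> p v = v"
      by metis
    show ?case
    proof (intro exI[of _ "\<lambda>v. lower i (p v)"] conjI ballI allI)
      fix v k assume v: "v \<in> feasible"
      show "lower i (p v) \<in> feasible"
        using p(1) v lower_feasible by blast
      show "lower i (p v) $ k \<le> v $ k"
        using p(1,2) v lower_le order_trans by metis
    next
      fix v k assume v: "v \<in> feasible" and k: "k \<in> insert i S"
      show "\<exists>j. j \<noteq> k \<and> lower i (p v) $ k + lower i (p v) $ j = D k j"
      proof (cases "k = i")
        case True
        obtain j where "j \<noteq> i" "lower i (p v) $ i = D i j - p v $ j"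
          by (rule lower_nth_attained)
        then show ?thesis using True by (intro exI[of _ j]) simp
      next
        case False
        then obtain j where "j \<noteq> k" "p v $ k + p v $ j = D k j"
          using p(3) v k by blast
        then show ?thesis
          using lower_tight[OF p(1)[OF v]] by metis
      qed
    next
      fix v w
      show "infnorm (lower i (p v) - lower i (p w)) \<le> infnorm (v - w)"
        using lower_lipschitz p(4) order_trans by blast
    next
      fix v assume "v \<in> tspan"
      then show "lower i (p v) = v"
        using p(5) lower_tspan by simp
    qed
  qed
  from this[of UNIV] obtain p where p: "\<forall>v\<in>feasible. p v \<in> feasible \<and> (\<forall>k. p v $ k \<le> v $ k) \<and>
        (\<forall>i\<in>UNIV. \<exists>j. j \<noteq> i \<and> p v $ i + p v $ j = D i j)"
      "\<forall>v w. infnorm (p v - p w) \<le> infnorm (v - w)" "\<forall>v\<in>tspan. p v = v"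
    by blast
  show ?thesis
    by (rule that[of p]) (use p in \<open>simp_all add: tspan_def\<close>)
qed

text \<open>The polyhedron is convex, so the straight segment lies in it, and its image under the
  retraction is 1-Lipschitz with unchanged end points. A 1-Lipschitz path over an interval as long
  as the distance of its ends cannot lose length anywhere, hence is isometric.\<close>

lemma tspan_geodesic:
  assumes v: "v \<in> tspan" and w: "w \<in> tspan"
  obtains c where "c 0 = v" "c (infnorm (v - w)) = w"
    "\<And>t. 0 \<le> t \<Longrightarrow> t \<le> infnorm (v - w) \<Longrightarrow> c t \<in> tspan"
    "\<And>s t. 0 \<le> s \<Longrightarrow> s \<le> infnorm (v - w) \<Longrightarrow> 0 \<le> t \<Longrightarrow> t \<le> infnorm (v - w) \<Longrightarrow>
       infnorm (c s - c t) = \<bar>s - t\<bar>"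
proof -
  define l where "l = infnorm (v - w)"
  obtain p where p: "\<And>v. v \<in> feasible \<Longrightarrow> p v \<in> tspan"
    "\<And>v w. infnorm (p v - p w) \<le> infnorm (v - w)" "\<And>v. v \<in> tspan \<Longrightarrow> p v = v"
    using retraction by metis
  \<comment> \<open>If \<open>l = 0\<close> the quotient is 0, which gives the constant path at
    \<open>v = w\<close>.\<close>
  define g where "g t = v + (t / l) *\<^sub>R (w - v)" for t
  define c where "c = p \<circ> g"
  have l0: "0 \<le> l" by (simp add: l_def infnorm_pos_le)
  have g0: "g 0 = v" by (simp add: g_def)
  have gl: "g l = w"
  proof (cases "l = 0")
    case True
    then have "v = w" by (simp add: l_def infnorm_eq_0)
    then show ?thesis by (simp add: g_def)
  qed (simp add: g_def)
  have g: "g t \<in> feasible" if t: "0 \<le> t" "t \<le> l" for t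
  proof -
    define \<mu> where "\<mu> = t / l"
    have \<mu>: "0 \<le> \<mu>" "\<mu> \<le> 1"
      using t by (auto simp: \<mu>_def divide_le_eq_1)
    have "D i j \<le> g t $ i + g t $ j" if "i \<noteq> j" for i j
    proof -
      have "(1 - \<mu>) * D i j \<le> (1 - \<mu>) * (v $ i + v $ j)" "\<mu> * D i j \<le> \<mu> * (w $ i + w $ j)"
        using \<mu> feasibleD[OF tspan_feasible[OF v] that] feasibleD[OF tspan_feasible[OF w] that]
        by (auto intro: mult_left_mono)
      then show ?thesis
        by (simp add: g_def \<mu>_def[symmetric] algebra_simps)
    qed
    then show ?thesis by (simp add: feasible_def)
  qed
  have glip: "infnorm (g s - g t) \<le> \<bar>s - t\<bar>" for s t
  proof -
    have "g s - g t = ((s - t) / l) *\<^sub>R (w - v)"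
      by (simp add: g_def algebra_simps diff_divide_distrib)
    then have "infnorm (g s - g t) = \<bar>(s - t) / l\<bar> * l"
      using infnorm_sub[of v w] by (simp add: infnorm_mul l_def)
    then show ?thesis using l0 by (cases "l = 0") auto
  qed
  have clip: "infnorm (c s - c t) \<le> \<bar>s - t\<bar>" for s t
    unfolding c_def o_def using p(2) glip order_trans by blast
  have c0: "c 0 = v" and cl: "c l = w"
    using p(3) v w g0 gl by (simp_all add: c_def)
  have le: "t - s \<le> infnorm (c s - c t)" if "0 \<le> s" "s \<le> t" "t \<le> l" for s t
  proof -
    have "l \<le> infnorm (c 0 - c s) + infnorm (c s - c t) + infnorm (c t - c l)"
      unfolding c0 cl unfolding l_def
      using infnorm_diff_triangle[of v w "c s"] infnorm_diff_triangle[of "c s" w "c t"] by linarith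
    then show ?thesis
      using clip[of 0 s] clip[of t l] that by simp
  qed
  show ?thesis
  proof (rule that[of c, folded l_def, OF c0 cl])
    show "c t \<in> tspan" if "0 \<le> t" "t \<le> l" for t
      using p(1) g[OF that] by (simp add: c_def)
    show "infnorm (c s - c t) = \<bar>s - t\<bar>" if "0 \<le> s" "s \<le> l" "0 \<le> t" "t \<le> l" for s t
      using that clip[of s t] le[of s t] le[of t s] infnorm_sub[of "c s" "c t"]
      by (cases "s \<le> t") auto
  qed
qed

text \<open>Raising all other coordinates at the rate at which \<open>i\<close> falls keeps every
  constraint. The retraction can only lower coordinate \<open>i\<close> further, but a 1-Lipschitz
  path cannot move it by more than \<open>t\<close>, so the rate is exactly 1.\<close>

lemma tspan_ray:
  assumes v: "v \<in> tspan"
  obtains c where "c 0 = v" "\<And>t. 0 \<le> t \<Longrightarrow> c t \<in> tspan" "\<And>t. 0 \<le> t \<Longrightarrow> c t $ i = v $ i - t"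
    "\<And>s t. infnorm (c s - c t) \<le> \<bar>s - t\<bar>"
proof -
  obtain p where p: "\<And>v. v \<in> feasible \<Longrightarrow> p v \<in> tspan" "\<And>v k. v \<in> feasible \<Longrightarrow> p v $ k \<le> v $ k"
    "\<And>v w. infnorm (p v - p w) \<le> infnorm (v - w)" "\<And>v. v \<in> tspan \<Longrightarrow> p v = v"
    using retraction by metis
  define g where "g t = (\<chi> k. if k = i then v $ k - t else v $ k + t)" for t
  define c where "c = p \<circ> g"
  have g: "g t \<in> feasible" if t: "0 \<le> t" for t
  proof -
    have "D j k \<le> g t $ j + g t $ k" if "j \<noteq> k" for j k
      using feasibleD[OF tspan_feasible[OF v] that] t that by (auto simp: g_def)
    then show ?thesis by (simp add: feasible_def)
  qed
  have "infnorm (g s - g t) \<le> \<bar>s - t\<bar>" for s t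
    by (auto simp: infnorm_le_iff_cart g_def)
  then have clip: "infnorm (c s - c t) \<le> \<bar>s - t\<bar>" for s t
    unfolding c_def o_def using p(3) order_trans by blast
  have "g 0 = v"
    by (simp add: g_def vec_eq_iff)
  then have c0: "c 0 = v"
    using p(4) v by (simp add: c_def)
  show ?thesis
  proof (rule that[of c, OF c0 _ _ clip])
    show "c t \<in> tspan" if "0 \<le> t" for t
      using p(1) g[OF that] by (simp add: c_def)
    show "c t $ i = v $ i - t" if "0 \<le> t" for t
    proof -
      have "c t $ i \<le> g t $ i"
        using p(2) g[OF that] by (simp add: c_def)
      moreover have "\<bar>c 0 $ i - c t $ i\<bar> \<le> t"
        using component_le_infnorm_cart[of "c 0 - c t" i] clip[of 0 t] that by simp
      ultimately show ?thesis
        using c0 by (simp add: g_def)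
    qed
  qed
qed

text \<open>When the largest coordinate difference has the wrong sign at \<open>k\<close>, a partner
  \<open>j\<close> of \<open>k\<close> at \<open>w\<close> turns it around: the constraint at
  \<open>v\<close> makes \<open>j\<close> gain at least what \<open>k\<close> loses.\<close>

lemma tspan_direction:
  assumes v: "v \<in> tspan" and w: "w \<in> tspan"
  obtains i where "v $ i - w $ i = infnorm (v - w)"
proof -
  obtain k where k: "infnorm (v - w) = \<bar>v $ k - w $ k\<bar>"
    using infnorm_attained_cart[of "v - w"] by auto
  show ?thesis
  proof (cases "v $ k \<ge> w $ k")
    case True
    then show ?thesis using that k by simp
  next
    case False
    obtain j where j: "j \<noteq> k" "w $ k + w $ j = D k j"
      using tspan_tight[OF w] by blast
    have "D k j \<le> v $ k + v $ j"
      using feasibleD[OF tspan_feasible[OF v]] j by metis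
    then have "infnorm (v - w) \<le> v $ j - w $ j"
      using k j False by simp
    then show ?thesis
      using that[of j] component_le_infnorm_cart[of "v - w" j] by simp
  qed
qed

lemma closed_feasible: "closed feasible"
proof -
  have "feasible = (\<Inter>i. \<Inter>j. {v. i \<noteq> j \<longrightarrow> D i j \<le> v $ i + v $ j})"
    by (auto simp: feasible_def)
  also have "closed \<dots>"
  proof (intro closed_INT ballI)
    fix i j
    show "closed {v. i \<noteq> j \<longrightarrow> D i j \<le> v $ i + v $ j}"
      by (cases "i = j") (auto intro!: closed_Collect_le continuous_intros)
  qed
  finally show ?thesis .
qed

lemma closed_tspan: "closed tspan"
proof -
  have "tspan = feasible \<inter> (\<Inter>i. \<Union>j\<in>UNIV - {i}. {v. v $ i + v $ j = D i j})"
    by (auto simp: tspan_def)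
  moreover have "closed {v :: real ^ 'n. v $ i + v $ j = D i j}" for i j
    by (intro closed_Collect_eq continuous_intros)
  ultimately show ?thesis
    by (simp add: closed_Int closed_feasible closed_INT closed_UN)
qed

end

section \<open>The polyhedral structure of the tight span\<close>

lemma polyhedral_face_imp_face_of:
  assumes "polyhedral_face P F" "convex P"
  shows "F face_of P"
proof (cases "F = {}")
  case False
  then obtain a b where "P \<subseteq> {x. a \<bullet> x \<le> b}" "F = {x. a \<bullet> x = b} \<inter> P"
    using assms(1) by (auto simp: polyhedral_face_def)
  then show ?thesis
    using face_of_Int_supporting_hyperplane_le[OF assms(2), of a b] by (auto simp: Int_commute)
qed simp

lemma proper_face_imp_polyhedral_face:
  assumes "polyhedron P" "F face_of P" "F \<noteq> P"
  shows "polyhedral_face P F"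
proof -
  have "F exposed_face_of P"
    using assms exposed_face_of_polyhedron by blast
  then show ?thesis
    using assms(3) unfolding exposed_face_of polyhedral_face_def by blast
qed

lemma polyhedral_face_subset:
  assumes "polyhedral_face Q F" "P \<subseteq> Q" "F \<subseteq> P"
  shows "polyhedral_face P F"
  using assms unfolding polyhedral_face_def by blast

text \<open>\<open>S\<close> is left open because the lemma serves both the whole tight span and its
  compact core. The delicate axiom is the one on intersections, when one cell contains the
  other.\<close>

lemma polyhedral_complex_faces:
  assumes Q: "polyhedron Q"
  shows "polyhedral_complex {F. F face_of Q \<and> F \<subseteq> S}"
  unfolding polyhedral_complex_def
proof (intro conjI ballI allI impI)
  show "{} \<in> {F. F face_of Q \<and> F \<subseteq> S}"
    by simp
  show "polyhedron P" if "P \<in> {F. F face_of Q \<and> F \<subseteq> S}" for P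
    using that Q face_of_polyhedron_polyhedron by blast
  show "F \<in> {F. F face_of Q \<and> F \<subseteq> S}"
    if P: "P \<in> {F. F face_of Q \<and> F \<subseteq> S}" and F: "polyhedral_face P F" for P F
  proof -
    have "F face_of P"
      using F P polyhedral_face_imp_face_of face_of_imp_convex by blast
    then show ?thesis
      using P face_of_trans face_of_imp_subset by blast
  qed
  have *: "polyhedral_face A (A \<inter> B)"
    if A: "A face_of Q" and B: "B face_of Q" and ne: "A \<noteq> B" for A B
  proof -
    have "polyhedron A" "polyhedron B"
      using A B Q face_of_polyhedron_polyhedron by auto
    have int: "A \<inter> B face_of Q"
      using A B face_of_Int by blast
    show ?thesis
    proof (cases "A \<inter> B = A")
      case False
      have "A \<inter> B face_of A"
        using int A face_of_subset face_of_imp_subset by (metis inf.cobounded1)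
      then show ?thesis
        using False \<open>polyhedron A\<close> proper_face_imp_polyhedral_face by blast
    next
      case True
      \<comment> \<open>As a face of itself \<open>A\<close> need not be cut out by a genuine hyperplane, but as a proper face
        of \<open>B\<close> it is, and the same hyperplane works for \<open>A\<close>.\<close>
      have "A \<inter> B face_of B"
        using int B face_of_subset face_of_imp_subset by (metis inf.cobounded2)
      then have "polyhedral_face B (A \<inter> B)"
        using True ne \<open>polyhedron B\<close> proper_face_imp_polyhedral_face by blast
      then show ?thesis
        using True polyhedral_face_subset by blast
    qed
  qed
  show "polyhedral_face P (P \<inter> R)" "polyhedral_face R (P \<inter> R)"
    if "P \<in> {F. F face_of Q \<and> F \<subseteq> S}" "R \<in> {F. F face_of Q \<and> F \<subseteq> S}" "P \<noteq> R" for P R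
    using *[of P R] *[of R P] that by (auto simp: Int_commute)
qed

text \<open>Ore's theorem: the complement of a minimal dominating set is dominating as well.\<close>

lemma small_dominating_set:
  fixes R :: "'a::finite \<Rightarrow> 'a \<Rightarrow> bool"
  assumes sym: "\<And>i j. R i j \<Longrightarrow> R j i" and ex: "\<And>i. \<exists>j. j \<noteq> i \<and> R i j"
  obtains S where "2 * card S \<le> CARD('a)" "\<And>j. j \<notin> S \<Longrightarrow> \<exists>s\<in>S. R s j"
proof -
  define dom where "dom S \<longleftrightarrow> (\<forall>j. j \<notin> S \<longrightarrow> (\<exists>s\<in>S. R s j))" for S
  have "dom UNIV" by (simp add: dom_def)
  then obtain S where S: "dom S" and min: "\<And>T. dom T \<Longrightarrow> card S \<le> card T"
    using ex_has_least_nat[of dom UNIV card] by blast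
  have "dom (- S)"
    unfolding dom_def
  proof (intro allI impI, rule ccontr)
    fix s assume "s \<notin> - S" and no: "\<not> (\<exists>t\<in>-S. R t s)"
    then have s: "s \<in> S" by simp
    \<comment> \<open>An \<open>s\<close> without neighbour outside \<open>S\<close> is redundant:
      its own neighbour lies in \<open>S\<close> and dominates it, and no vertex outside
      \<open>S\<close> relied on \<open>s\<close>.\<close>
    have "dom (S - {s})"
      unfolding dom_def
    proof (intro allI impI)
      fix j assume j: "j \<notin> S - {s}"
      show "\<exists>t\<in>S - {s}. R t j"
      proof (cases "j = s")
        case True
        obtain k where "k \<noteq> s" "R s k" using ex by blast
        then show ?thesis using True no sym by blast
      next
        case False
        then obtain t where "t \<in> S" "R t j"
          using S j by (auto simp: dom_def)
        moreover have "t \<noteq> s"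
          using \<open>R t j\<close> no sym j False by auto
        ultimately show ?thesis by blast
      qed
    qed
    then have "card S \<le> card (S - {s})" by (rule min)
    then show False
      using s by (metis card_Diff1_less finite leD)
  qed
  then have "card S \<le> card (- S)" by (rule min)
  moreover have "card (- S) = CARD('a) - card S"
    by (simp add: Compl_eq_Diff_UNIV card_Diff_subset)
  ultimately have "2 * card S \<le> CARD('a)"
    using card_mono[of UNIV S] by simp
  then show ?thesis
    using that S by (auto simp: dom_def)
qed

section \<open>Cells of the tight span: tight faces, the compact core, the dimension bound\<close>

context tight_span
begin

definition core :: "(real ^ 'n) set" where
  "core = {v \<in> tspan. \<forall>i. \<alpha> i \<le> v $ i}"

text \<open>For feasible \<open>v\<close>, the smallest face of the polyhedron that contains
  \<open>v\<close>.\<close>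

definition tight_face :: "real ^ 'n \<Rightarrow> (real ^ 'n) set" where
  "tight_face v = {w \<in> feasible. \<forall>i j. i \<noteq> j \<longrightarrow> v $ i + v $ j = D i j \<longrightarrow> w $ i + w $ j = D i j}"

lemma inner_axis_pair: "(axis i 1 + axis j 1) \<bullet> v = v $ i + v $ j" for v :: "real ^ 'n"
  by (simp add: inner_add_left inner_axis')

lemma polyhedron_feasible: "polyhedron feasible"
proof -
  have "feasible = \<Inter> ((\<lambda>(i, j). {v. (axis i 1 + axis j 1) \<bullet> v \<ge> D i j}) ` {(i, j). i \<noteq> j})"
    by (auto simp: feasible_def inner_axis_pair)
  also have "polyhedron \<dots>"
    by (rule polyhedron_Inter) (auto intro: polyhedron_halfspace_ge)
  finally show ?thesis .
qed

lemma tight_face_face_of: "tight_face v face_of feasible"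
proof -
  let ?E = "{(i, j). i \<noteq> j \<and> v $ i + v $ j = D i j}"
  let ?F = "\<lambda>(i, j). feasible \<inter> {w. (axis i 1 + axis j 1) \<bullet> w = D i j}"
  have cv: "convex feasible"
    by (rule polyhedron_imp_convex[OF polyhedron_feasible])
  \<comment> \<open>\<open>feasible\<close> is a member so that the family is nonempty even if no
    constraint is tight at \<open>v\<close>.\<close>
  have "\<Inter> (insert feasible (?F ` ?E)) face_of feasible"
  proof (rule face_of_Inter)
    fix T assume "T \<in> insert feasible (?F ` ?E)"
    then consider "T = feasible"
      | i j where "i \<noteq> j" "T = feasible \<inter> {w. (axis i 1 + axis j 1) \<bullet> w = D i j}"
      by auto
    then show "T face_of feasible"
    proof cases
      case 1
      then show ?thesis using cv face_of_refl by blast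
    next
      case (2 i j)
      then show ?thesis
        using face_of_Int_supporting_hyperplane_ge[OF cv, of "D i j" "axis i 1 + axis j 1"] feasibleD
        by (simp add: inner_axis_pair)
    qed
  qed simp
  also have "\<Inter> (insert feasible (?F ` ?E)) = tight_face v"
    by (auto simp: tight_face_def inner_axis_pair)
  finally show ?thesis .
qed

lemma tight_face_tspan: "v \<in> tspan \<Longrightarrow> tight_face v \<subseteq> tspan"
proof (rule subsetI)
  fix w assume v: "v \<in> tspan" and w: "w \<in> tight_face v"
  have "\<exists>j. j \<noteq> i \<and> w $ i + w $ j = D i j" for i
  proof -
    obtain j where "j \<noteq> i" "v $ i + v $ j = D i j"
      using tspan_tight[OF v] by blast
    then show ?thesis
      using w by (intro exI[of _ j]) (simp add: tight_face_def)
  qed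
  then show "w \<in> tspan"
    using w by (simp add: tspan_def tight_face_def)
qed

lemma tight_face_self: "v \<in> tspan \<Longrightarrow> v \<in> tight_face v"
  using tspan_feasible by (simp add: tight_face_def)

lemma tight_avoiding_imp_alpha_le:
  assumes v: "v \<in> feasible" and jk: "j \<noteq> i" "k \<noteq> i" "j \<noteq> k" and "v $ j + v $ k = D j k"
  shows "\<alpha> i \<le> v $ i"
  using feasibleD[OF v jk(1)[symmetric]] feasibleD[OF v jk(2)[symmetric]] alpha_le[OF jk] assms(5)
  by linarith

text \<open>If every tight pair contained \<open>i\<close>, then \<open>v\<close> would equal
  \<open>end_point i (v $ i)\<close>, and \<open>\<alpha> i \<le> v $ i\<close> would force the pair
  that attains \<open>\<alpha> i\<close> to be tight. Together with
  \<open>tight_avoiding_imp_alpha_le\<close> this describes the core by tight pairs, which is why it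
  is a union of faces.\<close>

lemma core_tight_avoiding:
  assumes v: "v \<in> core"
  obtains j k where "j \<noteq> i" "k \<noteq> i" "j \<noteq> k" "v $ j + v $ k = D j k"
proof (rule ccontr)
  assume no: "\<not> thesis"
  have vt: "v \<in> tspan" and le: "\<alpha> i \<le> v $ i"
    using v by (auto simp: core_def)
  have no': "\<not> (j \<noteq> i \<and> k \<noteq> i \<and> j \<noteq> k \<and> v $ j + v $ k = D j k)" for j k
    using no that by blast
  have star: "v $ j = D i j - v $ i" if "j \<noteq> i" for j
  proof -
    obtain k where "k \<noteq> j" "v $ j + v $ k = D j k"
      using tspan_tight[OF vt] by blast
    then have "k = i"
      using no' that by metis
    then show ?thesis
      using \<open>v $ j + v $ k = D j k\<close> sym[of i j] by simp
  qed
  obtain j k where jk: "j \<noteq> i" "k \<noteq> i" "j \<noteq> k" "2 * \<alpha> i = D i j + D i k - D j k"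
    by (rule alpha_attained)
  have "D j k \<le> v $ j + v $ k"
    using feasibleD[OF tspan_feasible[OF vt]] jk by blast
  then have "v $ j + v $ k = D j k"
    using star[OF jk(1)] star[OF jk(2)] jk(4) le by simp
  then show False
    using no' jk by blast
qed

lemma tight_face_core:
  assumes v: "v \<in> core" shows "tight_face v \<subseteq> core"
proof
  fix w assume w: "w \<in> tight_face v"
  have "\<alpha> i \<le> w $ i" for i
  proof -
    obtain j k where jk: "j \<noteq> i" "k \<noteq> i" "j \<noteq> k" "v $ j + v $ k = D j k"
      using core_tight_avoiding[OF v] by blast
    then have "w \<in> feasible" "w $ j + w $ k = D j k"
      using w by (auto simp: tight_face_def)
    then show ?thesis
      using tight_avoiding_imp_alpha_le jk by blast
  qed
  then show "w \<in> core"
    using w v tight_face_tspan[of v] by (auto simp: core_def)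
qed

lemma Union_faces_tspan: "\<Union> {F. F face_of feasible \<and> F \<subseteq> tspan} = tspan"
proof -
  have "v \<in> \<Union> {F. F face_of feasible \<and> F \<subseteq> tspan}" if "v \<in> tspan" for v
    using that tight_face_face_of tight_face_tspan tight_face_self by (intro UnionI[of "tight_face v"]) auto
  then show ?thesis by auto
qed

lemma Union_faces_core: "\<Union> {F. F face_of feasible \<and> F \<subseteq> core} = core"
proof -
  have "v \<in> \<Union> {F. F face_of feasible \<and> F \<subseteq> core}" if "v \<in> core" for v
    using that tight_face_face_of tight_face_core tight_face_self[of v]
    by (intro UnionI[of "tight_face v"]) (auto simp: core_def)
  then show ?thesis by auto
qed

lemma bounded_core: "bounded core"
proof -
  obtain C where C: "\<And>v i. v \<in> tspan \<Longrightarrow> (\<And>i. \<alpha> i \<le> v $ i) \<Longrightarrow> \<bar>v $ i\<bar> \<le> C"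
    using tspan_above_alpha_bounded by blast
  have "norm v \<le> sqrt (DIM(real ^ 'n)) * C" if "v \<in> core" for v
  proof -
    have "infnorm v \<le> C"
      unfolding infnorm_le_iff_cart using C that by (auto simp: core_def)
    then show ?thesis
      using norm_le_infnorm[of v] by (meson mult_left_mono order_trans real_sqrt_ge_zero of_nat_0_le_iff)
  qed
  then show ?thesis
    by (auto simp: bounded_iff)
qed

text \<open>A point of a convex set with the fewest tight constraints shares them with all other points,
  as is seen at midpoints.\<close>

lemma convex_common_tight:
  assumes cv: "convex F" and sub: "F \<subseteq> feasible" and ne: "F \<noteq> {}"
  obtains v where "v \<in> F" "\<And>w. w \<in> F \<Longrightarrow> w \<in> tight_face v"
proof -
  define E where "E v = {(i, j). i \<noteq> j \<and> v $ i + v $ j = D i j}" for v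
  obtain v where v: "v \<in> F" and min: "\<And>w. w \<in> F \<Longrightarrow> card (E v) \<le> card (E w)"
    using ne ex_has_least_nat[of "\<lambda>v. v \<in> F" _ "\<lambda>v. card (E v)"] by blast
  have "E v \<subseteq> E w" if w: "w \<in> F" for w
  proof -
    define m where "m = (1 / 2) *\<^sub>R v + (1 / 2) *\<^sub>R w"
    have "m \<in> F"
      unfolding m_def using cv v w by (intro convexD) auto
    have "E m \<subseteq> E v \<inter> E w"
    proof clarify
      fix i j assume "(i, j) \<in> E m"
      then have ij: "i \<noteq> j" and m: "m $ i + m $ j = D i j"
        by (auto simp: E_def)
      have "D i j \<le> v $ i + v $ j" "D i j \<le> w $ i + w $ j"
        using v w sub feasibleD ij by blast+
      then have "v $ i + v $ j = D i j" "w $ i + w $ j = D i j"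
        using m by (simp_all add: m_def)
      then show "(i, j) \<in> E v \<inter> E w"
        using ij by (simp add: E_def)
    qed
    then have "E m = E v"
      using min[OF \<open>m \<in> F\<close>] by (metis card_seteq finite le_inf_iff)
    then show ?thesis
      using \<open>E m \<subseteq> E v \<inter> E w\<close> by blast
  qed
  then have "w \<in> tight_face v" if "w \<in> F" for w
    using that sub by (auto simp: tight_face_def E_def)
  then show ?thesis
    using that v by blast
qed

text \<open>The pairs that are tight on all of \<open>F\<close> form a graph without isolated
  vertices. A dominating set \<open>S\<close> of at most half the indices determines the remaining
  coordinates by \<open>w $ s j + w $ j = D (s j) j\<close>, so \<open>F\<close> lies in an affine
  image of a space of dimension \<open>card S\<close>.\<close>

lemma aff_dim_tspan_convex:
  assumes cv: "convex F" and sub: "F \<subseteq> tspan"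
  shows "real_of_int (aff_dim F) \<le> real CARD('n) / 2"
proof (cases "F = {}")
  case False
  then obtain v where v: "v \<in> F" "\<And>w. w \<in> F \<Longrightarrow> w \<in> tight_face v"
    using convex_common_tight[OF cv] sub tspan_feasible by blast
  define R where "R i j \<longleftrightarrow> i \<noteq> j \<and> v $ i + v $ j = D i j" for i j
  have "R j i" if "R i j" for i j
    using that sym[of i j] by (auto simp: R_def add.commute)
  moreover have "\<exists>j. j \<noteq> i \<and> R i j" for i
    using tspan_tight[of v i] v(1) sub unfolding R_def by (metis subsetD)
  ultimately obtain S where S: "2 * card S \<le> CARD('n)" "\<And>j. j \<notin> S \<Longrightarrow> \<exists>s\<in>S. R s j"
    using small_dominating_set[of R] by blast
  then obtain s where s: "\<And>j. j \<notin> S \<Longrightarrow> s j \<in> S" "\<And>j. j \<notin> S \<Longrightarrow> R (s j) j"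
    by metis
  define W where "W = {x :: real ^ 'n. \<forall>i. i \<notin> S \<longrightarrow> x $ i = 0}"
  define L :: "real ^ 'n \<Rightarrow> real ^ 'n" where "L x = (\<chi> j. if j \<in> S then x $ j else - x $ s j)" for x
  define c :: "real ^ 'n" where "c = (\<chi> j. if j \<in> S then 0 else D (s j) j)"
  have "linear L"
    by (rule linearI) (auto simp: L_def vec_eq_iff)
  have "subspace W"
    by (simp add: W_def subspace_def)
  have "F \<subseteq> (+) c ` L ` W"
  proof
    fix w assume w: "w \<in> F"
    define x :: "real ^ 'n" where "x = (\<chi> j. if j \<in> S then w $ j else 0)"
    have "w $ s j + w $ j = D (s j) j" if "j \<notin> S" for j
      using v(2)[OF w] s(2)[OF that] by (auto simp: tight_face_def R_def)
    then have "w = c + L x"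
      using s(1) by (auto simp: vec_eq_iff c_def L_def x_def algebra_simps)
    moreover have "x \<in> W" by (simp add: W_def x_def)
    ultimately show "w \<in> (+) c ` L ` W" by blast
  qed
  then have "aff_dim F \<le> aff_dim ((+) c ` L ` W)"
    by (rule aff_dim_subset)
  also have "\<dots> \<le> aff_dim W"
    using aff_dim_linear_image_le[OF \<open>linear L\<close>] by (simp add: aff_dim_translation_eq)
  also have "\<dots> = int (card S)"
    using aff_dim_subspace[OF \<open>subspace W\<close>] dim_substandard_cart[where 'a = real and d = S]
    unfolding W_def dim_vec_eq by simp
  finally show ?thesis
    using S(1) by linarith
qed simp

section \<open>The half-lines attached to the core\<close>

definition end_direction :: "'n \<Rightarrow> real ^ 'n" where
  "end_direction i = (\<chi> k. if k = i then - 1 else 1)"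

lemma half_line_end:
  "half_line (end_point i (\<alpha> i)) (end_direction i) = {end_point i a |a. a \<le> \<alpha> i}"
proof -
  have *: "end_point i (\<alpha> i) + t *\<^sub>R end_direction i = end_point i (\<alpha> i - t)" for t
    by (auto simp: vec_eq_iff end_point_def end_direction_def)
  have "\<exists>t. end_point i a = end_point i (\<alpha> i - t) \<and> 0 \<le> t" if "a \<le> \<alpha> i" for a
    using that by (intro exI[of _ "\<alpha> i - a"]) simp
  then show ?thesis
    unfolding half_line_def * by auto
qed

lemma end_points_eq: "{end_point i a |a. a \<le> \<alpha> i} = {v \<in> tspan. v $ i \<le> \<alpha> i}"
proof
  show "{end_point i a |a. a \<le> \<alpha> i} \<subseteq> {v \<in> tspan. v $ i \<le> \<alpha> i}"
    using end_point_tspan by auto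
  show "{v \<in> tspan. v $ i \<le> \<alpha> i} \<subseteq> {end_point i a |a. a \<le> \<alpha> i}"
    using tspan_below_alpha by blast
qed

lemma end_points_Int_core: "{v \<in> tspan. v $ i \<le> \<alpha> i} \<inter> core = {end_point i (\<alpha> i)}"
proof -
  have "end_point i (\<alpha> i) \<in> core"
  proof -
    have "\<alpha> j \<le> end_point i (\<alpha> i) $ j" for j
      using alpha_sum[of i j] by (auto simp: end_point_def)
    then show ?thesis
      using end_point_tspan by (simp add: core_def)
  qed
  moreover have "v = end_point i (\<alpha> i)" if "v \<in> tspan" "v $ i \<le> \<alpha> i" "v \<in> core" for v
  proof -
    have "v $ i = \<alpha> i"
      using that by (simp add: core_def order_antisym)
    then show ?thesis
      using tspan_below_alpha[OF that(1,2)] by simp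
  qed
  ultimately show ?thesis
    by (intro set_eqI iffI) (auto simp: end_point_tspan)
qed

text \<open>The chain \<open>D i j \<le> v $ i + v $ j \<le> \<alpha> i + \<alpha> j \<le> D i
  j\<close> collapses. Two ends can still share their end points, as in a star.\<close>

lemma end_points_Int_end_points:
  assumes "i \<noteq> j" and v: "v \<in> tspan" "v $ i \<le> \<alpha> i" "v $ j \<le> \<alpha> j"
  shows "v = end_point i (\<alpha> i)"
proof -
  have "v $ i = \<alpha> i"
    using feasibleD[OF tspan_feasible[OF v(1)] assms(1)] alpha_sum[OF assms(1)] v by simp
  then show ?thesis
    using tspan_below_alpha[OF v(1), of i] by simp
qed

text \<open>The compact part is the subcomplex of faces inside \<open>core\<close>; a point outside
  it has a coordinate below its threshold and so lies on a half-line.\<close>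

lemma attached_half_lines_tspan:
  "attached_half_lines CARD('n) {F. F face_of feasible \<and> F \<subseteq> tspan}"
proof -
  obtain h where h: "bij_betw h {..<CARD('n)} (UNIV :: 'n set)"
    using ex_bij_betw_nat_finite[of "UNIV :: 'n set"] by (auto simp: lessThan_atLeast0)
  have inj: "h i \<noteq> h j" if "i < CARD('n)" "j < CARD('n)" "i \<noteq> j" for i j
    using h that by (auto simp: bij_betw_def inj_on_def)
  let ?L = "\<lambda>i. {v \<in> tspan. v $ i \<le> \<alpha> i}"
  have L: "half_line (end_point i (\<alpha> i)) (end_direction i) = ?L i" for i
    by (simp add: half_line_end end_points_eq)
  have int: "?L i \<inter> ?L j \<subseteq> {end_point i (\<alpha> i)} \<inter> {end_point j (\<alpha> j)}" if "i \<noteq> j" for i j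
    using end_points_Int_end_points[OF that] end_points_Int_end_points[OF that[symmetric]] by blast
  have ne: "end_direction i \<noteq> 0" for i
    by (auto simp: end_direction_def vec_eq_iff)
  show ?thesis
    unfolding attached_half_lines_def
  proof (rule exI[of _ "{F. F face_of feasible \<and> F \<subseteq> core}"],
      rule exI[of _ "\<lambda>i. end_point (h i) (\<alpha> (h i))"], rule exI[of _ "\<lambda>i. end_direction (h i)"],
      intro conjI allI impI ballI)
    show "{F. F face_of feasible \<and> F \<subseteq> core} \<subseteq> {F. F face_of feasible \<and> F \<subseteq> tspan}"
      by (auto simp: core_def)
    show "polyhedral_complex {F. F face_of feasible \<and> F \<subseteq> core}"
      by (rule polyhedral_complex_faces[OF polyhedron_feasible])
    show "finite {F. F face_of feasible \<and> F \<subseteq> core}"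
      using finite_polyhedron_faces[OF polyhedron_feasible] by (rule rev_finite_subset) auto
    show "bounded P" if "P \<in> {F. F face_of feasible \<and> F \<subseteq> core}" for P
      using that bounded_core bounded_subset by blast
    show "end_direction (h i) \<noteq> 0" for i
      by (rule ne)
    show "inj_on (\<lambda>i. half_line (end_point (h i) (\<alpha> (h i))) (end_direction (h i))) {..<CARD('n)}"
    proof (rule inj_onI, rule ccontr)
      fix i j assume ij: "i \<in> {..<CARD('n)}" "j \<in> {..<CARD('n)}" "i \<noteq> j"
        and "half_line (end_point (h i) (\<alpha> (h i))) (end_direction (h i)) =
             half_line (end_point (h j) (\<alpha> (h j))) (end_direction (h j))"
      then have "?L (h i) \<subseteq> {end_point (h i) (\<alpha> (h i))}"
        using int[of "h i" "h j"] inj[of i j] by (simp add: L)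
      moreover have "end_point (h i) (\<alpha> (h i) - 1) \<in> ?L (h i)"
        by (simp add: end_point_tspan)
      ultimately have "end_point (h i) (\<alpha> (h i) - 1) = end_point (h i) (\<alpha> (h i))"
        by blast
      then have "\<alpha> (h i) - 1 = \<alpha> (h i)"
        by (metis end_point_nth(1))
      then show False
        by simp
    qed
    have "tspan = core \<union> (\<Union>i. ?L i)"
      unfolding core_def by (auto intro: less_imp_le simp: not_le)
    also have "(\<Union>i. ?L i) = (\<Union>i<CARD('n). ?L (h i))"
      using h by (auto simp: bij_betw_def) (metis UNIV_I image_iff)
    finally have eq: "tspan = core \<union> (\<Union>i<CARD('n). ?L (h i))" .
    show "\<Union> {F. F face_of feasible \<and> F \<subseteq> tspan} = \<Union> {F. F face_of feasible \<and> F \<subseteq> core} \<union>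
        (\<Union>i<CARD('n). half_line (end_point (h i) (\<alpha> (h i))) (end_direction (h i)))"
      unfolding Union_faces_tspan Union_faces_core L by (rule eq)
    show "half_line (end_point (h i) (\<alpha> (h i))) (end_direction (h i)) \<inter>
        \<Union> {F. F face_of feasible \<and> F \<subseteq> core} = {end_point (h i) (\<alpha> (h i))}" for i
      unfolding Union_faces_core L by (rule end_points_Int_core)
    show "half_line (end_point (h i) (\<alpha> (h i))) (end_direction (h i)) \<inter>
        half_line (end_point (h j) (\<alpha> (h j))) (end_direction (h j)) \<subseteq>
        {end_point (h i) (\<alpha> (h i))} \<inter> {end_point (h j) (\<alpha> (h j))}"
      if "i < CARD('n)" "j < CARD('n)" "i \<noteq> j" for i j
      unfolding L using int[OF inj[OF that]] .
  qed
qed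

lemma tspan_polyhedral_complex:
  obtains \<P> :: "(real ^ 'n) set set" where "polyhedral_complex \<P>" "finite \<P>"
    "\<And>P. P \<in> \<P> \<Longrightarrow> real_of_int (aff_dim P) \<le> real CARD('n) / 2" "\<Union> \<P> = tspan"
    "attached_half_lines CARD('n) \<P>"
proof (rule that[of "{F. F face_of feasible \<and> F \<subseteq> tspan}"])
  show "polyhedral_complex {F. F face_of feasible \<and> F \<subseteq> tspan}"
    by (rule polyhedral_complex_faces[OF polyhedron_feasible])
  show "finite {F. F face_of feasible \<and> F \<subseteq> tspan}"
    using finite_polyhedron_faces[OF polyhedron_feasible] by (rule rev_finite_subset) auto
  show "real_of_int (aff_dim P) \<le> real CARD('n) / 2" if "P \<in> {F. F face_of feasible \<and> F \<subseteq> tspan}" for P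
    using that aff_dim_tspan_convex face_of_imp_convex by blast
qed (rule Union_faces_tspan attached_half_lines_tspan)+

end

section \<open>Busemann coordinates on good spaces with finite boundary\<close>

lemma geodesic_rayD:
  assumes "geodesic_ray X r"
  shows "0 \<le> t \<Longrightarrow> r t \<in> mspace X" "0 \<le> s \<Longrightarrow> 0 \<le> t \<Longrightarrow> mdist X (r s) (r t) = \<bar>s - t\<bar>"
  using assms by (auto simp: geodesic_ray_def geodesic_on_def)

lemma geodesic_on_subset: "geodesic_on X I c \<Longrightarrow> J \<subseteq> I \<Longrightarrow> geodesic_on X J c"
  unfolding geodesic_on_def by blast

lemma equiv_asymptotic_rays: "equiv {r. geodesic_ray X r} (asymptotic_rays X)"
proof (rule equivI)
  show "asymptotic_rays X \<subseteq> {r. geodesic_ray X r} \<times> {r. geodesic_ray X r}"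
    by (auto simp: asymptotic_rays_def)
  have "\<exists>C. \<forall>t\<ge>0. mdist X (r t) (r t) \<le> C" if "geodesic_ray X r" for r
    using geodesic_rayD(2)[OF that] by (intro exI[of _ 0]) auto
  then show "refl_on {r. geodesic_ray X r} (asymptotic_rays X)"
    by (auto simp: refl_on_def asymptotic_rays_def)
  show "sym (asymptotic_rays X)"
    by (auto simp: sym_def asymptotic_rays_def mdist_commute[of X])
  show "trans (asymptotic_rays X)"
  proof (rule transI)
    fix a b c assume ab: "(a, b) \<in> asymptotic_rays X" and bc: "(b, c) \<in> asymptotic_rays X"
    then obtain A B where AB: "\<forall>t\<ge>0. mdist X (a t) (b t) \<le> A" "\<forall>t\<ge>0. mdist X (b t) (c t) \<le> B"
      by (auto simp: asymptotic_rays_def)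
    have r: "geodesic_ray X a" "geodesic_ray X b" "geodesic_ray X c"
      using ab bc by (auto simp: asymptotic_rays_def)
    have "mdist X (a t) (c t) \<le> A + B" if t: "0 \<le> t" for t
    proof -
      have "mdist X (a t) (c t) \<le> mdist X (a t) (b t) + mdist X (b t) (c t)"
        using geodesic_rayD(1)[OF r(1) t] geodesic_rayD(1)[OF r(2) t] geodesic_rayD(1)[OF r(3) t]
        by (rule mdist_triangle)
      also have "\<dots> \<le> A + B"
        using AB t by (intro add_mono) auto
      finally show ?thesis .
    qed
    then show "(a, c) \<in> asymptotic_rays X"
      using r by (auto simp: asymptotic_rays_def)
  qed
qed

lemma boundary_ray:
  assumes "\<xi> \<in> gromov_boundary X" "r \<in> \<xi>" shows "geodesic_ray X r"
  using assms in_quotient_imp_subset[OF equiv_asymptotic_rays] by (auto simp: gromov_boundary_def)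

lemma boundary_obtain_ray:
  assumes "\<xi> \<in> gromov_boundary X" obtains r where "r \<in> \<xi>" "geodesic_ray X r"
  using assms in_quotient_imp_non_empty[OF equiv_asymptotic_rays] boundary_ray
  unfolding gromov_boundary_def by blast

lemma boundary_asymptotic:
  assumes "\<xi> \<in> gromov_boundary X" "r \<in> \<xi>" "r' \<in> \<xi>" shows "(r, r') \<in> asymptotic_rays X"
  using assms in_quotient_imp_in_rel[OF equiv_asymptotic_rays, of \<xi> X] by (auto simp: gromov_boundary_def)

lemma boundary_eqI:
  assumes "\<xi> \<in> gromov_boundary X" "\<eta> \<in> gromov_boundary X" "r \<in> \<xi>" "r' \<in> \<eta>"
    "(r, r') \<in> asymptotic_rays X"
  shows "\<xi> = \<eta>"
  using assms unfolding gromov_boundary_def by (rule quotient_eqI[OF equiv_asymptotic_rays])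

lemma ray_boundary:
  assumes "geodesic_ray X r" obtains \<xi> where "\<xi> \<in> gromov_boundary X" "r \<in> \<xi>"
proof (rule that[of "asymptotic_rays X `` {r}"])
  show "asymptotic_rays X `` {r} \<in> gromov_boundary X"
    unfolding gromov_boundary_def using assms by (intro quotientI) simp
  show "r \<in> asymptotic_rays X `` {r}"
    using equiv_class_self[OF equiv_asymptotic_rays] assms by blast
qed

text \<open>If infinitely many points avoided a neighbourhood, stopping \<open>r\<close> at those
  times would give generalized rays that agree with \<open>r\<close> on longer and longer intervals,
  so the closed complement would contain \<open>Inr \<xi>\<close>.\<close>

lemma limitin_cone_ray:
  assumes \<xi>: "\<xi> \<in> gromov_boundary X" and r: "r \<in> \<xi>"
  shows "limitin (cone_topology X) (\<lambda>n. Inl (r (real n))) (Inr \<xi>) sequentially"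
  unfolding limitin_def
proof (intro conjI allI impI)
  have ray: "geodesic_ray X r"
    using boundary_ray \<xi> r by blast
  show "Inr \<xi> \<in> topspace (cone_topology X)"
    using \<xi> by (simp add: compactification_def InrI)
  fix U assume U: "openin (cone_topology X) U \<and> Inr \<xi> \<in> U"
  show "\<forall>\<^sub>F n in sequentially. Inl (r (real n)) \<in> U"
  proof (rule ccontr)
    assume "\<not> ?thesis"
    then have "infinite {n. Inl (r (real n)) \<notin> U}"
      unfolding eventually_cofinite[symmetric] cofinite_eq_sequentially[symmetric] by simp
    from infinite_enumerate[OF this] obtain \<sigma> :: "nat \<Rightarrow> nat"
      where \<sigma>: "strict_mono \<sigma>" "\<And>n. Inl (r (real (\<sigma> n))) \<notin> U"
      by blast
    let ?zs = "\<lambda>n. Inl (r (real (\<sigma> n)))"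
    define c where "c n t = r (min t (real (\<sigma> n)))" for n t
    have "cone_converges X (r 0) ?zs (Inr \<xi>)"
      unfolding cone_converges_def
    proof (intro exI[of _ c] conjI allI impI)
      fix n
      have "geodesic_on X {0..real (\<sigma> n)} (c n)"
        using ray by (auto simp: geodesic_on_def c_def geodesic_ray_def)
      then show "generalized_ray X (r 0) (c n) (?zs n)"
        unfolding generalized_ray_def by (auto simp: c_def intro!: exI[of _ "real (\<sigma> n)"])
    next
      fix \<rho> :: "nat \<Rightarrow> nat" assume \<rho>: "strict_mono \<rho>"
      show "\<exists>(\<tau>::nat \<Rightarrow> nat) c'. strict_mono \<tau> \<and> generalized_ray X (r 0) c' (Inr \<xi>) \<and>
          converges_on_compacts X (\<lambda>n. c (\<rho> (\<tau> n))) c'"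
      proof (intro exI[of _ "\<lambda>n. n"] exI[of _ r] conjI)
        show "strict_mono (\<lambda>n::nat. n)" by (simp add: strict_mono_def)
        show "generalized_ray X (r 0) r (Inr \<xi>)"
          using \<xi> r by (simp add: generalized_ray_def)
        show "converges_on_compacts X (\<lambda>n. c (\<rho> n)) r"
          unfolding converges_on_compacts_def
        proof (intro allI impI)
          fix T \<epsilon> :: real assume T: "0 \<le> T" and \<epsilon>: "0 < \<epsilon>"
          obtain N where N: "T \<le> real N" using real_arch_simple by blast
          have "mdist X (c (\<rho> n) t) (r t) < \<epsilon>" if n: "n \<ge> N" and t: "t \<in> {0..T}" for n t
          proof -
            have "n \<le> \<sigma> (\<rho> n)"
              using seq_suble[OF \<rho>, of n] seq_suble[OF \<sigma>(1), of "\<rho> n"] by linarith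
            then have "t \<le> real (\<sigma> (\<rho> n))"
              using N n t by auto
            then show ?thesis
              using geodesic_rayD(2)[OF ray, of t t] t \<epsilon> by (simp add: c_def min_def)
          qed
          then show "\<exists>N. \<forall>n\<ge>N. \<forall>t\<in>{0..T}. mdist X (c (\<rho> n) t) (r t) < \<epsilon>"
            by blast
        qed
      qed
    qed
    moreover have "cone_closed X (compactification X - U)"
      using U by (simp add: openin_cone_topology)
    moreover have "?zs n \<in> compactification X - U" for n
      using \<sigma>(2) geodesic_rayD(1)[OF ray] by (auto simp: compactification_def)
    moreover have "r 0 \<in> mspace X"
      using geodesic_rayD(1)[OF ray] by simp
    ultimately have "Inr \<xi> \<in> compactification X - U"
      using cone_closedD by metis
    then show False
      using U by simp
  qed
qed

lemma extends_gromov_product_limit: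
  assumes "extends_gromov_product X x G"
    "limitin (cone_topology X) zs z sequentially" "limitin (cone_topology X) ws w sequentially"
  shows "(\<lambda>n. G (zs n, ws n)) \<longlonglongrightarrow> G (z, w)"
proof -
  have "limitin (prod_topology (cone_topology X) (cone_topology X)) (\<lambda>n. (zs n, ws n)) (z, w) sequentially"
    using assms(2,3) by (simp add: limitin_pairwise o_def)
  moreover have "continuous_map (prod_topology (cone_topology X) (cone_topology X)) (top_of_set {0..}) G"
    using assms(1) by (simp add: extends_gromov_product_def)
  ultimately have "limitin (top_of_set {0..}) (G \<circ> (\<lambda>n. (zs n, ws n))) (G (z, w)) sequentially"
    by (rule continuous_map_limit[rotated])
  then show ?thesis
    unfolding limitin_subtopology o_def by simp
qed

lemma extends_gromov_product_ray_ray: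
  assumes G: "extends_gromov_product X x G" and \<xi>: "\<xi> \<in> gromov_boundary X" "r \<in> \<xi>"
    and \<eta>: "\<eta> \<in> gromov_boundary X" "r' \<in> \<eta>"
  shows "(\<lambda>n. ereal (gromov_product X x (r (real n)) (r' (real n)))) \<longlonglongrightarrow> G (Inr \<xi>, Inr \<eta>)"
proof -
  have "G (Inl (r (real n)), Inl (r' (real n))) = ereal (gromov_product X x (r (real n)) (r' (real n)))" for n
    using G assms boundary_ray geodesic_rayD(1) of_nat_0_le_iff unfolding extends_gromov_product_def by blast
  then show ?thesis
    using extends_gromov_product_limit[OF G limitin_cone_ray[OF \<xi>] limitin_cone_ray[OF \<eta>]] by simp
qed

lemma extends_gromov_product_point_ray:
  assumes G: "extends_gromov_product X x G" and y: "y \<in> mspace X" and \<xi>: "\<xi> \<in> gromov_boundary X" "r \<in> \<xi>"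
  shows "(\<lambda>n. ereal (gromov_product X x y (r (real n)))) \<longlonglongrightarrow> G (Inl y, Inr \<xi>)"
proof -
  have "G (Inl y, Inl (r (real n))) = ereal (gromov_product X x y (r (real n)))" for n
    using G assms boundary_ray geodesic_rayD(1) of_nat_0_le_iff unfolding extends_gromov_product_def by blast
  moreover have "limitin (cone_topology X) (\<lambda>n. Inl y) (Inl y) sequentially"
    using y by (simp add: compactification_def InlI)
  ultimately show ?thesis
    using extends_gromov_product_limit[OF G _ limitin_cone_ray[OF \<xi>], of "\<lambda>n. Inl y" "Inl y"] by simp
qed

text \<open>Both sides are limits of the same products along rays, so the extension chosen by
  \<open>SOME\<close> may be replaced by any other.\<close>

lemma boundary_gromov_product_eq:
  assumes G: "extends_gromov_product X x G" and "\<xi> \<in> gromov_boundary X" "\<eta> \<in> gromov_boundary X"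
  shows "boundary_gromov_product X x \<xi> \<eta> = G (Inr \<xi>, Inr \<eta>)"
proof -
  obtain r where r: "r \<in> \<xi>" using boundary_obtain_ray assms(2) by blast
  obtain r' where r': "r' \<in> \<eta>" using boundary_obtain_ray assms(3) by blast
  have "extends_gromov_product X x (SOME G. extends_gromov_product X x G)"
    by (rule someI[where P = "extends_gromov_product X x", OF G])
  from extends_gromov_product_ray_ray[OF this assms(2) r assms(3) r']
    extends_gromov_product_ray_ray[OF G assms(2) r assms(3) r']
  show ?thesis
    unfolding boundary_gromov_product_def by (rule LIMSEQ_unique)
qed

section \<open>Finite products between distinct boundary points\<close>

lemma gromov_product_nonneg:
  assumes "x \<in> mspace X" "y \<in> mspace X" "z \<in> mspace X"
  shows "0 \<le> gromov_product X x y z"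
  using mdist_triangle[of y X x z] assms mdist_commute[of X z x] by (simp add: gromov_product_def)

lemma gromov_product_le:
  assumes "x \<in> mspace X" "y \<in> mspace X" "z \<in> mspace X"
  shows "gromov_product X x y z \<le> mdist X y x"
  using mdist_triangle[of x X y z] mdist_commute[of X] assms by (simp add: gromov_product_def)

lemma gromov_product_commute: "gromov_product X x y z = gromov_product X x z y"
  by (simp add: gromov_product_def mdist_commute[of X])

lemma extends_gromov_product_self:
  assumes G: "extends_gromov_product X x G" and x: "x \<in> mspace X" and \<xi>: "\<xi> \<in> gromov_boundary X"
  shows "G (Inr \<xi>, Inr \<xi>) = \<infinity>"
proof -
  obtain r where r: "r \<in> \<xi>" "geodesic_ray X r"
    using boundary_obtain_ray \<xi> by blast
  have "real n - mdist X (r 0) x \<le> gromov_product X x (r (real n)) (r (real n))" for n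
  proof -
    have "mdist X (r 0) (r (real n)) \<le> mdist X (r 0) x + mdist X x (r (real n))"
      using geodesic_rayD(1)[OF r(2)] x by (intro mdist_triangle) auto
    then show ?thesis
      using geodesic_rayD[OF r(2)] mdist_commute[of X x] by (simp add: gromov_product_def)
  qed
  moreover have "filterlim (\<lambda>n. real n - mdist X (r 0) x) at_top sequentially"
    by real_asymp
  ultimately have "filterlim (\<lambda>n. gromov_product X x (r (real n)) (r (real n))) at_top sequentially"
    using filterlim_at_top_mono by (metis (no_types, lifting) always_eventually)
  then have "(\<lambda>n. ereal (gromov_product X x (r (real n)) (r (real n)))) \<longlonglongrightarrow> \<infinity>"
    by (simp add: tendsto_PInfty_eq_at_top)
  then show ?thesis
    using extends_gromov_product_ray_ray[OF G \<xi> r(1) \<xi> r(1)] LIMSEQ_unique by blast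
qed

lemma geodesic_segment_sum:
  assumes "geodesic_segment X x y S" "a \<in> S"
  shows "a \<in> mspace X" "mdist X x a + mdist X a y = mdist X x y"
proof -
  obtain l c where c: "0 \<le> l" "geodesic_on X {0..l} c" "c 0 = x" "c l = y" "S = c ` {0..l}"
    using assms(1) by (auto simp: geodesic_segment_def)
  then obtain t where t: "0 \<le> t" "t \<le> l" "a = c t"
    using assms(2) by auto
  then show "a \<in> mspace X"
    using c(2) by (auto simp: geodesic_on_def)
  have "mdist X (c u) (c v) = \<bar>u - v\<bar>" if "0 \<le> u" "u \<le> l" "0 \<le> v" "v \<le> l" for u v
    using c(2) that by (auto simp: geodesic_on_def)
  from this[of 0 t] this[of t l] this[of 0 l] show "mdist X x a + mdist X a y = mdist X x y"
    using c t by simp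
qed

lemma geodesic_ray_segment:
  assumes "geodesic_ray X r" "0 \<le> l" shows "geodesic_segment X (r 0) (r l) (r ` {0..l})"
  using assms unfolding geodesic_segment_def geodesic_ray_def
  by (intro exI[of _ l] exI[of _ r]) (auto intro: geodesic_on_subset)

text \<open>If the Gromov product of the end points is large, then the side opposite to the base point
  is far away, so an initial part of the first ray stays close to the second ray.\<close>

lemma slim_imp_asymptotic:
  assumes gs: "geodesic_space X" and slim: "geodesic_triangles_slim X \<delta>" and \<delta>: "0 \<le> \<delta>"
    and r: "geodesic_ray X r" and r': "geodesic_ray X r'"
    and big: "\<And>B. \<exists>n. B \<le> real n \<and> B < gromov_product X (r 0) (r (real n)) (r' (real n))"
  shows "(r, r') \<in> asymptotic_rays X"
proof -
  define p where "p = r 0"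
  define q where "q = r' 0"
  define K where "K = mdist X p q"
  have pq: "p \<in> mspace X" "q \<in> mspace X"
    using geodesic_rayD(1)[OF r] geodesic_rayD(1)[OF r'] by (auto simp: p_def q_def)
  have K: "0 \<le> K" by (simp add: K_def)
  \<comment> \<open>Two slim triangles lead from \<open>r t\<close> to a point \<open>w\<close> on
    \<open>W\<close> or on \<open>r'\<close> within \<open>2 * \<delta>\<close>. On \<open>W\<close>
    this bounds \<open>t\<close> by \<open>2 * \<delta> + K\<close>, and the detour over
    \<open>p\<close> and \<open>q\<close> of length \<open>2 * t + K\<close> suffices; on
    \<open>r'\<close> the time of \<open>w\<close> differs from \<open>t\<close> by at most
    \<open>2 * \<delta> + K\<close>.\<close>
  have "mdist X (r t) (r' t) \<le> 4 * \<delta> + 3 * K" if t: "0 \<le> t" for t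
  proof -
    obtain n where n: "t + \<delta> \<le> real n" and prod: "t + \<delta> < gromov_product X p (r (real n)) (r' (real n))"
      using big[of "t + \<delta>"] by (auto simp: p_def)
    define a where "a = r (real n)"
    define b where "b = r' (real n)"
    have ab: "a \<in> mspace X" "b \<in> mspace X"
      using geodesic_rayD(1)[OF r] geodesic_rayD(1)[OF r'] by (auto simp: a_def b_def)
    obtain S where S: "geodesic_segment X a b S"
      using gs ab by (auto simp: geodesic_space_def)
    obtain V where V: "geodesic_segment X b p V"
      using gs ab pq by (auto simp: geodesic_space_def)
    obtain W where W: "geodesic_segment X p q W"
      using gs pq by (auto simp: geodesic_space_def)
    have rt: "r t \<in> r ` {0..real n}"
      using t n \<delta> by auto
    have rtX: "r t \<in> mspace X" "r' t \<in> mspace X"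
      using t geodesic_rayD(1)[OF r] geodesic_rayD(1)[OF r'] by auto
    have dpt: "mdist X p (r t) = t" "mdist X q (r' t) = t"
      using t geodesic_rayD(2)[OF r, of 0 t] geodesic_rayD(2)[OF r', of 0 t] by (auto simp: p_def q_def)
    have "geodesic_segment X p a (r ` {0..real n})"
      using geodesic_ray_segment[OF r, of "real n"] by (simp add: p_def a_def)
    then have "\<exists>v\<in>S \<union> V. mdist X (r t) v \<le> \<delta>"
      using slim S V rt unfolding geodesic_triangles_slim_def by blast
    then obtain v where v: "v \<in> S \<union> V" "mdist X (r t) v \<le> \<delta>" by blast
    \<comment> \<open>The product at \<open>p\<close> is at most the distance from \<open>p\<close>
      to any point of \<open>S\<close>, and for \<open>v\<close> this distance is at most
      \<open>t + \<delta>\<close>.\<close>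
    have "v \<notin> S"
    proof
      assume vS: "v \<in> S"
      note s = geodesic_segment_sum[OF S vS]
      have "mdist X p a \<le> mdist X p v + mdist X v a" "mdist X p b \<le> mdist X p v + mdist X v b"
        using pq ab s(1) by (auto intro: mdist_triangle)
      moreover have "mdist X p v \<le> mdist X p (r t) + mdist X (r t) v"
        using pq rtX s(1) by (auto intro: mdist_triangle)
      ultimately show False
        using prod s(2) v(2) dpt mdist_commute[of X a p] mdist_commute[of X b p] mdist_commute[of X v a]
        by (simp add: gromov_product_def a_def[symmetric] b_def[symmetric])
    qed
    then have vV: "v \<in> V" using v by simp
    have vX: "v \<in> mspace X"
      using geodesic_segment_sum(1)[OF V vV] .
    have "geodesic_segment X q b (r' ` {0..real n})"
      using geodesic_ray_segment[OF r', of "real n"] by (simp add: q_def b_def)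
    then have "\<exists>w\<in>W \<union> r' ` {0..real n}. mdist X v w \<le> \<delta>"
      using slim V W vV unfolding geodesic_triangles_slim_def by blast
    then obtain w where w: "w \<in> W \<union> r' ` {0..real n}" "mdist X v w \<le> \<delta>" by blast
    have wX: "w \<in> mspace X"
      using w(1) geodesic_segment_sum(1)[OF W] geodesic_rayD(1)[OF r'] by auto
    have rw: "mdist X (r t) w \<le> 2 * \<delta>"
      using mdist_triangle[OF rtX(1) vX wX] v(2) w(2) by simp
    have tri: "mdist X (r t) (r' t) \<le> t + K + t"
      using mdist_triangle[OF rtX(1) pq(1) rtX(2)] mdist_triangle[OF pq rtX(2)] dpt
        mdist_commute[of X "r t" p] by (simp add: K_def)
    show ?thesis
    proof (cases "w \<in> W")
      case True
      have "mdist X p w \<le> K"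
        using geodesic_segment_sum(2)[OF W True] by (simp add: K_def) (metis add_increasing2 mdist_nonneg order_refl)
      then have "t \<le> 2 * \<delta> + K"
        using mdist_triangle[OF pq(1) wX rtX(1)] dpt rw mdist_commute[of X w "r t"] by simp
      then show ?thesis using tri by simp
    next
      case False
      then obtain t' where t': "0 \<le> t'" "w = r' t'"
        using w(1) by auto
      have qw: "mdist X q w = t'"
        using t' geodesic_rayD(2)[OF r', of 0 t'] by (simp add: q_def)
      have "mdist X w (r' t) = \<bar>t' - t\<bar>"
        using t t' geodesic_rayD(2)[OF r', of t' t] by simp
      moreover have "t' \<le> K + t + 2 * \<delta>"
        using mdist_triangle[OF pq(2) pq(1) wX] mdist_triangle[OF pq(1) rtX(1) wX] dpt rw qw
          mdist_commute[of X q p] by (simp add: K_def)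
      moreover have "t \<le> 2 * \<delta> + t' + K"
        using mdist_triangle[OF pq(1) wX rtX(1)] mdist_triangle[OF pq wX] dpt rw qw
          mdist_commute[of X w "r t"] by (simp add: K_def)
      ultimately have "mdist X w (r' t) \<le> 2 * \<delta> + K" by simp
      then show ?thesis
        using mdist_triangle[OF rtX(1) wX rtX(2)] rw K by simp
    qed
  qed
  then show ?thesis
    using r r' by (auto simp: asymptotic_rays_def)
qed

text \<open>An infinite value makes the products along two rays grow without bound, also after
  moving the base point from \<open>x\<close> to \<open>r 0\<close>, which costs at most their
  distance. Slim triangles then make the rays asymptotic.\<close>

lemma extends_gromov_product_finite:
  assumes hyp: "gromov_hyperbolic X" and x: "x \<in> mspace X" and G: "extends_gromov_product X x G"
    and \<xi>: "\<xi> \<in> gromov_boundary X" and \<eta>: "\<eta> \<in> gromov_boundary X" and ne: "\<xi> \<noteq> \<eta>"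
  shows "G (Inr \<xi>, Inr \<eta>) \<noteq> \<infinity>"
proof
  assume inf: "G (Inr \<xi>, Inr \<eta>) = \<infinity>"
  obtain r where r: "r \<in> \<xi>" "geodesic_ray X r" using boundary_obtain_ray \<xi> by blast
  obtain r' where r': "r' \<in> \<eta>" "geodesic_ray X r'" using boundary_obtain_ray \<eta> by blast
  obtain \<delta> where \<delta>: "0 \<le> \<delta>" "geodesic_triangles_slim X \<delta>" "geodesic_space X"
    using hyp by (auto simp: gromov_hyperbolic_def)
  have lim: "filterlim (\<lambda>n. gromov_product X x (r (real n)) (r' (real n))) at_top sequentially"
    using extends_gromov_product_ray_ray[OF G \<xi> r(1) \<eta> r'(1)] inf by (simp add: tendsto_PInfty_eq_at_top)
  have p: "r 0 \<in> mspace X" using geodesic_rayD(1)[OF r(2)] by simp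
  have "\<exists>n. B \<le> real n \<and> B < gromov_product X (r 0) (r (real n)) (r' (real n))" for B
  proof -
    have "\<forall>\<^sub>F n in sequentially. B + mdist X x (r 0) < gromov_product X x (r (real n)) (r' (real n))"
      using lim by (auto simp: filterlim_at_top_dense)
    moreover have "\<forall>\<^sub>F n in sequentially. B \<le> real n"
      using eventually_ge_at_top[of "nat \<lceil>B\<rceil>"] by eventually_elim linarith
    ultimately have "\<forall>\<^sub>F n in sequentially. B \<le> real n \<and>
        B + mdist X x (r 0) < gromov_product X x (r (real n)) (r' (real n))"
      by eventually_elim simp
    then obtain n where n: "B \<le> real n" "B + mdist X x (r 0) < gromov_product X x (r (real n)) (r' (real n))"
      using eventually_happens'[OF sequentially_bot] by blast
    have "r (real n) \<in> mspace X" "r' (real n) \<in> mspace X"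
      using geodesic_rayD(1)[OF r(2)] geodesic_rayD(1)[OF r'(2)] by auto
    then have "mdist X (r (real n)) x \<le> mdist X (r (real n)) (r 0) + mdist X (r 0) x"
      "mdist X (r' (real n)) x \<le> mdist X (r' (real n)) (r 0) + mdist X (r 0) x"
      using x p by (auto intro: mdist_triangle)
    then show ?thesis
      using n mdist_commute[of X x "r 0"] by (intro exI[of _ n]) (simp add: gromov_product_def)
  qed
  then have "(r, r') \<in> asymptotic_rays X"
    using slim_imp_asymptotic \<delta> r(2) r'(2) by blast
  then show False
    using boundary_eqI \<xi> \<eta> r(1) r'(1) ne by blast
qed

text \<open>The continuous function \<open>G (_, Inr \<xi>)\<close> is infinite at
  \<open>\<xi>\<close> and, by finiteness of the boundary, bounded by a finite \<open>M\<close> at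
  all other boundary points, so \<open>{M<..}\<close> cuts out \<open>\<xi>\<close> alone.\<close>

lemma boundary_topology_discrete:
  assumes good: "good_gromov_hyperbolic X" and fin: "finite (gromov_boundary X)"
  shows "boundary_topology X = discrete_topology (gromov_boundary X)"
proof -
  have "topspace (boundary_topology X) = gromov_boundary X"
    unfolding boundary_topology_def topspace_pullback_topology
    by (auto simp: compactification_def)
  moreover have "openin (boundary_topology X) {\<xi>}" if \<xi>: "\<xi> \<in> gromov_boundary X" for \<xi>
  proof -
    obtain r where r: "geodesic_ray X r" using boundary_obtain_ray \<xi> by blast
    define x where "x = r 0"
    have x: "x \<in> mspace X" using geodesic_rayD(1)[OF r] by (simp add: x_def)
    obtain G where G: "extends_gromov_product X x G"
      using good x by (auto simp: good_gromov_hyperbolic_def boundary_continuous_def)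
    define M where "M = Max (insert 0 ((\<lambda>\<eta>. G (Inr \<eta>, Inr \<xi>)) ` (gromov_boundary X - {\<xi>})))"
    have "M \<in> insert 0 ((\<lambda>\<eta>. G (Inr \<eta>, Inr \<xi>)) ` (gromov_boundary X - {\<xi>}))"
      unfolding M_def using fin by (intro Max_in) auto
    then have "M = 0 \<or> (\<exists>\<eta>\<in>gromov_boundary X. \<eta> \<noteq> \<xi> \<and> M = G (Inr \<eta>, Inr \<xi>))"
      by blast
    then have M: "M \<noteq> \<infinity>"
      using extends_gromov_product_finite[OF _ x G _ \<xi>] good unfolding good_gromov_hyperbolic_def
      by (metis PInfty_neq_ereal(1) zero_ereal_def)
    have le: "G (Inr \<eta>, Inr \<xi>) \<le> M" if "\<eta> \<in> gromov_boundary X" "\<eta> \<noteq> \<xi>" for \<eta>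
      unfolding M_def using fin that by (intro Max_ge) auto
    define U where "U = {z \<in> topspace (cone_topology X). G (z, Inr \<xi>) \<in> {M<..} \<inter> {0..}}"
    have "continuous_map (cone_topology X) (prod_topology (cone_topology X) (cone_topology X))
        (\<lambda>z. (z, Inr \<xi>))"
      using \<xi> by (intro continuous_map_pairedI) (auto simp: compactification_def)
    then have "continuous_map (cone_topology X) (top_of_set {0..}) (G \<circ> (\<lambda>z. (z, Inr \<xi>)))"
      using G continuous_map_compose unfolding extends_gromov_product_def by blast
    moreover have "openin (top_of_set {0..}) ({M<..} \<inter> {0..})"
      unfolding openin_open by (intro exI[of _ "{M<..}"]) (simp add: Int_commute)
    ultimately have "openin (cone_topology X)
        {z \<in> topspace (cone_topology X). (G \<circ> (\<lambda>z. (z, Inr \<xi>))) z \<in> {M<..} \<inter> {0..}}"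
      by (rule openin_continuous_map_preimage)
    then have "openin (cone_topology X) U"
      by (simp only: U_def o_def)
    moreover have "{\<xi>} = Inr -` U \<inter> gromov_boundary X"
    proof (intro equalityI subsetI)
      fix \<eta> assume "\<eta> \<in> {\<xi>}"
      then show "\<eta> \<in> Inr -` U \<inter> gromov_boundary X"
        using M \<xi> extends_gromov_product_self[OF G x \<xi>]
        by (simp add: U_def compactification_def InrI)
    next
      fix \<eta> assume \<eta>: "\<eta> \<in> Inr -` U \<inter> gromov_boundary X"
      then have "M < G (Inr \<eta>, Inr \<xi>)"
        by (simp add: U_def)
      then show "\<eta> \<in> {\<xi>}"
        using le[of \<eta>] \<eta> by (metis IntE leD singletonI)
    qed
    ultimately show ?thesis
      unfolding boundary_topology_def openin_pullback_topology by blast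
  qed
  ultimately show ?thesis
    by (metis discrete_topology_unique)
qed

text \<open>Geodesic completeness prolongs the segment beyond \<open>y\<close>; the prolongation is
  read backwards, so that it is a ray from \<open>y\<close> that leads straight away from
  \<open>z\<close>.\<close>

lemma backward_ray:
  assumes gc: "geodesically_complete X" and seg: "geodesic_segment X y z S"
  obtains \<rho> where "geodesic_ray X \<rho>" "\<rho> 0 = y" "\<And>t. 0 \<le> t \<Longrightarrow> mdist X z (\<rho> t) = mdist X z y + t"
proof -
  obtain l c where c: "0 \<le> l" "geodesic_on X {0..l} c" "c 0 = y" "c l = z"
    using seg by (auto simp: geodesic_segment_def)
  have "is_interval {0..l}" "{0..l} \<noteq> {}"
    using c(1) by (auto simp: is_interval_cc)
  then obtain c' where c': "geodesic_on X UNIV c'" "\<forall>t\<in>{0..l}. c' t = c t"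
    using gc c(2) unfolding geodesically_complete_def by blast
  have e: "c' 0 = y" "c' l = z" using c c' by auto
  have d: "mdist X (c' s) (c' t) = \<bar>s - t\<bar>" for s t
    using c'(1) by (simp add: geodesic_on_def)
  show ?thesis
  proof (rule that[of "\<lambda>t. c' (- t)"])
    show "geodesic_ray X (\<lambda>t. c' (- t))"
      using c'(1) by (auto simp: geodesic_ray_def geodesic_on_def)
    show "mdist X z (c' (- t)) = mdist X z y + t" if "0 \<le> t" for t
      using d[of l "- t"] d[of l 0] that c(1) e by simp
  qed (use e in simp)
qed

text \<open>Existence of the Busemann limits, and their independence of the ray, comes from
  continuity of the extended product: \<open>b \<xi> y\<close> is the distance to \<open>x\<close>
  minus twice the product of \<open>y\<close> and \<open>\<xi>\<close>. Off the boundary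
  \<open>P\<close> is set to 0 so that its symmetry holds for all arguments.\<close>

lemma boundary_coordinates:
  assumes good: "good_gromov_hyperbolic X" and fin: "finite (gromov_boundary X)" and x: "x \<in> mspace X"
  obtains b P where
    "\<And>\<xi> r y. \<xi> \<in> gromov_boundary X \<Longrightarrow> r \<in> \<xi> \<Longrightarrow> y \<in> mspace X \<Longrightarrow>
       (\<lambda>n. mdist X y (r (real n)) - mdist X x (r (real n))) \<longlonglongrightarrow> b \<xi> y"
    "\<And>\<xi> \<eta> y. \<xi> \<in> gromov_boundary X \<Longrightarrow> \<eta> \<in> gromov_boundary X \<Longrightarrow> \<xi> \<noteq> \<eta> \<Longrightarrow> y \<in> mspace X \<Longrightarrow>
       boundary_gromov_product X y \<xi> \<eta> = ereal ((b \<xi> y + b \<eta> y) / 2 + P \<xi> \<eta>)"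
    "\<And>\<xi> \<eta> y. \<xi> \<in> gromov_boundary X \<Longrightarrow> \<eta> \<in> gromov_boundary X \<Longrightarrow> \<xi> \<noteq> \<eta> \<Longrightarrow> y \<in> mspace X \<Longrightarrow>
       0 \<le> (b \<xi> y + b \<eta> y) / 2 + P \<xi> \<eta>"
    "\<And>\<xi> y. \<xi> \<in> gromov_boundary X \<Longrightarrow> y \<in> mspace X \<Longrightarrow>
       \<exists>\<eta>\<in>gromov_boundary X. \<eta> \<noteq> \<xi> \<and> (b \<xi> y + b \<eta> y) / 2 + P \<xi> \<eta> = 0"
    "\<And>\<xi> y y'. \<xi> \<in> gromov_boundary X \<Longrightarrow> y \<in> mspace X \<Longrightarrow> y' \<in> mspace X \<Longrightarrow> \<bar>b \<xi> y - b \<xi> y'\<bar> \<le> mdist X y y'"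
    "\<And>y y'. y \<in> mspace X \<Longrightarrow> y' \<in> mspace X \<Longrightarrow> \<exists>\<xi>\<in>gromov_boundary X. b \<xi> y - b \<xi> y' = mdist X y y'"
    "\<And>\<xi> \<eta>. P \<xi> \<eta> = P \<eta> \<xi>"
proof -
  have hyp: "gromov_hyperbolic X" and gs: "geodesic_space X" and gc: "geodesically_complete X"
    and bc: "boundary_continuous X"
    using good by (auto simp: good_gromov_hyperbolic_def)
  from bc obtain G where G: "\<And>y. y \<in> mspace X \<Longrightarrow> extends_gromov_product X y (G y)"
    unfolding boundary_continuous_def by metis
  define b where "b \<xi> y = mdist X y x - 2 * real_of_ereal (G x (Inl y, Inr \<xi>))" for \<xi> y
  define P0 where "P0 \<xi> \<eta> = real_of_ereal (G x (Inr \<xi>, Inr \<eta>))" for \<xi> \<eta>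
  define P where "P \<xi> \<eta> = (if \<xi> \<in> gromov_boundary X \<and> \<eta> \<in> gromov_boundary X then P0 \<xi> \<eta> else 0)" for \<xi> \<eta>
  have rX: "r (real n) \<in> mspace X" if "\<xi> \<in> gromov_boundary X" "r \<in> \<xi>" for \<xi> r n
    using that boundary_ray geodesic_rayD(1) of_nat_0_le_iff by blast
  have b: "(\<lambda>n. mdist X y (r (real n)) - mdist X x (r (real n))) \<longlonglongrightarrow> b \<xi> y"
    if \<xi>: "\<xi> \<in> gromov_boundary X" "r \<in> \<xi>" and y: "y \<in> mspace X" for \<xi> r y
  proof -
    note lim = extends_gromov_product_point_ray[OF G[OF x] y \<xi>]
    have "0 \<le> ereal (gromov_product X x y (r (real n)))"
      "ereal (gromov_product X x y (r (real n))) \<le> ereal (mdist X y x)" for n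
      using gromov_product_nonneg[OF x y rX[OF \<xi>]] gromov_product_le[OF x y rX[OF \<xi>]] by auto
    then have "0 \<le> G x (Inl y, Inr \<xi>)" "G x (Inl y, Inr \<xi>) \<le> ereal (mdist X y x)"
      by (auto intro: LIMSEQ_le_const[OF lim] LIMSEQ_le_const2[OF lim])
    then have "G x (Inl y, Inr \<xi>) = ereal (real_of_ereal (G x (Inl y, Inr \<xi>)))"
      by (cases "G x (Inl y, Inr \<xi>)") auto
    then have "(\<lambda>n. gromov_product X x y (r (real n))) \<longlonglongrightarrow> real_of_ereal (G x (Inl y, Inr \<xi>))"
      using lim by (metis lim_ereal)
    then have "(\<lambda>n. mdist X y x - 2 * gromov_product X x y (r (real n))) \<longlonglongrightarrow> b \<xi> y"
      unfolding b_def by (intro tendsto_intros)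
    moreover have "mdist X y x - 2 * gromov_product X x y (r (real n)) =
        mdist X y (r (real n)) - mdist X x (r (real n))" for n
      by (simp add: gromov_product_def mdist_commute[of X x] field_simps)
    ultimately show ?thesis
      by simp
  qed
  have P: "G y (Inr \<xi>, Inr \<eta>) = ereal ((b \<xi> y + b \<eta> y) / 2 + P \<xi> \<eta>)"
    "0 \<le> (b \<xi> y + b \<eta> y) / 2 + P \<xi> \<eta>"
    if \<xi>: "\<xi> \<in> gromov_boundary X" and \<eta>: "\<eta> \<in> gromov_boundary X" and ne: "\<xi> \<noteq> \<eta>" and y: "y \<in> mspace X"
    for \<xi> \<eta> y
  proof -
    obtain r where r: "r \<in> \<xi>" using boundary_obtain_ray \<xi> by blast
    obtain r' where r': "r' \<in> \<eta>" using boundary_obtain_ray \<eta> by blast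
    note limx = extends_gromov_product_ray_ray[OF G[OF x] \<xi> r \<eta> r']
    note limy = extends_gromov_product_ray_ray[OF G[OF y] \<xi> r \<eta> r']
    have nonneg: "0 \<le> G z (Inr \<xi>, Inr \<eta>)" if z: "z \<in> mspace X" for z
      using gromov_product_nonneg[OF z rX[OF \<xi> r] rX[OF \<eta> r']]
      by (intro LIMSEQ_le_const[OF extends_gromov_product_ray_ray[OF G[OF z] \<xi> r \<eta> r']]) auto
    have "G x (Inr \<xi>, Inr \<eta>) = ereal (P \<xi> \<eta>)"
      using nonneg[OF x] extends_gromov_product_finite[OF hyp x G[OF x] \<xi> \<eta> ne] \<xi> \<eta>
      by (cases "G x (Inr \<xi>, Inr \<eta>)") (auto simp: P_def P0_def)
    then have "(\<lambda>n. gromov_product X x (r (real n)) (r' (real n))) \<longlonglongrightarrow> P \<xi> \<eta>"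
      using limx by (metis lim_ereal)
    \<comment> \<open>Changing the base point from \<open>x\<close> to \<open>y\<close> adds half
      the sum of the two differences of distances; this identity passes to the limit.\<close>
    then have "(\<lambda>n. ((mdist X y (r (real n)) - mdist X x (r (real n))) +
         (mdist X y (r' (real n)) - mdist X x (r' (real n)))) / 2 + gromov_product X x (r (real n)) (r' (real n)))
        \<longlonglongrightarrow> (b \<xi> y + b \<eta> y) / 2 + P \<xi> \<eta>"
      using b[OF \<xi> r y] b[OF \<eta> r' y] by (intro tendsto_intros) auto
    also have "(\<lambda>n. ((mdist X y (r (real n)) - mdist X x (r (real n))) +
         (mdist X y (r' (real n)) - mdist X x (r' (real n)))) / 2 + gromov_product X x (r (real n)) (r' (real n)))
      = (\<lambda>n. gromov_product X y (r (real n)) (r' (real n)))"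
      unfolding gromov_product_def mdist_commute[of X _ x] mdist_commute[of X _ y]
      by (intro ext) (simp add: field_simps)
    finally have "(\<lambda>n. ereal (gromov_product X y (r (real n)) (r' (real n)))) \<longlonglongrightarrow>
        ereal ((b \<xi> y + b \<eta> y) / 2 + P \<xi> \<eta>)"
      by simp
    then show eq: "G y (Inr \<xi>, Inr \<eta>) = ereal ((b \<xi> y + b \<eta> y) / 2 + P \<xi> \<eta>)"
      using limy LIMSEQ_unique by blast
    then show "0 \<le> (b \<xi> y + b \<eta> y) / 2 + P \<xi> \<eta>"
      using nonneg[OF y] by simp
  qed
  \<comment> \<open>For each \<open>n\<close> a ray from \<open>y\<close> pointing away from
    \<open>r n\<close> ends at a boundary point whose product with \<open>r n\<close> at
    \<open>y\<close> is 0. One boundary point occurs for infinitely many \<open>n\<close>, and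
    continuity carries the value 0 to \<open>\<xi>\<close>; being finite, it excludes
    \<open>\<xi>\<close> itself.\<close>
  have tight: "\<exists>\<eta>\<in>gromov_boundary X. \<eta> \<noteq> \<xi> \<and> (b \<xi> y + b \<eta> y) / 2 + P \<xi> \<eta> = 0"
    if \<xi>: "\<xi> \<in> gromov_boundary X" and y: "y \<in> mspace X" for \<xi> y
  proof -
    obtain r where r: "r \<in> \<xi>" using boundary_obtain_ray \<xi> by blast
    have "\<exists>\<eta>. \<eta> \<in> gromov_boundary X \<and> G y (Inl (r (real n)), Inr \<eta>) = 0" for n
    proof -
      obtain S where S: "geodesic_segment X y (r (real n)) S"
        using gs y rX[OF \<xi> r] unfolding geodesic_space_def by blast
      obtain \<rho> where \<rho>: "geodesic_ray X \<rho>" "\<rho> 0 = y"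
          "\<And>t. 0 \<le> t \<Longrightarrow> mdist X (r (real n)) (\<rho> t) = mdist X (r (real n)) y + t"
        using backward_ray[OF gc S] by blast
      obtain \<eta> where \<eta>: "\<eta> \<in> gromov_boundary X" "\<rho> \<in> \<eta>"
        using ray_boundary[OF \<rho>(1)] by blast
      have "gromov_product X y (r (real n)) (\<rho> (real m)) = 0" for m
        using \<rho>(3)[of "real m"] geodesic_rayD(2)[OF \<rho>(1), of "real m" 0] \<rho>(2) by (simp add: gromov_product_def)
      then have "(\<lambda>m::nat. ereal 0) \<longlonglongrightarrow> G y (Inl (r (real n)), Inr \<eta>)"
        using extends_gromov_product_point_ray[OF G[OF y] rX[OF \<xi> r] \<eta>, of n] by simp
      then have "G y (Inl (r (real n)), Inr \<eta>) = ereal 0"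
        using LIMSEQ_unique tendsto_const by blast
      then show ?thesis
        using \<eta> by auto
    qed
    then obtain e where e: "\<And>n. e n \<in> gromov_boundary X" "\<And>n. G y (Inl (r (real n)), Inr (e n)) = 0"
      by metis
    have "finite (e ` UNIV)"
      using e(1) fin by (meson finite_subset image_subsetI)
    then obtain m where "infinite {n \<in> UNIV. e n = e m}"
      using pigeonhole_infinite[of "UNIV :: nat set" e] by auto
    then obtain \<sigma> :: "nat \<Rightarrow> nat" where \<sigma>: "strict_mono \<sigma>" "\<And>n. e (\<sigma> n) = e m"
      using infinite_enumerate[of "{n \<in> UNIV. e n = e m}"] by blast
    have "limitin (cone_topology X) ((\<lambda>n. Inl (r (real n))) \<circ> \<sigma>) (Inr \<xi>) sequentially"
      by (rule limitin_subsequence[OF \<sigma>(1) limitin_cone_ray[OF \<xi> r]])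
    moreover have "limitin (cone_topology X) (\<lambda>n. Inr (e m)) (Inr (e m)) sequentially"
      using e(1) by (simp add: compactification_def InrI)
    ultimately have "(\<lambda>n. G y (Inl (r (real (\<sigma> n))), Inr (e m))) \<longlonglongrightarrow> G y (Inr \<xi>, Inr (e m))"
      using extends_gromov_product_limit[OF G[OF y]] unfolding o_def by blast
    moreover have "G y (Inl (r (real (\<sigma> n))), Inr (e m)) = 0" for n
      using e(2)[of "\<sigma> n"] \<sigma>(2) by simp
    ultimately have zero: "G y (Inr \<xi>, Inr (e m)) = 0"
      using LIMSEQ_unique tendsto_const by (metis (no_types, lifting) ext)
    then have "e m \<noteq> \<xi>"
      using extends_gromov_product_self[OF G[OF y] y \<xi>] by auto
    then show ?thesis
      using P(1)[OF \<xi> e(1) _ y, of m] zero e(1) by (intro bexI[of _ "e m"]) (auto simp: zero_ereal_def)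
  qed
  have lip: "\<bar>b \<xi> y - b \<xi> y'\<bar> \<le> mdist X y y'"
    if \<xi>: "\<xi> \<in> gromov_boundary X" and y: "y \<in> mspace X" "y' \<in> mspace X" for \<xi> y y'
  proof -
    obtain r where r: "r \<in> \<xi>" using boundary_obtain_ray \<xi> by blast
    have "(\<lambda>n. \<bar>(mdist X y (r (real n)) - mdist X x (r (real n))) - (mdist X y' (r (real n)) - mdist X x (r (real n)))\<bar>)
        \<longlonglongrightarrow> \<bar>b \<xi> y - b \<xi> y'\<bar>"
      by (intro tendsto_intros b \<xi> r y)
    moreover have "\<bar>(mdist X y (r (real n)) - mdist X x (r (real n))) - (mdist X y' (r (real n)) - mdist X x (r (real n)))\<bar>
        \<le> mdist X y y'" for n
      using mdist_triangle[OF y(1) y(2) rX[OF \<xi> r], of n] mdist_triangle[OF y(2) y(1) rX[OF \<xi> r], of n]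
        mdist_commute[of X y y'] by simp
    ultimately show ?thesis
      by (intro LIMSEQ_le_const2) auto
  qed
  \<comment> \<open>Along the ray from \<open>y'\<close> pointing away from \<open>y\<close>, the
    distances to \<open>y\<close> and \<open>y'\<close> differ by exactly
    \<open>mdist X y y'\<close>.\<close>
  have dir: "\<exists>\<xi>\<in>gromov_boundary X. b \<xi> y - b \<xi> y' = mdist X y y'"
    if y: "y \<in> mspace X" "y' \<in> mspace X" for y y'
  proof -
    obtain S where "geodesic_segment X y' y S"
      using gs y unfolding geodesic_space_def by blast
    then obtain \<rho> where \<rho>: "geodesic_ray X \<rho>" "\<rho> 0 = y'" "\<And>t. 0 \<le> t \<Longrightarrow> mdist X y (\<rho> t) = mdist X y y' + t"
      using backward_ray[OF gc] by blast
    obtain \<xi> where \<xi>: "\<xi> \<in> gromov_boundary X" "\<rho> \<in> \<xi>"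
      using ray_boundary[OF \<rho>(1)] by blast
    have "(mdist X y (\<rho> (real n)) - mdist X x (\<rho> (real n))) - (mdist X y' (\<rho> (real n)) - mdist X x (\<rho> (real n)))
        = mdist X y y'" for n
      using \<rho>(3)[of "real n"] geodesic_rayD(2)[OF \<rho>(1), of 0 "real n"] \<rho>(2) by simp
    moreover have "(\<lambda>n. (mdist X y (\<rho> (real n)) - mdist X x (\<rho> (real n))) - (mdist X y' (\<rho> (real n)) - mdist X x (\<rho> (real n))))
        \<longlonglongrightarrow> b \<xi> y - b \<xi> y'"
      by (intro tendsto_intros b \<xi> y)
    ultimately have "(\<lambda>n::nat. mdist X y y') \<longlonglongrightarrow> b \<xi> y - b \<xi> y'"
      by simp
    then have "b \<xi> y - b \<xi> y' = mdist X y y'"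
      using LIMSEQ_unique tendsto_const by blast
    then show ?thesis
      using \<xi> by blast
  qed
  have sym: "P \<xi> \<eta> = P \<eta> \<xi>" for \<xi> \<eta>
  proof (cases "\<xi> \<in> gromov_boundary X \<and> \<eta> \<in> gromov_boundary X")
    case True
    then obtain r r' where r: "r \<in> \<xi>" "r' \<in> \<eta>" using boundary_obtain_ray by metis
    have "G x (Inr \<xi>, Inr \<eta>) = G x (Inr \<eta>, Inr \<xi>)"
      using extends_gromov_product_ray_ray[OF G[OF x], of \<xi> r \<eta> r']
        extends_gromov_product_ray_ray[OF G[OF x], of \<eta> r' \<xi> r] True r
      by (simp add: gromov_product_commute[of X x "r' _"] LIMSEQ_unique)
    then show ?thesis by (simp add: P_def P0_def)
  qed (auto simp: P_def)
  show ?thesis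
  proof (rule that[of b P])
    show "boundary_gromov_product X y \<xi> \<eta> = ereal ((b \<xi> y + b \<eta> y) / 2 + P \<xi> \<eta>)"
      if "\<xi> \<in> gromov_boundary X" "\<eta> \<in> gromov_boundary X" "\<xi> \<noteq> \<eta>" "y \<in> mspace X" for \<xi> \<eta> y
      using boundary_gromov_product_eq[OF G] P(1) that by simp
  qed ((rule b P(2) tight lip dir; assumption) | rule sym)+
qed

section \<open>The tight span as a good Gromov hyperbolic space\<close>

text \<open>A generalized ray that ends at \<open>y\<close> is constant after some time
  \<open>R\<close>, whereas one nearby that continued to time \<open>R + 1\<close> would still move
  by 1. So the nearby ones have stopped by then, and their end points are close to
  \<open>y\<close>.\<close>

lemma openin_cone_topology_points:
  assumes W: "W \<subseteq> mspace X"
    and ball: "\<And>y. y \<in> W \<Longrightarrow> \<exists>\<epsilon>>0. \<forall>z\<in>mspace X. mdist X y z < \<epsilon> \<longrightarrow> z \<in> W"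
  shows "openin (cone_topology X) (Inl ` W)"
  unfolding openin_cone_topology cone_closed_def
proof (intro conjI ballI allI impI)
  show "Inl ` W \<subseteq> compactification X"
    using W by (auto simp: compactification_def)
  show "compactification X - Inl ` W \<subseteq> compactification X"
    by blast
  fix p zs z
  assume *: "(\<forall>n. zs n \<in> compactification X - Inl ` W) \<and> cone_converges X p zs z"
  then have zs: "zs n \<notin> Inl ` W" for n
    by blast
  have "z \<notin> Inl ` W"
  proof
    assume "z \<in> Inl ` W"
    then obtain y where y: "y \<in> W" "z = Inl y"
      by blast
    have yX: "y \<in> mspace X"
      using y W by blast
    obtain \<epsilon> where \<epsilon>: "\<epsilon> > 0" "\<And>u. u \<in> mspace X \<Longrightarrow> mdist X y u < \<epsilon> \<Longrightarrow> u \<in> W"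
      using ball[OF y(1)] by blast
    obtain c where c: "\<And>n. generalized_ray X p (c n) (zs n)"
      and sub: "\<And>\<sigma>::nat \<Rightarrow> nat. strict_mono \<sigma> \<Longrightarrow>
        \<exists>(\<tau>::nat \<Rightarrow> nat) c'. strict_mono \<tau> \<and> generalized_ray X p c' z \<and>
          converges_on_compacts X (\<lambda>n. c (\<sigma> (\<tau> n))) c'"
      using conjunct2[OF *] unfolding cone_converges_def by blast
    obtain \<tau> :: "nat \<Rightarrow> nat" and c' where c': "generalized_ray X p c' z"
      "converges_on_compacts X (\<lambda>n. c (\<tau> n)) c'"
      using sub[of "\<lambda>n. n"] by (auto simp: strict_mono_def)
    obtain R where R: "0 \<le> R" "\<And>t. R \<le> t \<Longrightarrow> c' t = y"
      using c'(1) y(2) by (auto simp: generalized_ray_def)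
    \<comment> \<open>Two values within \<open>1 / 2\<close> of \<open>y\<close> cannot be at
      distance 1, and \<open>\<epsilon>\<close> keeps an end point inside \<open>W\<close>.\<close>
    have "\<exists>N. \<forall>n\<ge>N. \<forall>t\<in>{0..R + 1}. mdist X (c (\<tau> n) t) (c' t) < min \<epsilon> (1 / 2)"
      using c'(2) R(1) \<epsilon>(1) unfolding converges_on_compacts_def by (auto simp: min_def)
    then obtain n where n: "\<And>t. 0 \<le> t \<Longrightarrow> t \<le> R + 1 \<Longrightarrow> mdist X (c (\<tau> n) t) (c' t) < min \<epsilon> (1 / 2)"
      by (metis atLeastAtMost_iff order_refl)
    let ?c = "c (\<tau> n)"
    have near: "mdist X (?c R) y < 1 / 2" "mdist X (?c (R + 1)) y < min \<epsilon> (1 / 2)"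
      using n[of R] n[of "R + 1"] R by auto
    have False if g: "geodesic_on X {0..R + 1} ?c"
    proof -
      have "?c R \<in> mspace X" "?c (R + 1) \<in> mspace X" "mdist X (?c R) (?c (R + 1)) = 1"
        using g R(1) by (auto simp: geodesic_on_def)
      then show False
        using mdist_triangle[of "?c R" X y "?c (R + 1)"] near yX mdist_commute[of X y "?c (R + 1)"] by simp
    qed
    note long = this
    show False
    proof (cases "zs (\<tau> n)")
      case (Inl u)
      then obtain R' where R': "R' \<ge> 0" "geodesic_on X {0..R'} ?c" "\<And>t. R' \<le> t \<Longrightarrow> ?c t = u"
        using c[of "\<tau> n"] by (auto simp: generalized_ray_def)
      have "u \<in> mspace X"
        using R'(1,2) R'(3)[of R'] by (auto simp: geodesic_on_def)
      show False
      proof (cases "R' \<le> R + 1")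
        case True
        then have "mdist X y u < \<epsilon>"
          using near(2) R'(3) mdist_commute[of X u y] by simp
        then show False
          using \<epsilon>(2) \<open>u \<in> mspace X\<close> zs[of "\<tau> n"] Inl by blast
      next
        case False
        have "geodesic_on X {0..R + 1} ?c"
          using R'(2) by (rule geodesic_on_subset) (use False in auto)
        then show False by (rule long)
      qed
    next
      case (Inr \<eta>)
      then have "geodesic_ray X ?c"
        using c[of "\<tau> n"] boundary_ray by (auto simp: generalized_ray_def)
      then have "geodesic_on X {0..R + 1} ?c"
        unfolding geodesic_ray_def by (rule geodesic_on_subset) auto
      then show False by (rule long)
    qed
  qed
  then show "z \<in> compactification X - Inl ` W"
    using cone_converges_compactification[OF conjunct2[OF *]] by simp
qed

text \<open>Coordinates are kept apart from points because the copy used for maximality has its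
  points in \<open>nat \<Rightarrow> real\<close>.\<close>

locale tight_span_metric = tight_span D for D :: "'n::finite \<Rightarrow> 'n \<Rightarrow> real" +
  fixes Y :: "'b metric" and co :: "'b \<Rightarrow> real ^ 'n"
  assumes co_image: "co ` mspace Y = tspan"
    and mdist_co: "y \<in> mspace Y \<Longrightarrow> z \<in> mspace Y \<Longrightarrow> mdist Y y z = infnorm (co y - co z)"
begin

definition pt :: "real ^ 'n \<Rightarrow> 'b" where
  "pt = inv_into (mspace Y) co"

lemma co_tspan: "y \<in> mspace Y \<Longrightarrow> co y \<in> tspan"
  using co_image by blast

lemma pt [simp]: "v \<in> tspan \<Longrightarrow> pt v \<in> mspace Y" "v \<in> tspan \<Longrightarrow> co (pt v) = v"
  unfolding pt_def co_image[symmetric] by (auto intro: inv_into_into f_inv_into_f)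

lemma co_eq_iff:
  assumes "y \<in> mspace Y" "z \<in> mspace Y" shows "co y = co z \<longleftrightarrow> y = z"
  using mdist_co[OF assms] mdist_zero[OF assms] infnorm_0 by auto

lemma pt_co: "y \<in> mspace Y \<Longrightarrow> pt (co y) = y"
  using co_eq_iff[of "pt (co y)" y] co_tspan by simp

lemma mdist_pt: "v \<in> tspan \<Longrightarrow> w \<in> tspan \<Longrightarrow> mdist Y (pt v) (pt w) = infnorm (v - w)"
  by (simp add: mdist_co)

lemma co_lipschitz:
  assumes "y \<in> mspace Y" "z \<in> mspace Y" shows "\<bar>co y $ i - co z $ i\<bar> \<le> mdist Y y z"
  using component_le_infnorm_cart[of "co y - co z" i] mdist_co[OF assms] by simp

lemma co_feasible:
  assumes "y \<in> mspace Y" "i \<noteq> j" shows "D i j \<le> co y $ i + co y $ j"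
  using feasibleD[OF tspan_feasible[OF co_tspan]] assms by blast

lemma mdist_below:
  assumes "y \<in> mspace Y" "z \<in> mspace Y" "co y $ i \<le> \<alpha> i \<or> co z $ i \<le> \<alpha> i"
  shows "mdist Y y z = \<bar>co y $ i - co z $ i\<bar>"
  using tspan_dist_below[OF co_tspan co_tspan] assms mdist_co by simp

lemma co_below:
  assumes "y \<in> mspace Y" "co y $ i \<le> \<alpha> i" "j \<noteq> i" shows "co y $ j = D i j - co y $ i"
  using tspan_below_alpha[OF co_tspan[OF assms(1)] assms(2)] assms(3) by (metis end_point_nth(2))

text \<open>Inside an end distances are differences of coordinate \<open>i\<close>, so a geodesic
  that goes down to \<open>a\<close> and up again could be shortened by turning around earlier, at
  the latest at the mouth of the end.\<close>

lemma between_below: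
  assumes p: "p \<in> mspace Y" and a: "a \<in> mspace Y" and y: "y \<in> mspace Y"
    and sum: "mdist Y p a + mdist Y a y = mdist Y p y"
    and lt: "co a $ i < \<alpha> i" "co a $ i < co p $ i"
  shows "co y $ i \<le> co a $ i"
proof (rule ccontr)
  assume gt: "\<not> ?thesis"
  have pa: "mdist Y p a = co p $ i - co a $ i" and ay: "mdist Y a y = co y $ i - co a $ i"
    using mdist_below[OF p a, of i] mdist_below[OF a y, of i] lt gt by auto
  show False
  proof (cases "co p $ i \<le> \<alpha> i \<or> co y $ i \<le> \<alpha> i")
    case True
    then show False
      using mdist_below[OF p y, of i] pa ay sum lt gt by auto
  next
    case False
    \<comment> \<open>Compared with the way through \<open>a\<close>, the way through
      \<open>e\<close> saves \<open>2 * (\<alpha> i - co a $ i)\<close>.\<close>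
    define e where "e = pt (end_point i (\<alpha> i))"
    have e: "e \<in> mspace Y" "co e $ i = \<alpha> i"
      by (simp_all add: e_def end_point_tspan)
    have "mdist Y p e = co p $ i - \<alpha> i" "mdist Y e y = co y $ i - \<alpha> i"
      using mdist_below[OF p e(1), of i] mdist_below[OF e(1) y, of i] e(2) False by auto
    then show False
      using mdist_triangle[OF p e(1) y] pa ay sum lt by simp
  qed
qed

lemma geodesic_space: "geodesic_space Y"
  unfolding geodesic_space_def
proof (intro ballI)
  fix x y assume x: "x \<in> mspace Y" and y: "y \<in> mspace Y"
  define l where "l = infnorm (co x - co y)"
  obtain c where c: "c 0 = co x" "c l = co y" "\<And>t. 0 \<le> t \<Longrightarrow> t \<le> l \<Longrightarrow> c t \<in> tspan"
    "\<And>s t. 0 \<le> s \<Longrightarrow> s \<le> l \<Longrightarrow> 0 \<le> t \<Longrightarrow> t \<le> l \<Longrightarrow> infnorm (c s - c t) = \<bar>s - t\<bar>"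
    using tspan_geodesic[OF co_tspan[OF x] co_tspan[OF y]] unfolding l_def by metis
  have "geodesic_on Y {0..l} (pt \<circ> c)"
    using c(3,4) by (auto simp: geodesic_on_def mdist_pt)
  moreover have "0 \<le> l"
    by (simp add: l_def infnorm_pos_le)
  ultimately have "geodesic_segment Y x y ((pt \<circ> c) ` {0..l})"
    unfolding geodesic_segment_def using c(1,2) pt_co x y
    by (intro exI[of _ l] exI[of _ "pt \<circ> c"]) auto
  then show "\<exists>S. geodesic_segment Y x y S" by blast
qed

lemma segment_end_points:
  assumes "geodesic_segment X x y S" shows "x \<in> S" "y \<in> S"
  using assms unfolding geodesic_segment_def by force+

lemma segment_ivt:
  assumes S: "geodesic_segment Y u v S"
    and s: "co u $ i \<le> s \<and> s \<le> co v $ i \<or> co v $ i \<le> s \<and> s \<le> co u $ i"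
  shows "\<exists>b\<in>S. co b $ i = s"
proof -
  obtain l c where c: "0 \<le> l" "geodesic_on Y {0..l} c" "c 0 = u" "c l = v" "S = c ` {0..l}"
    using S by (auto simp: geodesic_segment_def)
  have "1-lipschitz_on {0..l} (\<lambda>t. co (c t) $ i)"
  proof (rule lipschitz_onI)
    fix t t' assume t: "t \<in> {0..l}" "t' \<in> {0..l}"
    then have "c t \<in> mspace Y" "c t' \<in> mspace Y" "mdist Y (c t) (c t') = \<bar>t - t'\<bar>"
      using c(2) by (auto simp: geodesic_on_def)
    then show "dist (co (c t) $ i) (co (c t') $ i) \<le> 1 * dist t t'"
      using co_lipschitz[of "c t" "c t'" i] by (simp add: dist_real_def)
  qed simp
  then have cont: "continuous_on {0..l} (\<lambda>t. co (c t) $ i)"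
    by (rule lipschitz_on_continuous_on)
  from s have "\<exists>t\<ge>0. t \<le> l \<and> co (c t) $ i = s"
  proof
    assume "co u $ i \<le> s \<and> s \<le> co v $ i"
    then show ?thesis
      using IVT'[of "\<lambda>t. co (c t) $ i" 0 s l] cont c by auto
  next
    assume "co v $ i \<le> s \<and> s \<le> co u $ i"
    then show ?thesis
      using IVT2'[of "\<lambda>t. co (c t) $ i" l s 0] cont c by auto
  qed
  then show ?thesis
    using c(5) by auto
qed

text \<open>\<open>\<delta>\<close> bounds the diameter of the core, so for a point in the core it
  suffices that another side meets the core. If none did, both would stay in one end by the
  intermediate value theorem, and so would the vertices of the first side.\<close>

lemma gromov_hyperbolic: "gromov_hyperbolic Y"
proof -
  obtain B where B: "\<And>v i. v \<in> tspan \<Longrightarrow> (\<And>i. \<alpha> i \<le> v $ i) \<Longrightarrow> \<bar>v $ i\<bar> \<le> B"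
    using tspan_above_alpha_bounded by blast
  define \<delta> where "\<delta> = 2 * \<bar>B\<bar>"
  have close: "mdist Y a b \<le> \<delta>"
    if "a \<in> mspace Y" "b \<in> mspace Y" "\<And>i. \<alpha> i \<le> co a $ i" "\<And>i. \<alpha> i \<le> co b $ i" for a b
  proof -
    have "\<bar>co a $ i - co b $ i\<bar> \<le> \<delta>" for i
      using B[OF co_tspan[OF that(1)] that(3), of i] B[OF co_tspan[OF that(2)] that(4), of i]
      by (simp add: \<delta>_def)
    then show ?thesis
      unfolding mdist_co[OF that(1,2)] by (simp add: infnorm_le_iff_cart)
  qed
  have "\<exists>b\<in>S \<union> T. mdist Y a b \<le> \<delta>"
    if R: "geodesic_segment Y x y R" and S: "geodesic_segment Y y z S"
      and T: "geodesic_segment Y z x T" and a: "a \<in> R" for x y z R S T a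
  proof -
    note aX = geodesic_segment_sum(1)[OF R a] and sum = geodesic_segment_sum(2)[OF R a]
    have X: "x \<in> mspace Y" "y \<in> mspace Y" "z \<in> mspace Y"
      using geodesic_segment_sum(1) R S segment_end_points by metis+
    \<comment> \<open>Distances from \<open>x\<close> and \<open>y\<close> are differences of
      coordinate \<open>i\<close>, so a point of the segment cannot lie above both.\<close>
    have not_both: "\<not> (co x $ i < co a $ i \<and> co y $ i < co a $ i)"
      if "co x $ i < \<alpha> i" "co y $ i < \<alpha> i" for i
      using mdist_below[OF X(1) aX, of i] mdist_below[OF aX X(2), of i] mdist_below[OF X(1) X(2), of i]
        sum that by auto
    show ?thesis
    proof (cases "\<exists>i. co a $ i < \<alpha> i")
      case True
      then obtain i where i: "co a $ i < \<alpha> i" by blast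
      \<comment> \<open>Inside an end the coordinate \<open>i\<close> determines the point, so it suffices to find the value
        \<open>co a $ i\<close> on the other two sides.\<close>
      have "co y $ i \<le> co a $ i" if "co a $ i < co x $ i"
        using between_below[OF X(1) aX X(2) sum i that] .
      moreover have "co x $ i \<ge> co a $ i \<or> co y $ i \<ge> co a $ i"
        using not_both[of i] i by linarith
      ultimately have "co x $ i \<le> co a $ i \<and> co a $ i \<le> co y $ i \<or>
          co y $ i \<le> co a $ i \<and> co a $ i \<le> co x $ i"
        by linarith
      then have "(co y $ i \<le> co a $ i \<and> co a $ i \<le> co z $ i \<or> co z $ i \<le> co a $ i \<and> co a $ i \<le> co y $ i) \<or>
          (co z $ i \<le> co a $ i \<and> co a $ i \<le> co x $ i \<or> co x $ i \<le> co a $ i \<and> co a $ i \<le> co z $ i)"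
        by linarith
      then have "\<exists>b\<in>S \<union> T. co b $ i = co a $ i"
        using segment_ivt[OF S, of i "co a $ i"] segment_ivt[OF T, of i "co a $ i"] by blast
      then obtain b where b: "b \<in> S \<union> T" "co b $ i = co a $ i"
        by blast
      then have "b \<in> mspace Y"
        using geodesic_segment_sum(1)[OF S] geodesic_segment_sum(1)[OF T] by blast
      then have "mdist Y a b = 0"
        using mdist_below[OF aX, of b i] b(2) i by simp
      then show ?thesis
        using b(1) by (intro bexI[of _ b]) (simp_all add: \<delta>_def)
    next
      case False
      then have core: "\<And>i. \<alpha> i \<le> co a $ i"
        by (simp add: not_less)
      show ?thesis
      proof (rule ccontr)
        assume no: "\<not> ?thesis"
        have far: "\<exists>i. co b $ i < \<alpha> i" if "b \<in> S \<union> T" for b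
        proof (rule ccontr)
          assume "\<nexists>i. co b $ i < \<alpha> i"
          then have "mdist Y a b \<le> \<delta>"
            using close[OF aX _ core] that geodesic_segment_sum(1)[OF S] geodesic_segment_sum(1)[OF T]
            by (metis UnE not_less)
          then show False using no that by blast
        qed
        \<comment> \<open>A coordinate equal to \<open>\<alpha> i\<close> occurs only at the end
          point of the half-line, which is in the core.\<close>
        have ne: "co b $ i \<noteq> \<alpha> i" if b: "b \<in> S \<union> T" for b i
        proof
          assume eq: "co b $ i = \<alpha> i"
          have bX: "b \<in> mspace Y"
            using b geodesic_segment_sum(1)[OF S] geodesic_segment_sum(1)[OF T] by blast
          have "\<alpha> j \<le> co b $ j" for j
            using co_below[OF bX, of i j] eq alpha_sum[of i j] by (cases "j = i") auto
          then show False
            using far[OF b] by (metis not_less)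
        qed
        obtain i where xi: "co x $ i < \<alpha> i"
          using far segment_end_points(2)[OF T] by blast
        have zi: "co z $ i < \<alpha> i"
        proof (rule ccontr)
          assume "\<not> ?thesis"
          then have "\<exists>b\<in>T. co b $ i = \<alpha> i"
            using xi by (intro segment_ivt[OF T]) auto
          then show False using ne by blast
        qed
        have yi: "co y $ i < \<alpha> i"
        proof (rule ccontr)
          assume "\<not> ?thesis"
          then have "\<exists>b\<in>S. co b $ i = \<alpha> i"
            using zi by (intro segment_ivt[OF S]) auto
          then show False using ne by blast
        qed
        show False
          using not_both[OF xi yi] core[of i] xi yi by linarith
      qed
    qed
  qed
  then have "geodesic_triangles_slim Y \<delta>"
    unfolding geodesic_triangles_slim_def by blast
  moreover have "0 \<le> \<delta>"
    by (simp add: \<delta>_def)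
  ultimately show ?thesis
    unfolding gromov_hyperbolic_def using geodesic_space by blast
qed

lemma proper_space: "proper_space Y"
  unfolding proper_space_def
proof (intro ballI allI)
  interpret M: Metric_space "mspace Y" "mdist Y"
    by (rule Metric_space_mspace_mdist)
  fix x r assume x: "x \<in> mspace Y"
  define K where "K = tspan \<inter> {v. infnorm (co x - v) \<le> r}"
  have "closed K"
    unfolding K_def by (intro closed_Int closed_tspan closed_Collect_le continuous_intros)
  moreover have "bounded K"
  proof -
    have "norm (co x - v) \<le> sqrt (DIM(real ^ 'n)) * r" if "v \<in> K" for v
    proof -
      have "norm (co x - v) \<le> sqrt (DIM(real ^ 'n)) * infnorm (co x - v)"
        by (rule norm_le_infnorm)
      also have "\<dots> \<le> sqrt (DIM(real ^ 'n)) * r"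
        using that by (intro mult_left_mono) (auto simp: K_def)
      finally show ?thesis .
    qed
    then show ?thesis
      unfolding bounded_def dist_norm by blast
  qed
  ultimately have "compact K"
    by (simp add: compact_eq_bounded_closed)
  then have K: "seq_compact K"
    by (rule compact_imp_seq_compact)
  have "compactin M.mtopology (M.mcball x r)"
    unfolding M.compactin_sequentially
  proof (intro conjI allI impI)
    show "M.mcball x r \<subseteq> mspace Y" by auto
    fix \<sigma> :: "nat \<Rightarrow> 'b" assume \<sigma>: "range \<sigma> \<subseteq> M.mcball x r"
    then have \<sigma>B: "\<sigma> n \<in> M.mcball x r" for n
      by (rule range_subsetD)
    then have \<sigma>Y: "\<sigma> n \<in> mspace Y" for n
      by simp
    have "co (\<sigma> n) \<in> K" for n
      using \<sigma>B[of n] mdist_co[OF x \<sigma>Y[of n]] co_tspan[OF \<sigma>Y[of n]] by (simp add: K_def)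
    then obtain v \<rho> where v: "v \<in> K" "strict_mono \<rho>" "((\<lambda>n. co (\<sigma> n)) \<circ> \<rho>) \<longlonglongrightarrow> v"
      using K unfolding seq_compact_def by metis
    have vt: "v \<in> tspan" "infnorm (co x - v) \<le> r"
      using v(1) by (auto simp: K_def)
    have "pt v \<in> M.mcball x r"
      using vt x by (simp add: mdist_co)
    moreover have "limitin M.mtopology (\<sigma> \<circ> \<rho>) (pt v) sequentially"
    proof -
      have "(\<lambda>n. infnorm (co (\<sigma> (\<rho> n)) - v)) \<longlonglongrightarrow> infnorm (v - v)"
        using v(3) unfolding o_def by (intro tendsto_intros)
      then have "(\<lambda>n. mdist Y (\<sigma> (\<rho> n)) (pt v)) \<longlonglongrightarrow> 0"
        using vt(1) \<sigma>Y by (simp add: mdist_co infnorm_0)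
      then show ?thesis
        unfolding M.limit_metric_sequentially using vt(1) \<sigma>Y
        by (auto simp: LIMSEQ_iff)
    qed
    ultimately show "\<exists>l \<rho>. l \<in> M.mcball x r \<and> strict_mono \<rho> \<and> limitin M.mtopology (\<sigma> \<circ> \<rho>) l sequentially"
      using v(2) by blast
  qed
  then show "compactin (mtopology_of Y) (mcball_of Y x r)"
    by (simp add: mtopology_of_def mcball_of_def)
qed

end

section \<open>Geodesic completeness of the tight span\<close>

context tight_span_metric
begin

text \<open>Such a geodesic runs towards end \<open>i\<close> and is calibrated by its Busemann
  function. Geodesics need not concatenate to geodesics, but those calibrated by the same coordinate
  do.\<close>

definition directed :: "real set \<Rightarrow> (real \<Rightarrow> 'b) \<Rightarrow> 'n \<Rightarrow> bool" where
  "directed I c i \<longleftrightarrow> geodesic_on Y I c \<and>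
     (\<forall>s\<in>I. \<forall>t\<in>I. s \<le> t \<longrightarrow> co (c s) $ i - co (c t) $ i = t - s)"

lemma directedI:
  assumes c: "\<And>t. t \<in> I \<Longrightarrow> c t \<in> mspace Y"
    and lip: "\<And>s t. s \<in> I \<Longrightarrow> t \<in> I \<Longrightarrow> s \<le> t \<Longrightarrow> mdist Y (c s) (c t) \<le> t - s"
    and dir: "\<And>s t. s \<in> I \<Longrightarrow> t \<in> I \<Longrightarrow> s \<le> t \<Longrightarrow> co (c s) $ i - co (c t) $ i = t - s"
  shows "directed I c i"
proof -
  have *: "mdist Y (c s) (c t) = t - s" if "s \<in> I" "t \<in> I" "s \<le> t" for s t
    using lip[OF that] dir[OF that] co_lipschitz[OF c[OF that(1)] c[OF that(2)], of i] by linarith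
  have "mdist Y (c s) (c t) = \<bar>s - t\<bar>" if "s \<in> I" "t \<in> I" for s t
    using *[OF that] *[OF that(2) that(1)] mdist_commute[of Y "c s" "c t"] by (cases "s \<le> t") auto
  then show ?thesis
    using c dir by (auto simp: directed_def geodesic_on_def)
qed

text \<open>If every coordinate failed to have slope \<open>-1\<close> on some pair of parameters, then each would fail
  on the smallest interval that contains these finitely many pairs.\<close>

lemma geodesic_directed:
  assumes c: "geodesic_on Y I c"
  obtains i where "directed I c i"
proof (rule ccontr)
  assume "\<not> thesis"
  then have no: "\<not> directed I c i" for i
    using that by blast
  have cY: "c t \<in> mspace Y" if "t \<in> I" for t
    using c that by (auto simp: geodesic_on_def)
  have d: "mdist Y (c s) (c t) = \<bar>s - t\<bar>" if "s \<in> I" "t \<in> I" for s t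
    using c that by (auto simp: geodesic_on_def)
  have "\<exists>s t. s \<in> I \<and> t \<in> I \<and> s \<le> t \<and> co (c s) $ i - co (c t) $ i \<noteq> t - s" for i
    using no[of i] c by (auto simp: directed_def)
  then obtain s t where st: "\<And>i. s i \<in> I" "\<And>i. t i \<in> I" "\<And>i. s i \<le> t i"
      "\<And>i. co (c (s i)) $ i - co (c (t i)) $ i \<noteq> t i - s i"
    by metis
  define S where "S = Min (range s)"
  define T where "T = Max (range t)"
  have "S \<in> range s" "T \<in> range t"
    unfolding S_def T_def by (auto intro: Min_in Max_in)
  then have ST: "S \<in> I" "T \<in> I"
    using st(1,2) by auto
  have le: "S \<le> s i" "t i \<le> T" for i
    unfolding S_def T_def by (auto intro: Min_le Max_ge)
  obtain i where i: "co (c S) $ i - co (c T) $ i = infnorm (co (c S) - co (c T))"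
    using tspan_direction[OF co_tspan[OF cY[OF ST(1)]] co_tspan[OF cY[OF ST(2)]]] by blast
  have "infnorm (co (c S) - co (c T)) = T - S"
    using mdist_co[OF cY[OF ST(1)] cY[OF ST(2)]] d[OF ST] le[of i] st(3)[of i] by simp
  moreover have "\<bar>co (c S) $ i - co (c (s i)) $ i\<bar> \<le> s i - S"
    using co_lipschitz[OF cY[OF ST(1)] cY[OF st(1)], of i i] d[OF ST(1) st(1)[of i]] le[of i] by simp
  moreover have "\<bar>co (c (s i)) $ i - co (c (t i)) $ i\<bar> \<le> t i - s i"
    using co_lipschitz[OF cY[OF st(1)] cY[OF st(2)], of i i i] d[OF st(1,2)[of i]] st(3)[of i] by simp
  moreover have "\<bar>co (c (t i)) $ i - co (c T) $ i\<bar> \<le> T - t i"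
    using co_lipschitz[OF cY[OF st(2)] cY[OF ST(2)], of i i] d[OF st(2)[of i] ST(2)] le[of i] by simp
  ultimately show False
    using i st(4)[of i] by linarith
qed

text \<open>Across the joint the fall of coordinate \<open>i\<close> bounds the distance from below
  and the triangle inequality bounds it from above.\<close>

lemma directed_concat:
  assumes I: "directed I c i" and J: "directed J c' i" and b: "b \<in> I" "b \<in> J" "c b = c' b"
    and sub: "I \<subseteq> {..b}" "J \<subseteq> {b..}"
  shows "directed (I \<union> J) (\<lambda>t. if t \<in> I then c t else c' t) i"
proof -
  define h where "h t = (if t \<in> I then c t else c' t)" for t
  have hI: "h t = c t" if "t \<in> I" for t using that by (simp add: h_def)
  have hJ: "h t = c' t" if "t \<in> J" for t
  proof (cases "t \<in> I")
    case True
    then have "t = b"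
      using that sub by force
    then show ?thesis
      using b by (simp add: h_def)
  qed (simp add: h_def)
  have cY: "h t \<in> mspace Y" if "t \<in> I \<union> J" for t
    using that I J hI hJ by (auto simp: directed_def geodesic_on_def)
  have dI: "mdist Y (h s) (h t) \<le> t - s" "co (h s) $ i - co (h t) $ i = t - s"
    if "s \<in> I" "t \<in> I" "s \<le> t" for s t
    using that I hI by (auto simp: directed_def geodesic_on_def)
  have dJ: "mdist Y (h s) (h t) \<le> t - s" "co (h s) $ i - co (h t) $ i = t - s"
    if "s \<in> J" "t \<in> J" "s \<le> t" for s t
    using that J hJ by (auto simp: directed_def geodesic_on_def)
  have "mdist Y (h s) (h t) \<le> t - s \<and> co (h s) $ i - co (h t) $ i = t - s"
    if st: "s \<in> I \<union> J" "t \<in> I \<union> J" "s \<le> t" for s t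
  proof -
    consider "s \<in> I" "t \<in> I" | "s \<in> J" "t \<in> J" | "s \<in> I" "t \<in> J" | "s \<in> J" "t \<in> I"
      using st by blast
    then show ?thesis
    proof cases
      case 3
      then have le: "s \<le> b" "b \<le> t" using sub by auto
      have "mdist Y (h s) (h t) \<le> mdist Y (h s) (h b) + mdist Y (h b) (h t)"
        using st b cY by (intro mdist_triangle) auto
      then show ?thesis
        using dI[OF 3(1) b(1) le(1)] dJ[OF b(2) 3(2) le(2)] by auto
    next
      case 4
      then have "s = b" "t = b" using sub st(3) by force+
      then show ?thesis using dI[OF b(1) b(1)] by simp
    qed (use st dI dJ in auto)
  qed
  then have "directed (I \<union> J) h i"
    using cY by (intro directedI) auto
  then show ?thesis
    by (simp add: h_def[abs_def])
qed

lemma directed_ray: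
  assumes y: "y \<in> mspace Y"
  obtains r where "r b = y" "directed {b..} r i"
proof -
  obtain c where c: "c 0 = co y" "\<And>t. 0 \<le> t \<Longrightarrow> c t \<in> tspan" "\<And>t. 0 \<le> t \<Longrightarrow> c t $ i = co y $ i - t"
    "\<And>s t. infnorm (c s - c t) \<le> \<bar>s - t\<bar>"
    using tspan_ray[OF co_tspan[OF y]] by metis
  have lip: "infnorm (c (s - b) - c (t - b)) \<le> t - s" if "s \<le> t" for s t
    using c(4)[of "s - b" "t - b"] that by simp
  show ?thesis
  proof (rule that[of "\<lambda>t. pt (c (t - b))"])
    show "pt (c (b - b)) = y"
      using c(1) pt_co[OF y] by simp
    show "directed {b..} (\<lambda>t. pt (c (t - b))) i"
      by (rule directedI) (use c(2,3) lip in \<open>auto simp: mdist_pt\<close>)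
  qed
qed

text \<open>A constraint between \<open>i\<close> and \<open>j\<close> that is tight at the origin of a ray towards \<open>j\<close> forces the
  coordinate \<open>i\<close> to grow with slope \<open>1\<close> along this ray.\<close>

lemma directed_backward_ray:
  assumes y: "y \<in> mspace Y"
  obtains r where "r a = y" "directed {..a} r i"
proof -
  obtain j where j: "j \<noteq> i" "co y $ i + co y $ j = D i j"
    using tspan_tight[OF co_tspan[OF y]] by blast
  obtain c where c: "c 0 = co y" "\<And>t. 0 \<le> t \<Longrightarrow> c t \<in> tspan" "\<And>t. 0 \<le> t \<Longrightarrow> c t $ j = co y $ j - t"
    "\<And>s t. infnorm (c s - c t) \<le> \<bar>s - t\<bar>"
    using tspan_ray[OF co_tspan[OF y]] by metis
  have ci: "c t $ i = co y $ i + t" if t: "0 \<le> t" for t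
  proof -
    have "D i j \<le> c t $ i + c t $ j"
      using feasibleD[OF tspan_feasible[OF c(2)[OF t]] j(1)[symmetric]] .
    moreover have "\<bar>c 0 $ i - c t $ i\<bar> \<le> t"
      using c(4)[of 0 t] component_le_infnorm_cart[of "c 0 - c t" i] t by simp
    ultimately show ?thesis
      using c(1) c(3)[OF t] j(2) by simp
  qed
  have lip: "infnorm (c (a - s) - c (a - t)) \<le> t - s" if "s \<le> t" for s t
    using c(4)[of "a - s" "a - t"] that by simp
  show ?thesis
  proof (rule that[of "\<lambda>t. pt (c (a - t))"])
    show "pt (c (a - a)) = y"
      using c(1) pt_co[OF y] by simp
    show "directed {..a} (\<lambda>t. pt (c (a - t))) i"
      by (rule directedI) (use c(2) ci lip in \<open>auto simp: mdist_pt\<close>)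
  qed
qed

text \<open>Open and half-open intervals have to be completed before anything can be attached at
  their ends. Coordinates along a geodesic are uniformly continuous and the tight span is closed, so
  the isometry equation passes to the closure.\<close>

lemma geodesic_closure:
  assumes c: "geodesic_on Y I c"
  obtains c' where "geodesic_on Y (closure I) c'" "\<And>t. t \<in> I \<Longrightarrow> c' t = c t"
proof -
  have cY: "c t \<in> mspace Y" if "t \<in> I" for t
    using c that by (auto simp: geodesic_on_def)
  have d: "infnorm (co (c s) - co (c t)) = \<bar>s - t\<bar>" if "s \<in> I" "t \<in> I" for s t
    using c that mdist_co[OF cY[OF that(1)] cY[OF that(2)]] by (auto simp: geodesic_on_def)
  have "(sqrt (DIM(real ^ 'n)))-lipschitz_on I (\<lambda>t. co (c t))"
  proof (rule lipschitz_onI)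
    fix s t assume "s \<in> I" "t \<in> I"
    then show "dist (co (c s)) (co (c t)) \<le> sqrt (DIM(real ^ 'n)) * dist s t"
      using norm_le_infnorm[of "co (c s) - co (c t)"] d[of s t] by (simp add: dist_norm)
  qed simp
  then have "uniformly_continuous_on I (\<lambda>t. co (c t))"
    by (rule lipschitz_on_uniformly_continuous)
  then obtain g where g: "uniformly_continuous_on (closure I) g" "\<And>t. t \<in> I \<Longrightarrow> co (c t) = g t"
    using uniformly_continuous_on_extension_on_closure by metis
  have cont: "continuous_on (closure I) g"
    by (rule uniformly_continuous_imp_continuous[OF g(1)])
  have "g ` I \<subseteq> tspan"
    using g(2) cY co_tspan by (metis image_subsetI)
  then have gt: "g t \<in> tspan" if "t \<in> closure I" for t
    using image_closure_subset[OF cont closed_tspan] that by blast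
  have "infnorm (g s - g t) - \<bar>s - t\<bar> = 0" if "s \<in> closure I" "t \<in> closure I" for s t
  proof -
    have "continuous_on (closure (I \<times> I)) (\<lambda>p. infnorm (g (fst p) - g (snd p)) - \<bar>fst p - snd p\<bar>)"
      unfolding closure_Times
      by (intro continuous_intros continuous_on_compose2[OF cont]) auto
    then have "(\<lambda>p. infnorm (g (fst p) - g (snd p)) - \<bar>fst p - snd p\<bar>) (s, t) = 0"
      by (rule continuous_constant_on_closure) (use that d g(2) in \<open>auto simp: closure_Times\<close>)
    then show ?thesis by simp
  qed
  then have "geodesic_on Y (closure I) (\<lambda>t. pt (g t))"
    using gt by (auto simp: geodesic_on_def mdist_pt)
  moreover have "pt (g t) = c t" if "t \<in> I" for t
    using g(2)[OF that] pt_co[OF cY[OF that]] by simp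
  ultimately show ?thesis
    by (rule that)
qed

text \<open>\<open>K\<close> is described only as the upward closure of \<open>I\<close>, which
  covers both cases: an interval unbounded above is left alone, any other gets a ray at its last
  point.\<close>

lemma directed_extend_forward:
  assumes c: "directed I c i" and I: "is_interval I" "closed I" "I \<noteq> {}"
  obtains c' K where "directed K c' i" "\<And>t. t \<in> I \<Longrightarrow> c' t = c t"
    "\<And>s t. s \<in> I \<Longrightarrow> s \<le> t \<Longrightarrow> t \<in> K" "\<And>t. t \<in> K \<Longrightarrow> \<exists>s\<in>I. s \<le> t" "I \<subseteq> K"
proof (cases "bdd_above I")
  case False
  have "t \<in> I" if s: "s \<in> I" "s \<le> t" for s t
  proof -
    obtain u where "u \<in> I" "t \<le> u"
      using False by (meson bdd_aboveI linear)
    then show ?thesis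
      using I(1) s mem_is_interval_1_I by blast
  qed
  then show ?thesis
    using that[of I c] c by blast
next
  case True
  define b where "b = Sup I"
  have b: "b \<in> I" "\<And>t. t \<in> I \<Longrightarrow> t \<le> b"
    unfolding b_def using closed_contains_Sup[OF I(3) True I(2)] cSup_upper[OF _ True] by auto
  have "c b \<in> mspace Y"
    using c b(1) by (auto simp: directed_def geodesic_on_def)
  then obtain r where r: "r b = c b" "directed {b..} r i"
    by (rule directed_ray)
  have "directed (I \<union> {b..}) (\<lambda>t. if t \<in> I then c t else r t) i"
    by (rule directed_concat[OF c r(2) b(1)]) (use b r(1) in auto)
  moreover have "t \<in> I \<union> {b..}" if "s \<in> I" "s \<le> t" for s t
    using mem_is_interval_1_I[OF I(1) that(1) b(1) that(2)] by (cases "t \<le> b") auto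
  moreover have "\<exists>s\<in>I. s \<le> t" if "t \<in> I \<union> {b..}" for t
    using that b(1) by auto
  ultimately show ?thesis
    using that[of "I \<union> {b..}" "\<lambda>t. if t \<in> I then c t else r t"] by simp
qed

lemma geodesically_complete: "geodesically_complete Y"
  unfolding geodesically_complete_def
proof (intro allI impI)
  fix I c assume *: "is_interval I \<and> I \<noteq> {} \<and> geodesic_on Y I c"
  obtain c1 where c1: "geodesic_on Y (closure I) c1" "\<And>t. t \<in> I \<Longrightarrow> c1 t = c t"
    using geodesic_closure * by metis
  define J where "J = closure I"
  have J: "is_interval J" "closed J" "J \<noteq> {}" "I \<subseteq> J"
    using * closure_subset by (auto simp: J_def is_interval_convex_1 intro: convex_closure)
  \<comment> \<open>The direction is fixed once for the whole geodesic; both prolongations have to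
    respect it.\<close>
  obtain i where i: "directed J c1 i"
    using geodesic_directed[OF c1(1)] unfolding J_def by blast
  obtain c2 K where c2: "directed K c2 i" "\<And>t. t \<in> J \<Longrightarrow> c2 t = c1 t"
      "\<And>s t. s \<in> J \<Longrightarrow> s \<le> t \<Longrightarrow> t \<in> K" "\<And>t. t \<in> K \<Longrightarrow> \<exists>s\<in>J. s \<le> t" "J \<subseteq> K"
    using directed_extend_forward[OF i J(1-3)] by metis
  have "\<exists>c3. geodesic_on Y UNIV c3 \<and> (\<forall>t\<in>J. c3 t = c2 t)"
  proof (cases "bdd_below J")
    case False
    have "t \<in> K" for t
    proof -
      obtain s where "s \<in> J" "s \<le> t"
        using False by (meson bdd_belowI linear)
      then show ?thesis using c2(3) by blast
    qed
    then have "K = UNIV" by blast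
    then show ?thesis
      using c2(1) by (auto simp: directed_def)
  next
    case True
    define a where "a = Inf J"
    have a: "a \<in> J" "\<And>t. t \<in> J \<Longrightarrow> a \<le> t"
      unfolding a_def using closed_contains_Inf[OF J(3) True J(2)] cInf_lower[OF _ True] by auto
    have aK: "a \<in> K" "K \<subseteq> {a..}"
      using a c2(4,5) by force+
    have "c2 a \<in> mspace Y"
      using c2(1) aK by (auto simp: directed_def geodesic_on_def)
    then obtain r where r: "r a = c2 a" "directed {..a} r i"
      by (rule directed_backward_ray)
    have "directed ({..a} \<union> K) (\<lambda>t. if t \<in> {..a} then r t else c2 t) i"
      by (rule directed_concat[OF r(2) c2(1) _ aK(1)]) (use r(1) aK in auto)
    moreover have "{..a} \<union> K = UNIV"
    proof -
      have "t \<in> {..a} \<union> K" for t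
        using c2(3)[OF a(1), of t] by (cases "t \<le> a") auto
      then show ?thesis by blast
    qed
    moreover have "(if t \<in> {..a} then r t else c2 t) = c2 t" if "t \<in> J" for t
      using a(2)[OF that] r(1) by auto
    ultimately show ?thesis
      by (intro exI[of _ "\<lambda>t. if t \<in> {..a} then r t else c2 t"]) (auto simp: directed_def)
  qed
  then show "\<exists>c'. geodesic_on Y UNIV c' \<and> (\<forall>t\<in>I. c' t = c t)"
    using c1(2) c2(2) J(4) by (metis subsetD)
qed

end

lemma open_ereal_real_ball:
  assumes "open V" "ereal g \<in> V"
  obtains e where "0 < e" "\<And>h. \<bar>h - g\<bar> < e \<Longrightarrow> ereal h \<in> V"
proof -
  have "open (ereal -` V)"
    using assms(1) by (rule open_ereal_vimage)
  then show ?thesis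
    using assms(2) that unfolding open_dist dist_real_def by (metis vimageE vimageI)
qed

lemma openin_cone_topology_ball:
  assumes a: "a \<in> mspace X"
  shows "openin (cone_topology X) (Inl ` mball_of X a d)"
proof (rule openin_cone_topology_points)
  fix y assume y: "y \<in> mball_of X a d"
  show "\<exists>\<epsilon>>0. \<forall>z\<in>mspace X. mdist X y z < \<epsilon> \<longrightarrow> z \<in> mball_of X a d"
  proof (intro exI[of _ "d - mdist X a y"] conjI ballI impI)
    fix z assume "z \<in> mspace X" "mdist X y z < d - mdist X a y"
    then show "z \<in> mball_of X a d"
      using y a mdist_triangle[of a X y z] by simp
  qed (use y in simp)
qed auto

lemma mdist_self: "x \<in> mspace X \<Longrightarrow> mdist X x x = 0"
  by simp

lemma gromov_product_lipschitz:
  assumes "x \<in> mspace X" "y \<in> mspace X" "z \<in> mspace X" "a \<in> mspace X" "b \<in> mspace X"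
  shows "\<bar>gromov_product X x y z - gromov_product X x a b\<bar> \<le> mdist X a y + mdist X b z"
proof -
  have tri: "\<bar>mdist X p x - mdist X q x\<bar> \<le> mdist X q p" if "p \<in> mspace X" "q \<in> mspace X" for p q
    using mdist_triangle[OF that assms(1)] mdist_triangle[OF that(2,1) assms(1)]
      mdist_commute[of X p q] by simp
  have "\<bar>mdist X y z - mdist X a b\<bar> \<le> mdist X a y + mdist X b z"
    using mdist_triangle[OF assms(2,4,3)] mdist_triangle[OF assms(4,5,3)]
      mdist_triangle[OF assms(4,2,5)] mdist_triangle[OF assms(2,3,5)]
      mdist_commute[of X a y] mdist_commute[of X b z] by simp
  then show ?thesis
    using tri[OF assms(2,4)] tri[OF assms(3,5)] unfolding gromov_product_def abs_le_iff
    by (simp add: field_simps)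
qed

section \<open>Boundary of the tight span and continuity of its Gromov product\<close>

context tight_span_metric
begin

lemma directed_rayD:
  assumes "directed {0..} r i"
  shows "geodesic_ray Y r" "0 \<le> t \<Longrightarrow> r t \<in> mspace Y" "0 \<le> t \<Longrightarrow> co (r t) $ i = co (r 0) $ i - t"
proof -
  have "co (r 0) $ i - co (r t) $ i = t - 0" if "0 \<le> t"
    using assms that unfolding directed_def by blast
  then show "0 \<le> t \<Longrightarrow> co (r t) $ i = co (r 0) $ i - t"
    by simp
  show "geodesic_ray Y r"
    using assms by (simp add: directed_def geodesic_ray_def)
  then show "0 \<le> t \<Longrightarrow> r t \<in> mspace Y"
    by (rule geodesic_rayD(1))
qed

text \<open>From time \<open>T\<close> on the first ray is inside the end, where the distance is the
  difference of coordinate \<open>i\<close>, and both coordinates fall at the same rate.\<close>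

lemma directed_asymptotic:
  assumes r: "directed {0..} r i" and r': "directed {0..} r' i"
  shows "(r, r') \<in> asymptotic_rays Y"
proof -
  note R = directed_rayD[OF r] and R' = directed_rayD[OF r']
  define T where "T = max 0 (co (r 0) $ i - \<alpha> i)"
  have "mdist Y (r t) (r' t) \<le> 2 * T + mdist Y (r 0) (r' 0)" if t: "0 \<le> t" for t
  proof (cases "T \<le> t")
    case True
    then have "co (r t) $ i \<le> \<alpha> i"
      using R(3)[OF t] by (auto simp: T_def)
    then have "mdist Y (r t) (r' t) = \<bar>co (r t) $ i - co (r' t) $ i\<bar>"
      using mdist_below R(2)[OF t] R'(2)[OF t] by blast
    also have "\<dots> = \<bar>co (r 0) $ i - co (r' 0) $ i\<bar>"
      using R(3)[OF t] R'(3)[OF t] by simp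
    also have "\<dots> \<le> mdist Y (r 0) (r' 0)"
      using R(2) R'(2) by (intro co_lipschitz) auto
    moreover have "0 \<le> T"
      by (simp add: T_def)
    ultimately show ?thesis
      by simp
  next
    case False
    have "mdist Y (r t) (r' t) \<le> mdist Y (r t) (r 0) + mdist Y (r 0) (r' t)"
      "mdist Y (r 0) (r' t) \<le> mdist Y (r 0) (r' 0) + mdist Y (r' 0) (r' t)"
      using R(2) R'(2) t by (auto intro: mdist_triangle)
    then show ?thesis
      using geodesic_rayD(2)[OF R(1), of t 0] geodesic_rayD(2)[OF R'(1), of 0 t] t False by simp
  qed
  then show ?thesis
    using R(1) R'(1) by (auto simp: asymptotic_rays_def)
qed

text \<open>Along \<open>r'\<close> coordinate \<open>j\<close> tends to minus infinity, so the
  constraint drives coordinate \<open>i\<close> to plus infinity, while along \<open>r\<close> it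
  falls.\<close>

lemma asymptotic_directed:
  assumes as: "(r, r') \<in> asymptotic_rays Y" and r: "directed {0..} r i" and r': "directed {0..} r' j"
  shows "i = j"
proof (rule ccontr)
  assume ne: "i \<noteq> j"
  note R = directed_rayD[OF r] and R' = directed_rayD[OF r']
  obtain C where C: "\<And>t. 0 \<le> t \<Longrightarrow> mdist Y (r t) (r' t) \<le> C"
    using as by (auto simp: asymptotic_rays_def)
  define t where "t = max 0 (C - D i j + co (r 0) $ i + co (r' 0) $ j + 1)"
  have t: "0 \<le> t" "C - D i j + co (r 0) $ i + co (r' 0) $ j + 1 \<le> t"
    by (auto simp: t_def)
  have "D i j \<le> co (r' t) $ i + co (r' t) $ j"
    by (rule co_feasible[OF R'(2)[OF t(1)] ne])
  then show False
    using co_lipschitz[OF R(2)[OF t(1)] R'(2)[OF t(1)], of i] C[OF t(1)] R(3)[OF t(1)] R'(3)[OF t(1)] t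
    by linarith
qed

definition lab :: "(real \<Rightarrow> 'b) set \<Rightarrow> 'n" where
  "lab \<xi> = (SOME i. \<exists>r\<in>\<xi>. directed {0..} r i)"

lemma lab_directed:
  assumes \<xi>: "\<xi> \<in> gromov_boundary Y" and r: "r \<in> \<xi>"
  shows "directed {0..} r (lab \<xi>)"
proof -
  obtain i where i: "directed {0..} r i"
    using boundary_ray[OF \<xi> r] geodesic_directed unfolding geodesic_ray_def by metis
  then have "\<exists>r\<in>\<xi>. directed {0..} r (lab \<xi>)"
    unfolding lab_def using r by (intro someI_ex[of "\<lambda>i. \<exists>r\<in>\<xi>. directed {0..} r i"]) blast
  then obtain r' where "r' \<in> \<xi>" "directed {0..} r' (lab \<xi>)"
    by blast
  then show ?thesis
    using asymptotic_directed[OF boundary_asymptotic[OF \<xi> r]] i by metis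
qed

lemma lab_bij: "bij_betw lab (gromov_boundary Y) UNIV"
proof (rule bij_betwI')
  fix \<xi> \<eta> assume \<xi>: "\<xi> \<in> gromov_boundary Y" and \<eta>: "\<eta> \<in> gromov_boundary Y"
  obtain r r' where r: "r \<in> \<xi>" "r' \<in> \<eta>"
    using \<xi> \<eta> boundary_obtain_ray by metis
  show "lab \<xi> = lab \<eta> \<longleftrightarrow> \<xi> = \<eta>"
    using boundary_eqI[OF \<xi> \<eta> r] directed_asymptotic lab_directed[OF \<xi> r(1)] lab_directed[OF \<eta> r(2)]
    by metis
next
  fix i :: 'n
  have "pt (end_point i (\<alpha> i)) \<in> mspace Y"
    by (simp add: end_point_tspan)
  then obtain r where r: "directed {0..} r i"
    using directed_ray by metis
  obtain \<xi> where \<xi>: "\<xi> \<in> gromov_boundary Y" "r \<in> \<xi>"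
    using ray_boundary[OF directed_rayD(1)[OF r]] by metis
  have "(r, r) \<in> asymptotic_rays Y"
    using directed_asymptotic[OF r r] .
  then have "i = lab \<xi>"
    using asymptotic_directed r lab_directed[OF \<xi>] by metis
  then show "\<exists>\<xi>\<in>gromov_boundary Y. i = lab \<xi>"
    using \<xi>(1) by blast
qed simp

definition end_nbhd :: "(real \<Rightarrow> 'b) set \<Rightarrow> real \<Rightarrow> 'b compactified set" where
  "end_nbhd \<xi> T = insert (Inr \<xi>) (Inl ` {y \<in> mspace Y. co y $ lab \<xi> < T})"

text \<open>Generalized rays close to a ray of \<open>\<xi>\<close> for a long time go deep into the
  end, and by \<open>between_below\<close> a geodesic that has done so does not leave it. Their end
  points are then in the set, so no sequence outside converges to \<open>\<xi>\<close>.\<close>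

lemma openin_end_nbhd:
  assumes \<xi>: "\<xi> \<in> gromov_boundary Y" and T: "T \<le> \<alpha> (lab \<xi>)"
  shows "openin (cone_topology Y) (end_nbhd \<xi> T)"
  unfolding openin_cone_topology
proof
  define i where "i = lab \<xi>"
  define W where "W = {y \<in> mspace Y. co y $ i < T}"
  have nbhd: "end_nbhd \<xi> T = insert (Inr \<xi>) (Inl ` W)"
    by (simp add: end_nbhd_def W_def i_def)
  show "end_nbhd \<xi> T \<subseteq> compactification Y"
    using \<xi> by (auto simp: end_nbhd_def compactification_def)
  have "openin (cone_topology Y) (Inl ` W)"
  proof (rule openin_cone_topology_points)
    fix y assume y: "y \<in> W"
    show "\<exists>\<epsilon>>0. \<forall>z\<in>mspace Y. mdist Y y z < \<epsilon> \<longrightarrow> z \<in> W"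
    proof (intro exI[of _ "T - co y $ i"] conjI ballI impI)
      fix z assume z: "z \<in> mspace Y" "mdist Y y z < T - co y $ i"
      then show "z \<in> W"
        using y co_lipschitz[of y z i] by (auto simp: W_def)
    qed (use y in \<open>simp add: W_def\<close>)
  qed (auto simp: W_def)
  then have closedW: "cone_closed Y (compactification Y - Inl ` W)"
    by (simp add: openin_cone_topology)
  show "cone_closed Y (compactification Y - end_nbhd \<xi> T)"
    unfolding cone_closed_def
  proof (intro conjI ballI allI impI)
    show "compactification Y - end_nbhd \<xi> T \<subseteq> compactification Y" by blast
    fix p zs z assume p: "p \<in> mspace Y"
      and *: "(\<forall>n. zs n \<in> compactification Y - end_nbhd \<xi> T) \<and> cone_converges Y p zs z"
    have zs: "zs n \<in> compactification Y" "zs n \<notin> end_nbhd \<xi> T" for n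
      using * by blast+
    have "zs n \<in> compactification Y - Inl ` W" for n
      using zs[of n] by (simp add: nbhd)
    then have zW: "z \<in> compactification Y - Inl ` W"
      by (rule cone_closedD[OF closedW p _ conjunct2[OF *]])
    have "z \<noteq> Inr \<xi>"
    proof
      assume z: "z = Inr \<xi>"
      obtain c where c: "\<And>n. generalized_ray Y p (c n) (zs n)"
        and sub: "\<And>\<sigma>::nat \<Rightarrow> nat. strict_mono \<sigma> \<Longrightarrow>
          \<exists>(\<tau>::nat \<Rightarrow> nat) c'. strict_mono \<tau> \<and> generalized_ray Y p c' z \<and>
            converges_on_compacts Y (\<lambda>n. c (\<sigma> (\<tau> n))) c'"
        using conjunct2[OF *] unfolding cone_converges_def by blast
      obtain \<tau> :: "nat \<Rightarrow> nat" and c' where c': "generalized_ray Y p c' z"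
        "converges_on_compacts Y (\<lambda>n. c (\<tau> n)) c'"
        using sub[of "\<lambda>n. n"] by (auto simp: strict_mono_def)
      have c'0: "c' 0 = p" and "c' \<in> \<xi>"
        using c'(1) z by (auto simp: generalized_ray_def)
      note C' = directed_rayD[OF lab_directed[OF \<xi> \<open>c' \<in> \<xi>\<close>], folded i_def]
      \<comment> \<open>At time \<open>t\<close> the limit ray is at least 2 below both
        \<open>T\<close> and its start, so a path within distance 1 of it is still below
        both.\<close>
      define t where "t = max 2 (co p $ i - T + 2)"
      have t: "2 \<le> t" "co p $ i - t \<le> T - 2"
        by (auto simp: t_def)
      have "\<exists>N. \<forall>n\<ge>N. \<forall>s\<in>{0..t}. mdist Y (c (\<tau> n) s) (c' s) < 1"
        using c'(2) t(1) unfolding converges_on_compacts_def by auto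
      then obtain n where n: "mdist Y (c (\<tau> n) t) (c' t) < 1"
        using t(1) by (metis atLeastAtMost_iff order_refl order_trans zero_le_numeral)
      define h where "h = c (\<tau> n)"
      define a where "a = h t"
      have h0: "h 0 = p"
        using c[of "\<tau> n"] by (simp add: generalized_ray_def h_def)
      have c't: "c' t \<in> mspace Y" "co (c' t) $ i = co p $ i - t"
        using C'(2,3)[of t] t(1) c'0 by auto
      have low: "co a $ i < T" "co a $ i < co p $ i" if "a \<in> mspace Y"
        using co_lipschitz[OF that c't(1), of i] n c't(2) t by (auto simp: a_def h_def)
      \<comment> \<open>A geodesic from \<open>p\<close> that has entered the end \<open>\<xi>\<close> as deep as \<open>a\<close> does not leave it.\<close>
      have stay: "co (h s) $ i \<le> co a $ i" if g: "geodesic_on Y {0..s} h" and s: "t \<le> s" for s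
      proof -
        have X: "h 0 \<in> mspace Y" "a \<in> mspace Y" "h s \<in> mspace Y"
          using g s t(1) by (auto simp: geodesic_on_def a_def)
        have d: "mdist Y (h u) (h v) = \<bar>u - v\<bar>" if "0 \<le> u" "u \<le> s" "0 \<le> v" "v \<le> s" for u v
          using g that by (auto simp: geodesic_on_def)
        have "mdist Y p a + mdist Y a (h s) = mdist Y p (h s)"
          using d[of 0 t] d[of t s] d[of 0 s] s t(1) by (simp add: a_def h0)
        then show ?thesis
          using between_below[OF _ X(2,3), of p i] X(1) h0 low[OF X(2)] T by (simp add: i_def)
      qed
      show False
      proof (cases "zs (\<tau> n)")
        case (Inl u)
        then obtain R where R: "R \<ge> 0" "geodesic_on Y {0..R} h" "\<And>t. R \<le> t \<Longrightarrow> h t = u"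
          using c[of "\<tau> n"] by (auto simp: generalized_ray_def h_def)
        have u: "u \<in> mspace Y"
          using R(1,2) R(3)[of R] by (auto simp: geodesic_on_def)
        have "co u $ i < T"
        proof (cases "R \<le> t")
          case True
          then show ?thesis
            using R(3)[of t] low(1) u by (simp add: a_def)
        next
          case False
          then have aX: "a \<in> mspace Y"
            using R(2) t(1) by (auto simp: geodesic_on_def a_def)
          show ?thesis
            using stay[OF R(2)] low(1)[OF aX] R(3)[of R] False by simp
        qed
        then show False
          using zs(2)[of "\<tau> n"] Inl u by (auto simp: nbhd W_def)
      next
        case (Inr \<eta>)
        then have \<eta>: "\<eta> \<in> gromov_boundary Y" "h \<in> \<eta>"
          using c[of "\<tau> n"] by (auto simp: generalized_ray_def h_def)
        note H = directed_rayD[OF lab_directed[OF \<eta>]]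
        have "\<eta> \<noteq> \<xi>"
          using zs(2)[of "\<tau> n"] Inr by (auto simp: nbhd)
        then have ne: "i \<noteq> lab \<eta>"
          using lab_bij \<xi> \<eta>(1) by (auto simp: bij_betw_def inj_on_def i_def)
        \<comment> \<open>By time \<open>s\<close> the fall of coordinate \<open>lab \<eta>\<close>
          forces coordinate \<open>i\<close> up to at least \<open>T\<close>.\<close>
        define s where "s = max t (T + co p $ lab \<eta> - D i (lab \<eta>))"
        have s: "t \<le> s" "0 \<le> s" "T + co p $ lab \<eta> - D i (lab \<eta>) \<le> s"
          using t by (auto simp: s_def)
        have "geodesic_on Y {0..s} h"
          using H(1) unfolding geodesic_ray_def by (rule geodesic_on_subset) auto
        then have "co (h s) $ i < T"
          using stay[of s] s(1) low(1) H(2)[of t] t(1) by (simp add: a_def)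
        then show False
          using co_feasible[OF H(2)[OF s(2)] ne] H(3)[OF s(2)] s(3) h0 by simp
      qed
    qed
    then show "z \<in> compactification Y - end_nbhd \<xi> T"
      using zW by (simp add: nbhd)
  qed
qed

text \<open>For \<open>z\<close> deep in an end, \<open>mdist Y z x - mdist Y y z\<close> is the
  difference of the end's coordinate at \<open>x\<close> and \<open>y\<close>. This gives the values
  with one boundary point; letting \<open>y\<close> run into another end, where its two coordinates
  sum to \<open>D\<close>, gives those with two.\<close>

fun product_ext :: "'b \<Rightarrow> 'b compactified \<times> 'b compactified \<Rightarrow> ereal" where
  "product_ext x (Inl y, Inl z) = ereal (gromov_product Y x y z)"
| "product_ext x (Inl y, Inr \<xi>) = ereal ((mdist Y y x + co x $ lab \<xi> - co y $ lab \<xi>) / 2)"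
| "product_ext x (Inr \<xi>, Inl y) = ereal ((mdist Y y x + co x $ lab \<xi> - co y $ lab \<xi>) / 2)"
| "product_ext x (Inr \<xi>, Inr \<eta>) = (if \<xi> = \<eta> then \<infinity>
     else ereal ((co x $ lab \<xi> + co x $ lab \<eta> - D (lab \<xi>) (lab \<eta>)) / 2))"

lemma product_ext_commute: "product_ext x (z, w) = product_ext x (w, z)"
  by (cases z; cases w) (auto simp: gromov_product_commute sym add.commute)

lemma product_ext_nonneg:
  assumes x: "x \<in> mspace Y" and z: "z \<in> compactification Y" and w: "w \<in> compactification Y"
  shows "0 \<le> product_ext x (z, w)"
proof -
  have *: "0 \<le> mdist Y y x + co x $ i - co y $ i" if "y \<in> mspace Y" for y i
    using co_lipschitz[OF that x, of i] by linarith
  show ?thesis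
  proof (cases z; cases w)
    fix \<xi> \<eta> assume "z = Inr \<xi>" "w = Inr \<eta>"
    then show ?thesis
      using z w lab_bij co_feasible[OF x, of "lab \<xi>" "lab \<eta>"]
      by (auto simp: compactification_def bij_betw_def inj_on_def)
  qed (use x z w * gromov_product_nonneg[OF x] in \<open>auto simp: compactification_def\<close>)
qed

text \<open>The coordinate of \<open>z\<close> cancels, so deep in an end the product is constant in
  \<open>z\<close> and already equals its limit.\<close>

lemma gromov_product_end:
  assumes x: "x \<in> mspace Y" and y: "y \<in> mspace Y" and z: "z \<in> mspace Y"
    and le: "co z $ i \<le> \<alpha> i" "co z $ i \<le> co x $ i" "co z $ i \<le> co y $ i"
  shows "gromov_product Y x y z = (mdist Y y x + co x $ i - co y $ i) / 2"
  using mdist_below[OF z x, of i] mdist_below[OF y z, of i] le by (simp add: gromov_product_def)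

lemma product_ext_nbhd_point_point:
  assumes x: "x \<in> mspace Y" and a: "a \<in> mspace Y" and b: "b \<in> mspace Y"
    and V: "open V" "product_ext x (Inl a, Inl b) \<in> V"
  obtains A B where "openin (cone_topology Y) A" "openin (cone_topology Y) B" "Inl a \<in> A" "Inl b \<in> B"
    "\<And>z w. z \<in> A \<Longrightarrow> w \<in> B \<Longrightarrow> product_ext x (z, w) \<in> V"
proof -
  obtain e where e: "0 < e" "\<And>h. \<bar>h - gromov_product Y x a b\<bar> < e \<Longrightarrow> ereal h \<in> V"
    using open_ereal_real_ball[OF V(1), of "gromov_product Y x a b"] V(2) by auto
  let ?B = "\<lambda>a. Inl ` mball_of Y a (e / 2) :: 'b compactified set"
  show ?thesis
  proof (rule that[of "?B a" "?B b", OF openin_cone_topology_ball[OF a] openin_cone_topology_ball[OF b]])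
    show "Inl a \<in> ?B a" "Inl b \<in> ?B b"
      using a b e(1) by (auto simp: mdist_self intro!: imageI)
    fix z w assume "z \<in> ?B a" "w \<in> ?B b"
    then obtain y u where yu: "z = Inl y" "w = Inl u" "y \<in> mspace Y" "u \<in> mspace Y"
        "mdist Y a y < e / 2" "mdist Y b u < e / 2"
      by auto
    then have "\<bar>gromov_product Y x y u - gromov_product Y x a b\<bar> < e"
      using gromov_product_lipschitz[OF x yu(3,4) a b] by simp
    then show "product_ext x (z, w) \<in> V"
      using e(2) yu by simp
  qed
qed

lemma product_ext_nbhd_point_end:
  assumes x: "x \<in> mspace Y" and a: "a \<in> mspace Y" and \<xi>: "\<xi> \<in> gromov_boundary Y"
    and V: "open V" "product_ext x (Inl a, Inr \<xi>) \<in> V"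
  obtains A B where "openin (cone_topology Y) A" "openin (cone_topology Y) B" "Inl a \<in> A" "Inr \<xi> \<in> B"
    "\<And>z w. z \<in> A \<Longrightarrow> w \<in> B \<Longrightarrow> product_ext x (z, w) \<in> V"
proof -
  define i where "i = lab \<xi>"
  define g where "g y = (mdist Y y x + co x $ i - co y $ i) / 2" for y
  obtain e where e: "0 < e" "\<And>h. \<bar>h - g a\<bar> < e \<Longrightarrow> ereal h \<in> V"
    using open_ereal_real_ball[OF V(1), of "g a"] V(2) by (auto simp: g_def i_def)
  define d where "d = min e 1"
  \<comment> \<open>The bounds put \<open>u\<close> inside the end and below \<open>x\<close>; the
    extra 1 keeps it below every \<open>y\<close> in the ball, whose radius is at most 1.\<close>
  define T where "T = min (\<alpha> i) (min (co x $ i) (co a $ i - 1))"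
  define W where "W = mball_of Y a d"
  have d: "0 < d" "d \<le> e" "d \<le> 1"
    using e(1) by (auto simp: d_def)
  show ?thesis
  proof (rule that[of "Inl ` W" "end_nbhd \<xi> T"])
    show "openin (cone_topology Y) (Inl ` W)"
      unfolding W_def by (rule openin_cone_topology_ball[OF a])
    show "openin (cone_topology Y) (end_nbhd \<xi> T)"
      using \<xi> by (rule openin_end_nbhd) (simp add: T_def i_def)
    show "Inl a \<in> Inl ` W"
      using a d(1) by (auto simp: W_def mdist_self intro!: imageI)
    show "Inr \<xi> \<in> end_nbhd \<xi> T"
      by (simp add: end_nbhd_def)
    fix z w :: "'b compactified" assume z: "z \<in> Inl ` W" and w: "w \<in> end_nbhd \<xi> T"
    then obtain y where y: "z = Inl y" "y \<in> mspace Y" "mdist Y a y < d"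
      by (auto simp: W_def)
    have "\<bar>mdist Y y x - mdist Y a x\<bar> \<le> mdist Y a y"
      using mdist_triangle[OF y(2) a x] mdist_triangle[OF a y(2) x] mdist_commute[of Y a y] by simp
    then have "\<bar>g y - g a\<bar> \<le> mdist Y a y"
      using co_lipschitz[OF a y(2), of i] unfolding g_def abs_le_iff by (simp add: field_simps)
    then have gV: "ereal (g y) \<in> V"
      using e(2) y(3) d(2) by simp
    show "product_ext x (z, w) \<in> V"
    proof (cases w)
      case (Inl u)
      then have u: "u \<in> mspace Y" "co u $ i < T"
        using w by (auto simp: end_nbhd_def i_def)
      have "co a $ i - 1 \<le> co y $ i"
        using co_lipschitz[OF a y(2), of i] y(3) d(3) by linarith
      then have "gromov_product Y x y u = g y"
        unfolding g_def using u(2) by (intro gromov_product_end[OF x y(2) u(1)]) (auto simp: T_def)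
      then show ?thesis
        using gV y(1) Inl by simp
    next
      case (Inr \<eta>)
      then have "\<eta> = \<xi>"
        using w by (auto simp: end_nbhd_def)
      then show ?thesis
        using gV y(1) Inr by (simp add: g_def i_def)
    qed
  qed
qed

lemma product_ext_nbhd_end_end:
  assumes x: "x \<in> mspace Y" and \<xi>: "\<xi> \<in> gromov_boundary Y" and \<eta>: "\<eta> \<in> gromov_boundary Y"
    and V: "open V" "product_ext x (Inr \<xi>, Inr \<eta>) \<in> V"
  obtains A B where "openin (cone_topology Y) A" "openin (cone_topology Y) B" "Inr \<xi> \<in> A" "Inr \<eta> \<in> B"
    "\<And>z w. z \<in> A \<Longrightarrow> w \<in> B \<Longrightarrow> product_ext x (z, w) \<in> V"
proof (cases "\<xi> = \<eta>")
  case True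
  define i where "i = lab \<xi>"
  obtain M where "{ereal M<..} \<subseteq> V"
    using V True open_PInfty[of V] by auto
  then have M: "ereal h \<in> V" if "M < h" for h
    using that by auto
  \<comment> \<open>Two points below \<open>T\<close> have product \<open>co x $ i\<close> minus the
    larger of their coordinates, which exceeds \<open>M\<close>.\<close>
  define T where "T = min (\<alpha> i) (min (co x $ i) (co x $ i - M))"
  have op: "openin (cone_topology Y) (end_nbhd \<xi> T)"
    using \<xi> by (rule openin_end_nbhd) (simp add: T_def i_def)
  have prod: "M < gromov_product Y x y u"
    if y: "y \<in> mspace Y" "co y $ i < T" and u: "u \<in> mspace Y" "co u $ i < T" for y u
    using mdist_below[OF y(1) x, of i] mdist_below[OF u(1) x, of i] mdist_below[OF y(1) u(1), of i] y(2) u(2)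
    by (auto simp: T_def gromov_product_def)
  have prod': "M < (mdist Y y x + co x $ i - co y $ i) / 2"
    if y: "y \<in> mspace Y" "co y $ i < T" for y
    using mdist_below[OF y(1) x, of i] y(2) by (auto simp: T_def)
  have "product_ext x (z, w) \<in> V" if z: "z \<in> end_nbhd \<xi> T" and w: "w \<in> end_nbhd \<xi> T" for z w
  proof (cases z; cases w)
    fix y u assume "z = Inl y" "w = Inl u"
    then show ?thesis
      using z w M[OF prod[of y u]] by (auto simp: end_nbhd_def i_def)
  next
    fix y \<zeta> assume "z = Inl y" "w = Inr \<zeta>"
    then show ?thesis
      using z w M[OF prod'[of y]] by (auto simp: end_nbhd_def i_def)
  next
    fix u \<zeta> assume "z = Inr \<zeta>" "w = Inl u"
    then show ?thesis
      using z w M[OF prod'[of u]] by (auto simp: end_nbhd_def i_def)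
  next
    fix \<zeta> \<zeta>' assume "z = Inr \<zeta>" "w = Inr \<zeta>'"
    then have "\<zeta> = \<xi>" "\<zeta>' = \<xi>"
      using z w by (auto simp: end_nbhd_def)
    then show ?thesis
      using V(2) True \<open>z = Inr \<zeta>\<close> \<open>w = Inr \<zeta>'\<close> by simp
  qed
  moreover have "Inr \<xi> \<in> end_nbhd \<xi> T"
    by (simp add: end_nbhd_def)
  ultimately show ?thesis
    using that[OF op op] True by simp
next
  case False
  define i where "i = lab \<xi>"
  define j where "j = lab \<eta>"
  have ne: "i \<noteq> j"
    using False \<xi> \<eta> lab_bij by (auto simp: bij_betw_def inj_on_def i_def j_def)
  define g where "g = (co x $ i + co x $ j - D i j) / 2"
  have gV: "ereal g \<in> V"
    using V(2) False by (simp add: g_def i_def j_def)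
  \<comment> \<open>With \<open>co y $ i\<close> below half of \<open>D i j\<close>, coordinate
    \<open>j\<close> of \<open>y\<close> is above that half, hence above coordinate \<open>j\<close>
    of any \<open>u\<close> below \<open>T\<close>; this is the order that
    \<open>gromov_product_end\<close> asks for.\<close>
  define S where "S = min (\<alpha> i) (min (co x $ i) (D i j / 2))"
  define T where "T = min (\<alpha> j) (min (co x $ j) (D i j / 2))"
  have opS: "openin (cone_topology Y) (end_nbhd \<xi> S)"
    using \<xi> by (rule openin_end_nbhd) (simp add: S_def i_def)
  have opT: "openin (cone_topology Y) (end_nbhd \<eta> T)"
    using \<eta> by (rule openin_end_nbhd) (simp add: T_def j_def)
  have prod1: "(mdist Y y x + co x $ j - co y $ j) / 2 = g" if y: "y \<in> mspace Y" "co y $ i < S" for y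
    using mdist_below[OF y(1) x, of i] co_below[OF y(1), of i j] ne y(2) by (auto simp: S_def g_def)
  have prod2: "(mdist Y y x + co x $ i - co y $ i) / 2 = g" if y: "y \<in> mspace Y" "co y $ j < T" for y
    using mdist_below[OF y(1) x, of j] co_below[OF y(1), of j i] ne y(2) sym[of i j]
    by (auto simp: T_def g_def)
  have prod: "gromov_product Y x y u = g"
    if y: "y \<in> mspace Y" "co y $ i < S" and u: "u \<in> mspace Y" "co u $ j < T" for y u
  proof -
    have "co y $ j = D i j - co y $ i"
      using co_below[OF y(1), of i j] ne y(2) by (auto simp: S_def)
    then have "co u $ j \<le> co y $ j"
      using y(2) u(2) by (simp add: S_def T_def)
    then have "gromov_product Y x y u = (mdist Y y x + co x $ j - co y $ j) / 2"
      using u(2) by (intro gromov_product_end[OF x y(1) u(1)]) (auto simp: T_def)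
    then show ?thesis
      using prod1[OF y] by simp
  qed
  have "product_ext x (z, w) \<in> V" if z: "z \<in> end_nbhd \<xi> S" and w: "w \<in> end_nbhd \<eta> T" for z w
  proof (cases z; cases w)
    fix y u assume "z = Inl y" "w = Inl u"
    then show ?thesis
      using z w prod[of y u] gV by (auto simp: end_nbhd_def i_def j_def)
  next
    fix y \<zeta> assume "z = Inl y" "w = Inr \<zeta>"
    then show ?thesis
      using z w prod1[of y] gV by (auto simp: end_nbhd_def i_def j_def)
  next
    fix u \<zeta> assume "z = Inr \<zeta>" "w = Inl u"
    then show ?thesis
      using z w prod2[of u] gV by (auto simp: end_nbhd_def i_def j_def)
  next
    fix \<zeta> \<zeta>' assume "z = Inr \<zeta>" "w = Inr \<zeta>'"
    then have "\<zeta> = \<xi>" "\<zeta>' = \<eta>"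
      using z w by (auto simp: end_nbhd_def)
    then show ?thesis
      using V(2) \<open>z = Inr \<zeta>\<close> \<open>w = Inr \<zeta>'\<close> by simp
  qed
  then show ?thesis
    using that[OF opS opT] by (simp add: end_nbhd_def)
qed

lemma product_ext_nbhd:
  assumes x: "x \<in> mspace Y" and p: "p \<in> compactification Y" and q: "q \<in> compactification Y"
    and V: "open V" "product_ext x (p, q) \<in> V"
  shows "\<exists>A B. openin (cone_topology Y) A \<and> openin (cone_topology Y) B \<and> p \<in> A \<and> q \<in> B \<and>
    (\<forall>z\<in>A. \<forall>w\<in>B. product_ext x (z, w) \<in> V)"
proof (cases p; cases q)
  fix a b assume pq: "p = Inl a" "q = Inl b"
  then have "a \<in> mspace Y" "b \<in> mspace Y" "product_ext x (Inl a, Inl b) \<in> V"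
    using p q V(2) by (auto simp: compactification_def)
  then show ?thesis
    using product_ext_nbhd_point_point[OF x _ _ V(1)] pq by metis
next
  fix a \<xi> assume pq: "p = Inl a" "q = Inr \<xi>"
  then have "a \<in> mspace Y" "\<xi> \<in> gromov_boundary Y" "product_ext x (Inl a, Inr \<xi>) \<in> V"
    using p q V(2) by (auto simp: compactification_def)
  then show ?thesis
    using product_ext_nbhd_point_end[OF x _ _ V(1)] pq by metis
next
  fix a \<xi> assume pq: "p = Inr \<xi>" "q = Inl a"
  then have "a \<in> mspace Y" "\<xi> \<in> gromov_boundary Y" "product_ext x (Inl a, Inr \<xi>) \<in> V"
    using p q V(2) by (auto simp: compactification_def)
  then obtain A B where "openin (cone_topology Y) A" "openin (cone_topology Y) B" "Inl a \<in> A" "Inr \<xi> \<in> B"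
    "\<And>z w. z \<in> A \<Longrightarrow> w \<in> B \<Longrightarrow> product_ext x (z, w) \<in> V"
    using product_ext_nbhd_point_end[OF x _ _ V(1)] by metis
  then show ?thesis
    using pq product_ext_commute by metis
next
  fix \<xi> \<eta> assume pq: "p = Inr \<xi>" "q = Inr \<eta>"
  then have "\<xi> \<in> gromov_boundary Y" "\<eta> \<in> gromov_boundary Y" "product_ext x (Inr \<xi>, Inr \<eta>) \<in> V"
    using p q V(2) by (auto simp: compactification_def)
  then show ?thesis
    using product_ext_nbhd_end_end[OF x _ _ V(1)] pq by metis
qed

lemma extends_product_ext:
  assumes x: "x \<in> mspace Y" shows "extends_gromov_product Y x (product_ext x)"
proof -
  let ?P = "prod_topology (cone_topology Y) (cone_topology Y)"
  have "topcontinuous_at ?P (top_of_set {0..}) (product_ext x) pq" if pq: "pq \<in> topspace ?P" for pq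
    unfolding topcontinuous_at_def
  proof (intro conjI allI impI)
    obtain p q where eq: "pq = (p, q)" by (cases pq)
    have p: "p \<in> compactification Y" "q \<in> compactification Y"
      using pq eq by auto
    show "pq \<in> topspace ?P" by (rule pq)
    show "product_ext x \<in> topspace ?P \<rightarrow> topspace (top_of_set {0..})"
      using product_ext_nonneg[OF x] by auto
    fix V assume "openin (top_of_set {0..}) V \<and> product_ext x pq \<in> V"
    then obtain V' where V': "open V'" "V = {0..} \<inter> V'" "product_ext x (p, q) \<in> V'"
      using eq unfolding openin_open by blast
    obtain A B where AB: "openin (cone_topology Y) A" "openin (cone_topology Y) B" "p \<in> A" "q \<in> B"
      "\<And>z w. z \<in> A \<Longrightarrow> w \<in> B \<Longrightarrow> product_ext x (z, w) \<in> V'"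
      using product_ext_nbhd[OF x p V'(1,3)] by blast
    have sub: "A \<subseteq> compactification Y" "B \<subseteq> compactification Y"
      using AB(1,2) openin_subset by fastforce+
    have "openin ?P (A \<times> B)"
      using AB(1,2) by (simp add: openin_prod_Times_iff)
    moreover have "product_ext x zw \<in> V" if "zw \<in> A \<times> B" for zw
      using that AB(5) product_ext_nonneg[OF x] sub by (auto simp: V'(2) subset_iff)
    ultimately show "\<exists>U. openin ?P U \<and> pq \<in> U \<and> (\<forall>zw\<in>U. product_ext x zw \<in> V)"
      using AB(3,4) eq by (intro exI[of _ "A \<times> B"]) auto
  qed
  then show ?thesis
    unfolding extends_gromov_product_def continuous_map_eq_topcontinuous_at by simp
qed

lemma good_gromov_hyperbolic: "good_gromov_hyperbolic Y"
  unfolding good_gromov_hyperbolic_def boundary_continuous_def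
  using gromov_hyperbolic proper_space geodesic_space geodesically_complete extends_product_ext by blast

lemma boundary_product:
  assumes "x \<in> mspace Y" "\<xi> \<in> gromov_boundary Y" "\<eta> \<in> gromov_boundary Y" "\<xi> \<noteq> \<eta>"
  shows "boundary_gromov_product Y x \<xi> \<eta> =
    ereal ((co x $ lab \<xi> + co x $ lab \<eta> - D (lab \<xi>) (lab \<eta>)) / 2)"
  using boundary_gromov_product_eq[OF extends_product_ext[OF assms(1)] assms(2,3)] assms(4) by simp

text \<open>Once the ray is in the end and below both points, the distances are differences of
  coordinate \<open>i\<close> and the sequence is constant.\<close>

lemma directed_ray_busemann:
  assumes r: "directed {0..} r i" and y: "y \<in> mspace Y" "z \<in> mspace Y"
  shows "(\<lambda>n. mdist Y y (r (real n)) - mdist Y z (r (real n))) \<longlonglongrightarrow> co y $ i - co z $ i"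
proof (rule tendsto_eventually)
  note R = directed_rayD[OF r]
  define T where "T = min (\<alpha> i) (min (co y $ i) (co z $ i))"
  have "\<forall>\<^sub>F n in sequentially. co (r 0) $ i - T \<le> real n"
    using eventually_ge_at_top[of "nat \<lceil>co (r 0) $ i - T\<rceil>"] by eventually_elim linarith
  then show "\<forall>\<^sub>F n in sequentially. mdist Y y (r (real n)) - mdist Y z (r (real n)) = co y $ i - co z $ i"
  proof eventually_elim
    case (elim n)
    then have "co (r (real n)) $ i \<le> T"
      using R(3)[of "real n"] by simp
    then show ?case
      using mdist_below[OF y(1) R(2)[of "real n"], of i] mdist_below[OF y(2) R(2)[of "real n"], of i]
      by (auto simp: T_def)
  qed
qed

end

section \<open>Maximal spaces\<close>

text \<open>\<open>a\<close>, \<open>b\<close>, \<open>c\<close>, \<open>d\<close> stand for the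
  factors of the four boundary points, which depend on the base point, and \<open>w1\<close> to
  \<open>w4\<close> for those of the pairs. Only the latter survive, and in both spaces they are
  given by \<open>D\<close> alone.\<close>

lemma cross_ratio_cancel:
  fixes a b c d :: real
  assumes "a \<noteq> 0" "b \<noteq> 0" "c \<noteq> 0" "d \<noteq> 0"
  shows "((a * c * w1) * (b * d * w2)) / ((a * d * w3) * (b * c * w4)) = (w1 * w2) / (w3 * w4)"
proof -
  have "((a * c * w1) * (b * d * w2)) / ((a * d * w3) * (b * c * w4)) =
      ((a * b * c * d) * (w1 * w2)) / ((a * b * c * d) * (w3 * w4))"
    by (simp add: ac_simps)
  then show ?thesis
    using assms by simp
qed

lemma homeomorphic_map_discrete:
  assumes "bij_betw f A B"
  shows "homeomorphic_map (discrete_topology A) (discrete_topology B) f"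
  using assms by (intro bijective_open_imp_homeomorphic_map) (auto simp: bij_betw_def open_map_def)

context tight_span
begin

text \<open>A copy of the tight span whose points lie in the type that maximality quantifies over.\<close>

lemma tight_span_copy:
  obtains Y :: "(nat \<Rightarrow> real) metric" and co where "tight_span_metric D Y co"
proof -
  obtain h where h: "bij_betw h {0..<CARD('n)} (UNIV :: 'n set)"
    using ex_bij_betw_nat_finite[of "UNIV :: 'n set"] by auto
  define enc :: "real ^ 'n \<Rightarrow> nat \<Rightarrow> real" where "enc v k = (if k < CARD('n) then v $ h k else 0)" for v k
  have "inj enc"
  proof (rule injI)
    fix v w assume eq: "enc v = enc w"
    have "v $ i = w $ i" for i
    proof -
      obtain k where "k < CARD('n)" "h k = i"
        using h by (metis UNIV_I atLeastLessThan_iff bij_betw_iff_bijections)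
      then show ?thesis
        using fun_cong[OF eq, of k] by (simp add: enc_def)
    qed
    then show "v = w"
      by (simp add: vec_eq_iff)
  qed
  define co where "co = inv enc"
  have co: "co (enc v) = v" for v
    using \<open>inj enc\<close> by (simp add: co_def)
  define d where "d a b = infnorm (co a - co b)" for a b
  interpret M: Metric_space "enc ` tspan" d
  proof
    show "0 \<le> d a b" "d a b = d b a" for a b
      by (simp_all add: d_def infnorm_pos_le infnorm_sub)
    show "d a b = 0 \<longleftrightarrow> a = b" if "a \<in> enc ` tspan" "b \<in> enc ` tspan" for a b
      using that by (auto simp: d_def co infnorm_eq_0)
    show "d a c \<le> d a b + d b c" for a b c
      unfolding d_def by (rule infnorm_diff_triangle)
  qed
  have "tight_span_metric D (metric (enc ` tspan, d)) co"
  proof unfold_locales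
    show "co ` mspace (metric (enc ` tspan, d)) = tspan"
      by (simp add: image_image co)
    show "mdist (metric (enc ` tspan, d)) y z = infnorm (co y - co z)" for y z
      by (simp add: d_def)
  qed
  then show ?thesis
    by (rule that)
qed

end

theorem theorem1p1:
  fixes X :: "'a metric"
  assumes "maximal_gromov_hyperbolic X"
    and "finite (gromov_boundary X)"
    and "card (gromov_boundary X) = CARD('n::finite)"
    and "CARD('n) \<ge> 4"
  shows "\<exists>\<P> :: (real ^ 'n) set set.
    polyhedral_complex \<P> \<and>
    finite \<P> \<and>
    (\<forall>P\<in>\<P>. real_of_int (aff_dim P) \<le> real CARD('n) / 2) \<and>
    isometric_to_sup_norm_set X (\<Union>\<P>) \<and>
    attached_half_lines CARD('n) \<P>"
proof -
  have good: "good_gromov_hyperbolic X"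
    using assms(1) by (simp add: maximal_gromov_hyperbolic_def)
  obtain e where e: "bij_betw e (UNIV :: 'n set) (gromov_boundary X)"
    using finite_same_card_bij[of "UNIV :: 'n set" "gromov_boundary X"] assms(2,3) by auto
  have eB: "e i \<in> gromov_boundary X" for i
    using e by (auto simp: bij_betw_def)
  have e_eq: "e i = e j \<longleftrightarrow> i = j" for i j
    using e by (auto simp: bij_betw_def inj_on_def)
  obtain r0 where "geodesic_ray X r0"
    using boundary_obtain_ray eB by blast
  then have "r0 0 \<in> mspace X"
    using geodesic_rayD(1) by blast
  then obtain x where x: "x \<in> mspace X" by blast
  obtain b P where
    b: "\<And>\<xi> r y. \<xi> \<in> gromov_boundary X \<Longrightarrow> r \<in> \<xi> \<Longrightarrow> y \<in> mspace X \<Longrightarrow>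
       (\<lambda>n. mdist X y (r (real n)) - mdist X x (r (real n))) \<longlonglongrightarrow> b \<xi> y"
    and prod: "\<And>\<xi> \<eta> y. \<xi> \<in> gromov_boundary X \<Longrightarrow> \<eta> \<in> gromov_boundary X \<Longrightarrow> \<xi> \<noteq> \<eta> \<Longrightarrow> y \<in> mspace X \<Longrightarrow>
       boundary_gromov_product X y \<xi> \<eta> = ereal ((b \<xi> y + b \<eta> y) / 2 + P \<xi> \<eta>)"
    and nonneg: "\<And>\<xi> \<eta> y. \<xi> \<in> gromov_boundary X \<Longrightarrow> \<eta> \<in> gromov_boundary X \<Longrightarrow> \<xi> \<noteq> \<eta> \<Longrightarrow> y \<in> mspace X \<Longrightarrow>
       0 \<le> (b \<xi> y + b \<eta> y) / 2 + P \<xi> \<eta>"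
    and tight: "\<And>\<xi> y. \<xi> \<in> gromov_boundary X \<Longrightarrow> y \<in> mspace X \<Longrightarrow>
       \<exists>\<eta>\<in>gromov_boundary X. \<eta> \<noteq> \<xi> \<and> (b \<xi> y + b \<eta> y) / 2 + P \<xi> \<eta> = 0"
    and lip: "\<And>\<xi> y y'. \<xi> \<in> gromov_boundary X \<Longrightarrow> y \<in> mspace X \<Longrightarrow> y' \<in> mspace X \<Longrightarrow>
       \<bar>b \<xi> y - b \<xi> y'\<bar> \<le> mdist X y y'"
    and dir: "\<And>y y'. y \<in> mspace X \<Longrightarrow> y' \<in> mspace X \<Longrightarrow> \<exists>\<xi>\<in>gromov_boundary X. b \<xi> y - b \<xi> y' = mdist X y y'"
    and P_sym: "\<And>\<xi> \<eta>. P \<xi> \<eta> = P \<eta> \<xi>"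
  proof (rule boundary_coordinates[OF good assms(2) x], goal_cases)
    case (1 b P)
    show ?case
      by (rule 1(1)[of b P]; fact 1)
  qed
  \<comment> \<open>The factor -2 turns nonnegativity of the product,
    \<open>0 \<le> (b \<xi> y + b \<eta> y) / 2 + P \<xi> \<eta>\<close>, into the constraint of
    \<open>feasible\<close>.\<close>
  define D where "D i j = - 2 * P (e i) (e j)" for i j
  interpret tight_span D
    by unfold_locales (use P_sym assms(4) in \<open>auto simp: D_def\<close>)
  define \<phi> :: "'a \<Rightarrow> real ^ 'n" where "\<phi> y = (\<chi> i. b (e i) y)" for y
  have \<phi>_tspan: "\<phi> y \<in> tspan" if y: "y \<in> mspace X" for y
  proof -
    have "D i j \<le> \<phi> y $ i + \<phi> y $ j" if "i \<noteq> j" for i j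
      using nonneg[OF eB eB _ y, of i j] that e_eq by (simp add: D_def \<phi>_def field_simps)
    moreover have "\<exists>j. j \<noteq> i \<and> \<phi> y $ i + \<phi> y $ j = D i j" for i
    proof -
      obtain \<eta> where \<eta>: "\<eta> \<in> gromov_boundary X" "\<eta> \<noteq> e i" "(b (e i) y + b \<eta> y) / 2 + P (e i) \<eta> = 0"
        using tight[OF eB y] by blast
      obtain j where "\<eta> = e j"
        using \<eta>(1) e by (auto simp: bij_betw_def)
      then show ?thesis
        using \<eta>(2,3) by (intro exI[of _ j]) (auto simp: D_def \<phi>_def field_simps)
    qed
    ultimately show ?thesis
      by (simp add: tspan_def feasible_def)
  qed
  have \<phi>_dist: "infnorm (\<phi> y - \<phi> z) = mdist X y z" if yz: "y \<in> mspace X" "z \<in> mspace X" for y z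
  proof (rule antisym)
    show "infnorm (\<phi> y - \<phi> z) \<le> mdist X y z"
      using lip[OF eB yz] by (simp add: infnorm_le_iff_cart \<phi>_def)
    obtain \<xi> where \<xi>: "\<xi> \<in> gromov_boundary X" "b \<xi> y - b \<xi> z = mdist X y z"
      using dir[OF yz] by blast
    obtain i where "\<xi> = e i"
      using \<xi>(1) e by (auto simp: bij_betw_def)
    then show "mdist X y z \<le> infnorm (\<phi> y - \<phi> z)"
      using \<xi>(2) component_le_infnorm_cart[of "\<phi> y - \<phi> z" i] by (simp add: \<phi>_def)
  qed
  obtain Y :: "(nat \<Rightarrow> real) metric" and co where Y: "tight_span_metric D Y co"
    by (rule tight_span_copy)
  interpret Y: tight_span_metric D Y co
    by (rule Y)
  define f where "f \<xi> = e (Y.lab \<xi>)" for \<xi>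
  have f_bij: "bij_betw f (gromov_boundary Y) (gromov_boundary X)"
    using bij_betw_trans[OF Y.lab_bij e] by (simp add: f_def[abs_def] o_def)
  have finY: "finite (gromov_boundary Y)"
    using bij_betw_finite[OF f_bij] assms(2) by simp
  have rhoY: "visual_rho Y y \<xi> \<eta> =
      exp (- co y $ Y.lab \<xi> / 2) * exp (- co y $ Y.lab \<eta> / 2) * exp (D (Y.lab \<xi>) (Y.lab \<eta>) / 2)"
    if "y \<in> mspace Y" "\<xi> \<in> gromov_boundary Y" "\<eta> \<in> gromov_boundary Y" "\<xi> \<noteq> \<eta>" for y \<xi> \<eta>
    using Y.boundary_product[OF that]
    by (simp add: visual_rho_def exp_add[symmetric] add_divide_distrib diff_divide_distrib algebra_simps)
  have rhoX: "visual_rho X z (f \<xi>) (f \<eta>) =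
      exp (- b (f \<xi>) z / 2) * exp (- b (f \<eta>) z / 2) * exp (D (Y.lab \<xi>) (Y.lab \<eta>) / 2)"
    if z: "z \<in> mspace X" and \<xi>: "\<xi> \<in> gromov_boundary Y" and \<eta>: "\<eta> \<in> gromov_boundary Y" and ne: "\<xi> \<noteq> \<eta>"
    for z \<xi> \<eta>
  proof -
    have "f \<xi> \<noteq> f \<eta>" "f \<xi> \<in> gromov_boundary X" "f \<eta> \<in> gromov_boundary X"
      using f_bij \<xi> \<eta> ne by (auto simp: bij_betw_def inj_on_def)
    then show ?thesis
      using prod[of "f \<xi>" "f \<eta>" z] z
      by (simp add: visual_rho_def exp_add[symmetric] D_def f_def add_divide_distrib algebra_simps)
  qed
  have "moebius_homeomorphism Y X f"
    unfolding moebius_homeomorphism_def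
  proof (intro conjI ballI impI)
    show "homeomorphic_map (boundary_topology Y) (boundary_topology X) f"
      unfolding boundary_topology_discrete[OF good assms(2)]
        boundary_topology_discrete[OF Y.good_gromov_hyperbolic finY]
      by (rule homeomorphic_map_discrete[OF f_bij])
    fix y z \<xi> \<xi>' \<eta> \<eta>'
    assume "y \<in> mspace Y" "z \<in> mspace X" "\<xi> \<in> gromov_boundary Y" "\<xi>' \<in> gromov_boundary Y"
      "\<eta> \<in> gromov_boundary Y" "\<eta>' \<in> gromov_boundary Y" "distinct [\<xi>, \<xi>', \<eta>, \<eta>']"
    then show "cross_ratio X z (f \<xi>) (f \<xi>') (f \<eta>) (f \<eta>') = cross_ratio Y y \<xi> \<xi>' \<eta> \<eta>'"
      unfolding cross_ratio_def by (simp add: rhoX rhoY cross_ratio_cancel)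
  qed
  then have "hyperbolic_filling X Y f"
    using Y.good_gromov_hyperbolic by (simp add: hyperbolic_filling_def)
  then obtain H where H: "isometric_embedding Y X H" "extends_to_boundary Y H f"
    using assms(1) unfolding maximal_gromov_hyperbolic_def by blast
  have HX: "H y \<in> mspace X" if "y \<in> mspace Y" for y
    using H(1) that by (auto simp: isometric_embedding_def)
  have Hd: "mdist X (H y) (H z) = mdist Y y z" if "y \<in> mspace Y" "z \<in> mspace Y" for y z
    using H(1) that by (auto simp: isometric_embedding_def)
  text \<open>An embedding that extends \<open>f\<close> preserves differences of Busemann functions, so in coordinates
    it is a translation; the tight constraints in the ends leave only the trivial one.\<close>
  have diff: "\<phi> (H y) $ i - \<phi> (H z) $ i = co y $ i - co z $ i"
    if y: "y \<in> mspace Y" and z: "z \<in> mspace Y" for y z i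
  proof -
    obtain \<xi> where \<xi>: "\<xi> \<in> gromov_boundary Y" "Y.lab \<xi> = i"
      using Y.lab_bij by (metis UNIV_I bij_betw_iff_bijections)
    obtain r where r: "r \<in> \<xi>"
      using boundary_obtain_ray \<xi>(1) by blast
    have d: "Y.directed {0..} r i"
      using Y.lab_directed[OF \<xi>(1) r] \<xi>(2) by simp
    have "H \<circ> r \<in> e i"
      using H(2) \<xi> r by (auto simp: extends_to_boundary_def f_def)
    then have "(\<lambda>n. (mdist X (H y) ((H \<circ> r) (real n)) - mdist X x ((H \<circ> r) (real n))) -
        (mdist X (H z) ((H \<circ> r) (real n)) - mdist X x ((H \<circ> r) (real n)))) \<longlonglongrightarrow> b (e i) (H y) - b (e i) (H z)"
      by (intro tendsto_diff b[OF eB] HX y z)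
    moreover have "(mdist X (H y) ((H \<circ> r) (real n)) - mdist X x ((H \<circ> r) (real n))) -
        (mdist X (H z) ((H \<circ> r) (real n)) - mdist X x ((H \<circ> r) (real n))) =
        mdist Y y (r (real n)) - mdist Y z (r (real n))" for n
      using Hd[OF y Y.directed_rayD(2)[OF d, of "real n"]] Hd[OF z Y.directed_rayD(2)[OF d, of "real n"]]
      by simp
    ultimately have "(\<lambda>n. mdist Y y (r (real n)) - mdist Y z (r (real n))) \<longlonglongrightarrow> b (e i) (H y) - b (e i) (H z)"
      by simp
    then show ?thesis
      using LIMSEQ_unique[OF Y.directed_ray_busemann[OF d y z]] by (simp add: \<phi>_def)
  qed
  \<comment> \<open>Any point of \<open>Y\<close> serves; \<open>undefined\<close> is merely some
    index.\<close>
  define y0 where "y0 = Y.pt (end_point undefined (\<alpha> undefined))"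
  have y0: "y0 \<in> mspace Y"
    by (simp add: y0_def end_point_tspan)
  define c where "c i = \<phi> (H y0) $ i - co y0 $ i" for i
  have trans: "\<phi> (H y) $ i = co y $ i + c i" if "y \<in> mspace Y" for y i
    using diff[OF that y0, of i] by (simp add: c_def)
  have pair: "c i + c j = 0" if ne: "j \<noteq> i" for i j
  proof -
    \<comment> \<open>At this height both \<open>y\<close> and its image are in end
      \<open>i\<close>, so the pair \<open>i\<close>, \<open>j\<close> is tight at both. Subtracting
      the two equations leaves \<open>c i + c j = 0\<close>.\<close>
    define a where "a = min (\<alpha> i) (\<alpha> i - c i)"
    define y where "y = Y.pt (end_point i a)"
    have y: "y \<in> mspace Y" "co y = end_point i a"
      by (simp_all add: y_def a_def end_point_tspan)
    have "\<phi> (H y) $ i = a + c i"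
      using trans[OF y(1), of i] y(2) by simp
    then have "\<phi> (H y) $ i \<le> \<alpha> i"
      by (simp add: a_def)
    then have "\<phi> (H y) $ j = D i j - \<phi> (H y) $ i"
      using tspan_below_alpha[OF \<phi>_tspan[OF HX[OF y(1)]]] ne by (metis end_point_nth(2))
    then show ?thesis
      using trans[OF y(1), of i] trans[OF y(1), of j] y(2) ne by simp
  qed
  have "c i = 0" for i
  proof -
    \<comment> \<open>\<open>c\<close> changes sign along each edge of the triangle
      \<open>i\<close>, \<open>j\<close>, \<open>k\<close>, so it vanishes. With two indices the
      tight span would be a line, which can be translated.\<close>
    obtain j where j: "j \<noteq> i" using exists_other by blast
    obtain k where k: "k \<noteq> i" "k \<noteq> j" using exists_other by blast
    show ?thesis
      using pair[OF j] pair[OF k(1)] pair[OF k(2)] by simp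
  qed
  then have \<phi>H: "\<phi> (H y) = co y" if "y \<in> mspace Y" for y
    using trans[OF that] by (simp add: vec_eq_iff)
  have "tspan \<subseteq> \<phi> ` mspace X"
  proof
    fix v assume "v \<in> tspan"
    then have "v = \<phi> (H (Y.pt v))" "H (Y.pt v) \<in> mspace X"
      using \<phi>H HX by auto
    then show "v \<in> \<phi> ` mspace X" by blast
  qed
  then have "\<phi> ` mspace X = tspan"
    using \<phi>_tspan by blast
  then have "isometric_to_sup_norm_set X tspan"
    unfolding isometric_to_sup_norm_set_def using \<phi>_dist by blast
  moreover obtain \<P> :: "(real ^ 'n) set set" where "polyhedral_complex \<P>" "finite \<P>"
    "\<And>P. P \<in> \<P> \<Longrightarrow> real_of_int (aff_dim P) \<le> real CARD('n) / 2" "\<Union> \<P> = tspan"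
    "attached_half_lines CARD('n) \<P>"
    using tspan_polyhedral_complex by blast
  ultimately show ?thesis
    by (intro exI[of _ \<P>]) simp
qed

end
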